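(* For every $n\ge1$ and every $N\ge n$, the polynomial $$\delta_n\beta_n\in\mathbb Z[a_1,\ldots,a_n]$$ is primitive (it has integer coefficients with greatest common divisor $1$). Consequently, $\delta_n$ is the exact common denominator of $\mathrm{Bc}_N(b_n)$. In particular, the genus $\mathrm{Bc}_n$ detects exactly the odd part of $d_n=\frac{n+1}{2}\operatorname{lcm}(1,2,\ldots,2n+2)$, i.e. the exact common denominator of the coefficients of $\mathrm{Bc}_n(b_n)$ is the odd part of $d_n$.
   Context: $\Omega_U^*=MU^*(\mathrm{pt})$ is the complex cobordism ring. $F(u,v)\in\Omega_U^*[[u,v]]$ is the universal one-dimensional commutative formal group law, $g$ its logarithm, $f=g^{-1}$, $\bar u=f(-g(u))$, and $B(x)=x+\sum_{n\ge1}b_nx^{n+1}\in(\Omega_U^*\otimes\mathbb Q)[[x]]$ is the unique series with $B(u\bar u)=-g(u)^2$. For $N\ge1$ let $f_{\mathrm{Bc},N}(z)=z+O(z^3)$ be the unique odd series over $\mathbb Q[a_1,\ldots,a_N]$ with $$\bigl(f_{\mathrm{Bc},N}'(z)\bigr)^2=1-a_1f_{\mathrm{Bc},N}(z)^2+a_2f_{\mathrm{Bc},N}(z)^4-\cdots+(-1)^Na_Nf_{\mathrm{Bc},N}(z)^{2N},$$ and let $\mathrm{Bc}_N\colon\Omega_U^*\to\mathbb Q[a_1,\ldots,a_N]$ be the Hirzebruch genus with this exponential, $M\mapsto\langle\prod_i x_i/f_{\mathrm{Bc},N}(x_i),[M]\rangle$ with $x_i$ the formal tangent Chern roots (extended $\mathbb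 Q$-linearly). Applying $\mathrm{Bc}_N$ coefficientwise to $B$ gives $$B_{\mathrm{Bc},N}(x)=\left(\int_0^{\sqrt x}\frac{dt}{\sqrt{1+a_1t^2+\cdots+a_Nt^{2N}}}\right)^2 .$$ For $N\ge n$, the coefficient $\beta_n=[x^{n+1}]B_{\mathrm{Bc},N}(x)=\mathrm{Bc}_N(b_n)$ depends only on $a_1,\ldots,a_n$. Put $$\delta_n=\frac{d_n}{2^{\nu_2(d_n)}}=\frac{n+1}{2^{\nu_2(n+1)}}\operatorname{lcm}(1,3,5,\ldots,2n+1),$$ the odd part of $d_n$ ($\nu_2$ is the $2$-adic valuation). The exact common denominator of a rational polynomial is the least positive integer whose product with it has integer coefficients. *)

theory Defs
  imports
    "HOL-Library.Poly_Mapping"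
    "HOL-Computational_Algebra.Formal_Power_Series"
begin

unbundle fps_syntax

section \<open>Polynomials in arbitrarily many variables\<close>

type_synonym ('v, 'k) mpoly = "('v \<Rightarrow>\<^sub>0 nat) \<Rightarrow>\<^sub>0 'k"

abbreviation mconst :: "'k::zero \<Rightarrow> ('v, 'k) mpoly" where
  "mconst c \<equiv> Poly_Mapping.single 0 c"

definition mvar :: "'v \<Rightarrow> ('v, 'k::comm_ring_1) mpoly" where
  "mvar v = Poly_Mapping.single (Poly_Mapping.single v 1) 1"

definition is_ring_hom :: "('a::comm_ring_1 \<Rightarrow> 'b::comm_ring_1) \<Rightarrow> bool" where
  "is_ring_hom h \<longleftrightarrow>
     h 1 = 1 \<and> (\<forall>x y. h (x + y) = h x + h y) \<and> (\<forall>x y. h (x * y) = h x * h y)"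

definition monom_eval :: "('v \<Rightarrow> 'r::comm_ring_1) \<Rightarrow> ('v \<Rightarrow>\<^sub>0 nat) \<Rightarrow> 'r" where
  "monom_eval x m = (\<Prod>v\<in>Poly_Mapping.keys m. x v ^ Poly_Mapping.lookup m v)"

definition mpoly_eval :: "('k::comm_ring_1 \<Rightarrow> 'r::comm_ring_1) \<Rightarrow> ('v \<Rightarrow> 'r) \<Rightarrow> ('v, 'k) mpoly \<Rightarrow> 'r" where
  "mpoly_eval \<phi> x p = (\<Sum>m\<in>Poly_Mapping.keys p. \<phi> (Poly_Mapping.lookup p m) * monom_eval x m)"

lemma ring_hom_simps:
  assumes "is_ring_hom h"
  shows "h 0 = 0" "h 1 = 1" "h (x + y) = h x + h y" "h (x * y) = h x * h y"
    "h (- x) = - h x" "h (x - y) = h x - h y"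
proof -
  show a: "h 1 = 1" "h (x + y) = h x + h y" "h (x * y) = h x * h y" for x y
    using assms by (auto simp: is_ring_hom_def)
  show z: "h 0 = 0" using a(2)[of 0 0] by simp
  show u: "h (- x) = - h x" for x using a(2)[of x "- x"] z by (simp add: eq_neg_iff_add_eq_0 add.commute)
  show "h (x - y) = h x - h y" using a(2)[of x "- y"] u by simp
qed

lemma ring_hom_comp: "is_ring_hom f \<Longrightarrow> is_ring_hom g \<Longrightarrow> is_ring_hom (\<lambda>x. f (g x))"
  unfolding is_ring_hom_def by simp

lemma ring_hom_power: "is_ring_hom h \<Longrightarrow> h (x ^ n) = h x ^ n"
  by (induction n) (auto simp: ring_hom_simps)

lemma ring_hom_sum: "is_ring_hom h \<Longrightarrow> h (sum f A) = (\<Sum>a\<in>A. h (f a))"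
  by (induction A rule: infinite_finite_induct) (auto simp: ring_hom_simps)

lemma ring_hom_prod: "is_ring_hom h \<Longrightarrow> h (prod f A) = (\<Prod>a\<in>A. h (f a))"
  by (induction A rule: infinite_finite_induct) (auto simp: ring_hom_simps)

lemma monom_eval_superset:
  assumes "finite A" "Poly_Mapping.keys m \<subseteq> A"
  shows "monom_eval x m = (\<Prod>v\<in>A. x v ^ Poly_Mapping.lookup m v)"
  unfolding monom_eval_def
  by (rule prod.mono_neutral_left) (use assms in \<open>auto simp: in_keys_iff\<close>)

lemma monom_eval_add: "monom_eval x (m + n) = monom_eval x m * monom_eval x n"
proof -
  let ?A = "Poly_Mapping.keys m \<union> Poly_Mapping.keys n"
  have "Poly_Mapping.keys (m + n) \<subseteq> ?A" by (rule Poly_Mapping.keys_add)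
  then show ?thesis
    by (simp add: monom_eval_superset[of ?A] lookup_add power_add prod.distrib)
qed

lemma mpoly_eval_superset:
  assumes "is_ring_hom \<phi>" "finite A" "Poly_Mapping.keys p \<subseteq> A"
  shows "mpoly_eval \<phi> x p = (\<Sum>m\<in>A. \<phi> (Poly_Mapping.lookup p m) * monom_eval x m)"
  unfolding mpoly_eval_def
  by (rule sum.mono_neutral_left) (use assms in \<open>auto simp: in_keys_iff ring_hom_simps\<close>)

lemma mpoly_eval_single:
  assumes "is_ring_hom \<phi>"
  shows "mpoly_eval \<phi> x (Poly_Mapping.single m c) = \<phi> c * monom_eval x m"
  using assms by (subst mpoly_eval_superset[of \<phi> "{m}"]) auto

lemma mpoly_eval_add:
  assumes "is_ring_hom \<phi>"
  shows "mpoly_eval \<phi> x (p + q) = mpoly_eval \<phi> x p + mpoly_eval \<phi> x q"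
proof -
  let ?A = "Poly_Mapping.keys p \<union> Poly_Mapping.keys q"
  have "Poly_Mapping.keys (p + q) \<subseteq> ?A" by (rule Poly_Mapping.keys_add)
  then show ?thesis
    using assms
    by (simp add: mpoly_eval_superset[of \<phi> ?A] lookup_add ring_hom_simps distrib_right sum.distrib)
qed

lemma mpoly_induct [case_names zero add]:
  assumes "P 0" "\<And>p m c. P p \<Longrightarrow> P (p + Poly_Mapping.single m c)"
  shows "P (p :: ('v, 'k::comm_ring_1) mpoly)"
proof (induction p rule: update_induct)
  case const
  show ?case using assms(1) by (simp flip: zero_poly_mapping_def)
next
  case (update f a b)
  have "Poly_Mapping.update a b f = f + Poly_Mapping.single a b"
    using update(1)
    by (intro poly_mapping_eqI) (auto simp: lookup_update lookup_add lookup_single in_keys_iff when_def)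
  then show ?case using assms(2) update by metis
qed

lemma mpoly_eval_mult:
  assumes h: "is_ring_hom \<phi>"
  shows "mpoly_eval \<phi> x (p * q) = mpoly_eval \<phi> x p * mpoly_eval \<phi> x q"
proof (induction p rule: mpoly_induct)
  case zero
  then show ?case by (simp add: mpoly_eval_def)
next
  case (add p m c)
  have "mpoly_eval \<phi> x (Poly_Mapping.single m c * q) = mpoly_eval \<phi> x (Poly_Mapping.single m c) * mpoly_eval \<phi> x q"
  proof (induction q rule: mpoly_induct)
    case zero
    then show ?case by (simp add: mpoly_eval_def)
  next
    case (add q n d)
    then show ?case using h
      by (simp add: distrib_left mpoly_eval_add mult_single mpoly_eval_single monom_eval_add ring_hom_simps algebra_simps)
  qed
  with add show ?case using h by (simp add: distrib_right mpoly_eval_add)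
qed

lemma mpoly_eval_hom:
  assumes "is_ring_hom \<phi>"
  shows "is_ring_hom (mpoly_eval \<phi> x)"
proof -
  have "mpoly_eval \<phi> x 1 = 1"
    using mpoly_eval_single[OF assms, of x 0 1] assms by (simp add: ring_hom_simps monom_eval_def)
  then show ?thesis
    using assms by (auto simp: is_ring_hom_def[of "mpoly_eval \<phi> x"] mpoly_eval_add mpoly_eval_mult)
qed

lemma mpoly_eval_const: "is_ring_hom \<phi> \<Longrightarrow> mpoly_eval \<phi> x (mconst c) = \<phi> c"
  by (simp add: mpoly_eval_single monom_eval_def)

lemma mpoly_eval_var: "is_ring_hom \<phi> \<Longrightarrow> mpoly_eval \<phi> x (mvar v) = x v"
  by (simp add: mvar_def mpoly_eval_single monom_eval_def ring_hom_simps)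


section \<open>Power series in three variables and formal group laws\<close>

text \<open>
  \<open>'r fps3\<close> is \<open>R[[u,v,w]]\<close>, with \<open>w\<close> the outermost variable.
  Series in \<open>u\<close> and \<open>v\<close> only are also treated as elements of this ring.
\<close>

type_synonym 'r fps3 = "'r fps fps fps"

definition coeff3 :: "'r::zero fps3 \<Rightarrow> nat \<Rightarrow> nat \<Rightarrow> nat \<Rightarrow> 'r" where
  "coeff3 s p q r = s $ r $ q $ p"

definition series3 :: "(nat \<Rightarrow> nat \<Rightarrow> nat \<Rightarrow> 'r) \<Rightarrow> 'r::zero fps3" where
  "series3 a = Abs_fps (\<lambda>r. Abs_fps (\<lambda>q. Abs_fps (\<lambda>p. a p q r)))"

definition uvar :: "'r::comm_ring_1 fps3" where "uvar = fps_const (fps_const fps_X)"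
definition vvar :: "'r::comm_ring_1 fps3" where "vvar = fps_const fps_X"
definition wvar :: "'r::comm_ring_1 fps3" where "wvar = fps_X"

text \<open>
  Substitution into a series in one variable and into a series
  \<open>\<Sum> c\<^sub>i\<^sub>j x\<^sup>i y\<^sup>j\<close> in two variables. For \<open>x\<close> and \<open>y\<close> with zero constant term the
  summands cut off do not contribute to the coefficient in question.
\<close>

definition subst1 :: "'r::comm_ring_1 fps \<Rightarrow> 'r fps3 \<Rightarrow> 'r fps3" where
  "subst1 g x = series3 (\<lambda>p q r. \<Sum>k\<le>p+q+r. g $ k * coeff3 (x ^ k) p q r)"

definition subst2 :: "(nat \<Rightarrow> nat \<Rightarrow> 'r::comm_ring_1) \<Rightarrow> 'r fps3 \<Rightarrow> 'r fps3 \<Rightarrow> 'r fps3" where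
  "subst2 c x y =
     series3 (\<lambda>p q r. \<Sum>i\<le>p+q+r. \<Sum>j\<le>p+q+r. c i j * coeff3 (x ^ i * y ^ j) p q r)"

text \<open>The series \<open>F(u,v) = \<Sum> c\<^sub>i\<^sub>j u\<^sup>i v\<^sup>j\<close> is represented by its coefficients \<open>c\<close>.\<close>

definition is_fgl :: "(nat \<Rightarrow> nat \<Rightarrow> 'r::comm_ring_1) \<Rightarrow> bool" where
  "is_fgl c \<longleftrightarrow>
     subst2 c uvar 0 = uvar \<and> subst2 c 0 vvar = vvar \<and>
     subst2 c uvar vvar = subst2 c vvar uvar \<and>
     subst2 c (subst2 c uvar vvar) wvar = subst2 c uvar (subst2 c vvar wvar)"

definition is_logarithm :: "(nat \<Rightarrow> nat \<Rightarrow> 'r::comm_ring_1) \<Rightarrow> 'r fps \<Rightarrow> bool" where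
  "is_logarithm c g \<longleftrightarrow>
     g $ 0 = 0 \<and> g $ 1 = 1 \<and> subst1 g (subst2 c uvar vvar) = subst1 g uvar + subst1 g vvar"

definition fgl_defects :: "(nat \<Rightarrow> nat \<Rightarrow> 'r::comm_ring_1) \<Rightarrow> 'r set" where
  "fgl_defects c =
     (\<Union>s \<in>
        {subst2 c uvar 0 - uvar, subst2 c 0 vvar - vvar,
         subst2 c uvar vvar - subst2 c vvar uvar,
         subst2 c (subst2 c uvar vvar) wvar - subst2 c uvar (subst2 c vvar wvar)}.
        range (\<lambda>(p, q, r). coeff3 s p q r))"

lemma fps3_eq_iff: "s = t \<longleftrightarrow> (\<forall>p q r. coeff3 s p q r = coeff3 t p q r)"
  by (auto simp: coeff3_def fps_eq_iff)

lemma coeff3_simps [simp]: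
  "coeff3 (series3 a) p q r = a p q r"
  "coeff3 (s + t) p q r = coeff3 s p q r + coeff3 t p q r"
  "coeff3 (s' - t') p q r = coeff3 s' p q r - coeff3 t' p q r"
  by (simp_all add: coeff3_def series3_def)

lemma coeff3_0 [simp]: "coeff3 0 p q r = 0"
  by (simp add: coeff3_def)

lemma coeff3_mult:
  "coeff3 (s * t) p q r =
     (\<Sum>k\<le>r. \<Sum>j\<le>q. \<Sum>i\<le>p. coeff3 s i j k * coeff3 t (p - i) (q - j) (r - k))"
  by (simp add: coeff3_def fps_mult_nth fps_sum_nth atLeast0AtMost)

lemma is_fgl_iff_defects: "is_fgl c \<longleftrightarrow> fgl_defects c \<subseteq> {0}"
proof -
  have *: "range (\<lambda>(p, q, r). coeff3 (s - t) p q r) \<subseteq> {0} \<longleftrightarrow> s = t" for s t :: "'a fps3"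
    by (auto simp: fps3_eq_iff[of s t] image_subset_iff)
  show ?thesis
    unfolding is_fgl_def fgl_defects_def UN_insert UN_empty Un_subset_iff * by blast
qed

definition map3 :: "('r::comm_ring_1 \<Rightarrow> 's::comm_ring_1) \<Rightarrow> 'r fps3 \<Rightarrow> 's fps3" where
  "map3 h s = series3 (\<lambda>p q r. h (coeff3 s p q r))"

lemma coeff3_map3 [simp]: "coeff3 (map3 h s) p q r = h (coeff3 s p q r)"
  by (simp add: map3_def)

lemma map3_simps:
  assumes "is_ring_hom h"
  shows "map3 h 0 = 0" "map3 h 1 = 1" "map3 h (s * t) = map3 h s * map3 h t"
    "map3 h (s - t) = map3 h s - map3 h t"
    "map3 h uvar = uvar" "map3 h vvar = vvar" "map3 h wvar = wvar"
proof -
  note rs = ring_hom_simps[OF assms]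
  show "map3 h 0 = 0" "map3 h (s - t) = map3 h s - map3 h t"
    by (simp_all add: fps3_eq_iff rs)
  show "map3 h (s * t) = map3 h s * map3 h t"
    by (simp add: fps3_eq_iff coeff3_mult rs ring_hom_sum[OF assms])
  show "map3 h 1 = 1"
    by (simp add: fps3_eq_iff) (simp add: coeff3_def rs fps_one_nth)
  show "map3 h uvar = uvar" "map3 h vvar = vvar" "map3 h wvar = wvar"
    by (simp_all add: fps3_eq_iff) (simp_all add: coeff3_def uvar_def vvar_def wvar_def fps_X_def fps_const_def rs)
qed

lemma map3_power: "is_ring_hom h \<Longrightarrow> map3 h (s ^ n) = map3 h s ^ n"
  by (induction n) (auto simp: map3_simps)

lemma map3_subst2:
  assumes "is_ring_hom h"
  shows "map3 h (subst2 c x y) = subst2 (\<lambda>i j. h (c i j)) (map3 h x) (map3 h y)"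
proof -
  have "h (coeff3 (x ^ i * y ^ j) p q r) = coeff3 (map3 h x ^ i * map3 h y ^ j) p q r" for i j p q r
    using coeff3_map3[of h "x ^ i * y ^ j" p q r] by (simp only: map3_simps[OF assms] map3_power[OF assms])
  then show ?thesis
    by (simp add: fps3_eq_iff subst2_def ring_hom_sum[OF assms] ring_hom_simps[OF assms])
qed

lemma fgl_defects_hom:
  assumes "is_ring_hom h"
  shows "fgl_defects (\<lambda>i j. h (c i j)) = h ` fgl_defects c"
proof -
  let ?S = "\<lambda>c. {subst2 c uvar 0 - uvar, subst2 c 0 vvar - vvar,
         subst2 c uvar vvar - subst2 c vvar uvar,
         subst2 c (subst2 c uvar vvar) wvar - subst2 c uvar (subst2 c vvar wvar)}"
  have S: "?S (\<lambda>i j. h (c i j)) = map3 h ` ?S c"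
    by (simp add: map3_simps[OF assms] map3_subst2[OF assms])
  show ?thesis
    unfolding fgl_defects_def S by (simp only: image_UN image_image) (simp add: case_prod_unfold)
qed


section \<open>The coefficient ring of the universal formal group law\<close>

inductive_set ideal_span :: "'a::comm_ring_1 set \<Rightarrow> 'a set" for S where
  zero: "0 \<in> ideal_span S"
| step: "p \<in> ideal_span S \<Longrightarrow> s \<in> S \<Longrightarrow> p + a * s \<in> ideal_span S"

lemma ideal_span_base: "s \<in> S \<Longrightarrow> s \<in> ideal_span S"
  using ideal_span.step[OF ideal_span.zero, of s S 1] by simp

lemma ideal_span_add: "p \<in> ideal_span S \<Longrightarrow> q \<in> ideal_span S \<Longrightarrow> p + q \<in> ideal_span S"
proof (rotate_tac 1, induction q rule: ideal_span.induct)
qed (auto intro: ideal_span.intros simp: add.assoc[symmetric])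

lemma ideal_span_mult: "p \<in> ideal_span S \<Longrightarrow> a * p \<in> ideal_span S"
  by (induction p rule: ideal_span.induct)
     (auto intro: ideal_span.intros simp: distrib_left mult.assoc[symmetric])

lemma ideal_span_uminus: "p \<in> ideal_span S \<Longrightarrow> - p \<in> ideal_span S"
  using ideal_span_mult[of p S "-1"] by simp

text \<open>
  For a coefficient ring \<open>k\<close>, the type \<open>'k lazard\<close> is \<open>k[c\<^sub>i\<^sub>j]\<close> modulo the ideal
  generated by the conditions for \<open>\<Sum> c\<^sub>i\<^sub>j u\<^sup>i v\<^sup>j\<close> to be a formal group law, that is, \<open>k\<close>
  tensored with the Lazard ring; see \<open>lazard_universal\<close> below. By Quillen's theorem
  \<open>int lazard\<close> is the complex cobordism ring with its formal group law, so
  \<open>rat lazard\<close> is its rationalization.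
\<close>

definition lazard_rel :: "(nat \<times> nat, 'k::comm_ring_1) mpoly \<Rightarrow> (nat \<times> nat, 'k) mpoly \<Rightarrow> bool" where
  "lazard_rel p q \<longleftrightarrow> p - q \<in> ideal_span (fgl_defects (\<lambda>i j. mvar (i, j)))"

quotient_type (overloaded) 'k lazard = "(nat \<times> nat, 'k::comm_ring_1) mpoly" / lazard_rel
proof (rule equivpI)
  show "reflp (lazard_rel :: (nat \<times> nat, 'k) mpoly \<Rightarrow> _)"
    by (auto simp: reflp_def lazard_rel_def intro: ideal_span.zero)
  show "symp (lazard_rel :: (nat \<times> nat, 'k) mpoly \<Rightarrow> _)"
    unfolding symp_def lazard_rel_def by (metis ideal_span_uminus minus_diff_eq)
  show "transp (lazard_rel :: (nat \<times> nat, 'k) mpoly \<Rightarrow> _)"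
  proof (rule transpI)
    fix p q r :: "(nat \<times> nat, 'k) mpoly"
    assume "lazard_rel p q" "lazard_rel q r"
    then show "lazard_rel p r"
      unfolding lazard_rel_def using ideal_span_add[of "p - q" _ "q - r"] by simp
  qed
qed

lemma mconst_hom: "is_ring_hom (mconst :: 'k::comm_ring_1 \<Rightarrow> ('v, 'k) mpoly)"
  by (simp add: is_ring_hom_def single_add mult_single)

lemma id_hom: "is_ring_hom (\<lambda>x. x)"
  by (simp add: is_ring_hom_def)

lemma mpoly_eval_ideal:
  assumes "is_ring_hom \<phi>" "is_fgl c"
    and "p \<in> ideal_span (fgl_defects (\<lambda>i j. mvar (i, j)))"
  shows "mpoly_eval \<phi> (\<lambda>(i, j). c i j) p = 0"
proof -
  let ?e = "mpoly_eval \<phi> (\<lambda>(i, j). c i j)"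
  have e: "is_ring_hom ?e" by (rule mpoly_eval_hom[OF assms(1)])
  have "?e ` fgl_defects (\<lambda>i j. mvar (i, j)) = fgl_defects c"
    using fgl_defects_hom[OF e, of "\<lambda>i j. mvar (i, j)"] by (simp add: mpoly_eval_var[OF assms(1)])
  then have d: "?e s = 0" if "s \<in> fgl_defects (\<lambda>i j. mvar (i, j))" for s
    using that assms(2) by (auto simp: is_fgl_iff_defects)
  show ?thesis using assms(3)
    by (induction rule: ideal_span.induct) (auto simp: ring_hom_simps[OF e] d)
qed

lemma coeff3_vars:
  "coeff3 uvar p q r = (if p = 1 \<and> q = 0 \<and> r = 0 then 1 else 0)"
  "coeff3 vvar p q r = (if p = 0 \<and> q = 1 \<and> r = 0 then 1 else 0)"
  "coeff3 wvar p q r = (if p = 0 \<and> q = 0 \<and> r = 1 then 1 else 0)"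
  by (auto simp: coeff3_def uvar_def vvar_def wvar_def fps_X_def)

lemma is_fgl_additive: "is_fgl (\<lambda>i j. if i + j = 1 then 1 else (0::'r::comm_ring_1))"
proof -
  let ?c = "\<lambda>i j. if i + j = 1 then 1 else (0::'r)"
  have *: "subst2 ?c x y = x + y" if "coeff3 x 0 0 0 = 0" "coeff3 y 0 0 0 = 0" for x y :: "'r fps3"
  proof -
    have "(\<Sum>i\<le>n. \<Sum>j\<le>n. ?c i j * coeff3 (x ^ i * y ^ j) p q r) = coeff3 x p q r + coeff3 y p q r"
      if n: "n = p + q + r" for n p q r
    proof (cases n)
      case 0
      then show ?thesis using n \<open>coeff3 x 0 0 0 = 0\<close> \<open>coeff3 y 0 0 0 = 0\<close> by simp
    next
      case (Suc m)
      have "(\<Sum>i\<le>n. \<Sum>j\<le>n. ?c i j * coeff3 (x ^ i * y ^ j) p q r)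
          = (\<Sum>(i, j)\<in>{..n} \<times> {..n}. ?c i j * coeff3 (x ^ i * y ^ j) p q r)"
        by (simp add: sum.cartesian_product)
      also have "\<dots> = (\<Sum>(i, j)\<in>{(0, 1), (1, 0)}. ?c i j * coeff3 (x ^ i * y ^ j) p q r)"
        using Suc by (intro sum.mono_neutral_right) (auto simp: add_is_1 split: if_splits)
      also have "\<dots> = coeff3 x p q r + coeff3 y p q r"
        by simp
      finally show ?thesis .
    qed
    then show ?thesis by (simp add: fps3_eq_iff subst2_def)
  qed
  have v: "coeff3 uvar 0 0 0 = (0::'r)" "coeff3 vvar 0 0 0 = (0::'r)" "coeff3 wvar 0 0 0 = (0::'r)"
    by (simp_all add: coeff3_vars)
  show ?thesis
    unfolding is_fgl_def by (simp only: * v coeff3_simps coeff3_0 add_0 add_0_right ac_simps simp_thms)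
qed

lemma not_lazard_rel_0_1: "\<not> lazard_rel (0 :: (nat \<times> nat, 'k::comm_ring_1) mpoly) 1"
proof
  assume "lazard_rel (0 :: (nat \<times> nat, 'k) mpoly) 1"
  then have "mpoly_eval (\<lambda>x::'k. x) (\<lambda>(i, j). if i + j = 1 then 1 else 0) (0 - 1 :: (nat \<times> nat, 'k) mpoly) = 0"
    unfolding lazard_rel_def
    using mpoly_eval_ideal[OF id_hom is_fgl_additive, of "0 - 1 :: (nat \<times> nat, 'k) mpoly"] by blast
  then show False
    using ring_hom_simps[OF mpoly_eval_hom[OF id_hom]] by (simp add: ring_hom_simps[OF mpoly_eval_hom[OF id_hom]])
qed

instantiation lazard :: (comm_ring_1) comm_ring_1
begin

lift_definition zero_lazard :: "'a lazard" is 0 .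
lift_definition one_lazard :: "'a lazard" is 1 .

lift_definition plus_lazard :: "'a lazard \<Rightarrow> 'a lazard \<Rightarrow> 'a lazard" is "(+)"
  unfolding lazard_rel_def by (metis add_diff_add ideal_span_add)

lift_definition uminus_lazard :: "'a lazard \<Rightarrow> 'a lazard" is uminus
  unfolding lazard_rel_def by (metis ideal_span_uminus minus_diff_minus)

lift_definition minus_lazard :: "'a lazard \<Rightarrow> 'a lazard \<Rightarrow> 'a lazard" is "(-)"
proof -
  fix p p' q q' :: "(nat \<times> nat, 'a) mpoly"
  assume "lazard_rel p p'" "lazard_rel q q'"
  moreover have "p - q - (p' - q') = (p - p') + - (q - q')" by simp
  ultimately show "lazard_rel (p - q) (p' - q')"
    unfolding lazard_rel_def by (metis ideal_span_add ideal_span_uminus)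
qed

lift_definition times_lazard :: "'a lazard \<Rightarrow> 'a lazard \<Rightarrow> 'a lazard" is "(*)"
proof -
  fix p p' q q' :: "(nat \<times> nat, 'a) mpoly"
  assume "lazard_rel p p'" "lazard_rel q q'"
  moreover have "p * q - p' * q' = q * (p - p') + p' * (q - q')" by (simp add: algebra_simps)
  ultimately show "lazard_rel (p * q) (p' * q')"
    unfolding lazard_rel_def by (metis ideal_span_add ideal_span_mult)
qed

instance
proof
  fix a b c :: "'a lazard"
  have r: "lazard_rel p p" for p :: "(nat \<times> nat, 'a) mpoly"
    by (simp add: lazard_rel_def ideal_span.zero)
  show "a + b + c = a + (b + c)" by transfer (simp add: add.assoc r)
  show "a + b = b + a" by transfer (simp add: add.commute r)
  show "0 + a = a" by transfer (simp add: r)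
  show "- a + a = 0" by transfer (simp add: r)
  show "a - b = a + - b" by transfer (simp add: r)
  show "a * b * c = a * (b * c)" by transfer (simp add: mult.assoc r)
  show "a * b = b * a" by transfer (simp add: mult.commute r)
  show "1 * a = a" by transfer (simp add: r)
  show "(a + b) * c = a * c + b * c" by transfer (simp add: distrib_right r)
  show "(0 :: 'a lazard) \<noteq> 1" by transfer (rule not_lazard_rel_0_1)
qed

end

lift_definition lazard_const :: "'k::comm_ring_1 \<Rightarrow> 'k lazard" is mconst .

lift_definition universal_fgl :: "nat \<Rightarrow> nat \<Rightarrow> 'k::comm_ring_1 lazard" is "\<lambda>i j. mvar (i, j)" .

lemma abs_lazard_hom: "is_ring_hom (abs_lazard :: (nat \<times> nat, 'k::comm_ring_1) mpoly \<Rightarrow> 'k lazard)"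
  unfolding is_ring_hom_def
  by (simp add: one_lazard.abs_eq plus_lazard.abs_eq times_lazard.abs_eq)

lemma is_fgl_universal: "is_fgl (universal_fgl :: nat \<Rightarrow> nat \<Rightarrow> 'k::comm_ring_1 lazard)"
proof -
  have d: "abs_lazard s = 0" if "s \<in> fgl_defects (\<lambda>i j. mvar (i, j))" for s :: "(nat \<times> nat, 'k) mpoly"
    using that by (simp add: zero_lazard_def lazard.abs_eq_iff lazard_rel_def ideal_span_base)
  have u: "universal_fgl = (\<lambda>i j. abs_lazard (mvar (i, j) :: (nat \<times> nat, 'k) mpoly))"
    by (simp add: universal_fgl.abs_eq fun_eq_iff)
  show ?thesis
    unfolding is_fgl_iff_defects u fgl_defects_hom[OF abs_lazard_hom] by (auto simp: d)
qed

lemma mpoly_hom_eq_eval: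
  assumes "is_ring_hom h"
  shows "h p = mpoly_eval (\<lambda>c. h (mconst c)) (\<lambda>v. h (mvar v)) p"
proof -
  let ?\<phi> = "\<lambda>c. h (mconst c)"
  have \<phi>: "is_ring_hom ?\<phi>"
    by (rule ring_hom_comp[OF assms mconst_hom])
  let ?e = "mpoly_eval ?\<phi> (\<lambda>v. h (mvar v))"
  have e: "is_ring_hom ?e" by (rule mpoly_eval_hom[OF \<phi>])
  have mon: "h (Poly_Mapping.single m 1) = ?e (Poly_Mapping.single m 1)" for m :: "'a \<Rightarrow>\<^sub>0 nat"
  proof -
    have pw: "h (Poly_Mapping.single (Poly_Mapping.single v n) 1) = h (mvar v) ^ n" for v n
    proof (induction n)
      case 0
      then show ?case using assms by (simp add: ring_hom_simps)
    next
      case (Suc n)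
      have "Poly_Mapping.single (Poly_Mapping.single v (Suc n)) 1 = mvar v * (Poly_Mapping.single (Poly_Mapping.single v n) 1 :: ('a, 'b) mpoly)"
        by (simp add: mvar_def mult_single single_add[symmetric])
      with Suc show ?case using assms by (simp add: ring_hom_simps)
    qed
    show ?thesis
    proof (induction m rule: update_induct)
      case const
      then show ?case using assms e by (simp add: zero_poly_mapping_def[symmetric] ring_hom_simps)
    next
      case (update f a b)
      have "Poly_Mapping.update a b f = f + Poly_Mapping.single a b"
        using update(1)
        by (intro poly_mapping_eqI) (auto simp: lookup_update lookup_add lookup_single in_keys_iff when_def)
      then have *: "Poly_Mapping.single (Poly_Mapping.update a b f) 1
          = Poly_Mapping.single f 1 * (Poly_Mapping.single (Poly_Mapping.single a b) 1 :: ('a, 'b) mpoly)"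
        by (simp add: mult_single)
      have "?e (Poly_Mapping.single (Poly_Mapping.single a b) 1) = h (mvar a) ^ b"
        using \<phi> assms by (simp add: mpoly_eval_single monom_eval_def ring_hom_simps)
      with update show ?case using assms e unfolding * by (simp add: ring_hom_simps pw)
    qed
  qed
  have sm: "Poly_Mapping.single m c = mconst c * (Poly_Mapping.single m 1 :: ('a, 'b) mpoly)" for m c
    by (simp add: mult_single)
  show ?thesis
  proof (induction p rule: mpoly_induct)
    case zero
    then show ?case using assms e by (simp add: ring_hom_simps)
  next
    case (add p m c)
    then show ?case
      unfolding sm[of m c]
      by (simp add: ring_hom_simps[OF assms] ring_hom_simps[OF e] mon mpoly_eval_const[OF \<phi>])
  qed
qed

theorem lazard_universal:
  fixes \<phi> :: "'k::comm_ring_1 \<Rightarrow> 'r::comm_ring_1"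
  assumes "is_ring_hom \<phi>" "is_fgl c"
  shows "\<exists>!h. is_ring_hom h \<and> (\<forall>a. h (lazard_const a) = \<phi> a) \<and> (\<forall>i j. h (universal_fgl i j) = c i j)"
proof (rule ex_ex1I)
  let ?e = "mpoly_eval \<phi> (\<lambda>(i, j). c i j)"
  have e: "is_ring_hom ?e" by (rule mpoly_eval_hom[OF assms(1)])
  have wd: "?e p = ?e q" if "lazard_rel p q" for p q
    using mpoly_eval_ideal[OF assms, of "p - q"] that by (simp add: lazard_rel_def ring_hom_simps[OF e])
  define h where "h = (\<lambda>x. ?e (rep_lazard x))"
  have h: "h (abs_lazard p) = ?e p" for p
    unfolding h_def by (rule wd) (metis Quotient3_lazard Quotient3_rep_abs equivp_reflp lazard_equivp)
  have "h (x + y) = h x + h y" "h (x * y) = h x * h y" for x y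
    by (induction x rule: lazard.abs_induct; induction y rule: lazard.abs_induct;
        simp add: plus_lazard.abs_eq times_lazard.abs_eq h ring_hom_simps[OF e])+
  then have "is_ring_hom h"
    by (simp add: is_ring_hom_def one_lazard_def h ring_hom_simps[OF e])
  then show "\<exists>h. is_ring_hom h \<and> (\<forall>a. h (lazard_const a) = \<phi> a) \<and> (\<forall>i j. h (universal_fgl i j) = c i j)"
    by (intro exI[of _ h])
       (simp add: lazard_const.abs_eq universal_fgl.abs_eq h mpoly_eval_const[OF assms(1)] mpoly_eval_var[OF assms(1)])
next
  fix h h' :: "'k lazard \<Rightarrow> 'r"
  assume a: "is_ring_hom h \<and> (\<forall>a. h (lazard_const a) = \<phi> a) \<and> (\<forall>i j. h (universal_fgl i j) = c i j)"
    "is_ring_hom h' \<and> (\<forall>a. h' (lazard_const a) = \<phi> a) \<and> (\<forall>i j. h' (universal_fgl i j) = c i j)"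
  have "h (abs_lazard p) = mpoly_eval \<phi> (\<lambda>(i, j). c i j) p"
    if "is_ring_hom h \<and> (\<forall>a. h (lazard_const a) = \<phi> a) \<and> (\<forall>i j. h (universal_fgl i j) = c i j)"
    for h :: "'k lazard \<Rightarrow> 'r" and p
  proof -
    have "is_ring_hom (\<lambda>p. h (abs_lazard p))"
      using that by (intro ring_hom_comp[OF _ abs_lazard_hom]) simp
    moreover have "(\<lambda>a. h (abs_lazard (mconst a))) = \<phi>"
      using that by (simp add: lazard_const.abs_eq[symmetric])
    moreover have "h (abs_lazard (mvar v)) = (case v of (i, j) \<Rightarrow> c i j)" for v
      using that by (cases v) (simp add: universal_fgl.abs_eq[symmetric])
    ultimately show ?thesis
      using mpoly_hom_eq_eval[of "\<lambda>p. h (abs_lazard p)" p] by simp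
  qed
  from this[OF a(1)] this[OF a(2)] have "h (abs_lazard p) = h' (abs_lazard p)" for p
    by simp
  then show "h = h'"
    by (intro ext) (rule lazard.abs_induct)
qed


section \<open>The classes \<open>b\<^sub>n\<close>\<close>

definition g_U :: "rat lazard fps" where
  "g_U = (THE g. is_logarithm universal_fgl g)"

definition f_U :: "rat lazard fps" where
  "f_U = (THE f. f $ 0 = 0 \<and> g_U oo f = fps_X)"

definition ubar :: "rat lazard fps" where
  "ubar = f_U oo (- g_U)"

definition B_U :: "rat lazard fps" where
  "B_U = (THE B. B $ 0 = 0 \<and> B $ 1 = 1 \<and> B oo (fps_X * ubar) = - (g_U ^ 2))"

definition b_U :: "nat \<Rightarrow> rat lazard" where
  "b_U n = B_U $ (n + 1)"


section \<open>Characteristic numbers and Hirzebruch genera\<close>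

text \<open>Mishchenko's theorem: \<open>g(u) = \<Sum> [CP\<^sup>n] u\<^sup>n\<^sup>+\<^sup>1 / (n + 1)\<close>.\<close>

definition CP :: "nat \<Rightarrow> rat lazard" where
  "CP n = of_nat (n + 1) * g_U $ (n + 1)"

text \<open>
  \<open>Q(x) = 1 + q\<^sub>1 x + q\<^sub>2 x\<^sup>2 + \<dots>\<close> with indeterminate coefficients. A monomial \<open>q\<^sup>\<mu>\<close> of
  \<open>\<rat>[q\<^sub>1, q\<^sub>2, \<dots>]\<close> is a partition \<open>\<mu>\<close>, given by the multiplicities of its parts, and
  \<open>\<Prod>\<^sub>i Q(x\<^sub>i) = \<Sum>\<^sub>\<mu> m\<^sub>\<mu>(x) q\<^sup>\<mu>\<close> with \<open>m\<^sub>\<mu>\<close> the monomial symmetric functions.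
\<close>

definition generic_series :: "(nat, rat) mpoly fps" where
  "generic_series = Abs_fps (\<lambda>j. if j = 0 then 1 else mvar j)"

text \<open>
  \<open>M \<mapsto> \<langle>\<Prod>\<^sub>i Q(x\<^sub>i), [M]\<rangle>\<close> is multiplicative, and the classes of the projective spaces
  generate the rational cobordism ring. The tangent bundle of \<open>CP\<^sup>n\<close> is stably the
  sum of \<open>n + 1\<close> copies of the hyperplane bundle, so that all \<open>n + 1\<close> Chern roots are the
  hyperplane class \<open>x\<close>, and \<open>\<langle>x\<^sup>n, [CP\<^sup>n]\<rangle> = 1\<close>.
\<close>

definition total_char_number :: "rat lazard \<Rightarrow> (nat, rat) mpoly" where
  "total_char_number = (THE h. is_ring_hom h \<and> (\<forall>c. h (lazard_const c) = mconst c) \<and>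
     (\<forall>n. h (CP n) = (generic_series ^ (n + 1)) $ n))"

text \<open>\<open>char_number \<mu> M = \<langle>m\<^sub>\<mu>(x\<^sub>1, x\<^sub>2, \<dots>), [M]\<rangle>\<close>\<close>

definition char_number :: "(nat \<Rightarrow>\<^sub>0 nat) \<Rightarrow> rat lazard \<Rightarrow> rat" where
  "char_number \<mu> M = Poly_Mapping.lookup (total_char_number M) \<mu>"

definition x_over :: "'r::comm_ring_1 fps \<Rightarrow> 'r fps" where
  "x_over f = (THE q. q * f = fps_X)"

text \<open>
  \<open>\<langle>\<Prod>\<^sub>i x\<^sub>i / f(x\<^sub>i), [M]\<rangle>\<close>, the product being expanded into the \<open>m\<^sub>\<mu>(x\<^sub>1, x\<^sub>2, \<dots>)\<close>.
\<close>

definition hirzebruch_genus :: "('v, rat) mpoly fps \<Rightarrow> rat lazard \<Rightarrow> ('v, rat) mpoly" where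
  "hirzebruch_genus f M =
     (\<Sum>\<mu> | char_number \<mu> M \<noteq> 0. mconst (char_number \<mu> M) * monom_eval (\<lambda>j. x_over f $ j) \<mu>)"


section \<open>The genera \<open>Bc\<^sub>N\<close>\<close>

text \<open>The variable with index \<open>k\<close> is \<open>a\<^sub>k\<close>.\<close>

definition f_Bc :: "nat \<Rightarrow> (nat, rat) mpoly fps" where
  "f_Bc N = (THE f. (\<forall>k. even k \<longrightarrow> f $ k = 0) \<and> f $ 1 = 1 \<and>
     fps_deriv f ^ 2 = 1 + (\<Sum>k=1..N. fps_const ((-1) ^ k * mvar k) * f ^ (2 * k)))"

definition Bc :: "nat \<Rightarrow> rat lazard \<Rightarrow> (nat, rat) mpoly" where
  "Bc N = hirzebruch_genus (f_Bc N)"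


section \<open>Integrality and denominators\<close>

definition poly_over_Z_in :: "nat set \<Rightarrow> (nat, rat) mpoly \<Rightarrow> bool" where
  "poly_over_Z_in V p \<longleftrightarrow>
     (\<forall>m. Poly_Mapping.lookup p m \<in> \<int>) \<and> (\<forall>m\<in>Poly_Mapping.keys p. Poly_Mapping.keys m \<subseteq> V)"

definition primitive_over_Z :: "(nat, rat) mpoly \<Rightarrow> bool" where
  "primitive_over_Z p \<longleftrightarrow>
     (\<exists>c :: (nat \<Rightarrow>\<^sub>0 nat) \<Rightarrow> int. (\<forall>m. Poly_Mapping.lookup p m = of_int (c m)) \<and> Gcd (range c) = 1)"

definition exact_denominator :: "('v, rat) mpoly \<Rightarrow> nat" where
  "exact_denominator p = (LEAST d. d > 0 \<and> (\<forall>m. of_nat d * Poly_Mapping.lookup p m \<in> \<int>))"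

definition odd_part :: "nat \<Rightarrow> nat" where
  "odd_part m = m div 2 ^ multiplicity 2 m"

definition d_den :: "nat \<Rightarrow> nat" where
  "d_den n = (n + 1) * Lcm {1..2 * n + 2} div 2"

definition \<delta>_den :: "nat \<Rightarrow> nat" where
  "\<delta>_den n = odd_part (n + 1) * Lcm {k. odd k \<and> k \<le> 2 * n + 1}"

end

theory Submission
  imports Defs "HOL-Computational_Algebra.Primes"
begin

text \<open>
  Over \<open>\<rat>\<close> a formal group law is determined by its logarithm, so a genus is determined by the
  image \<open>g\<close> of the universal logarithm; by Lagrange inversion, for the genus with exponential \<open>f\<close>
  this image is the compositional inverse of \<open>f\<close>. If \<open>f\<close> is odd, the formal inverse of \<open>u\<close> is \<open>- u\<close>, and \<open>B\<close> is mapped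
  to \<open>x G(x)\<^sup>2\<close> with \<open>G + 2 x G' = C\<close> and \<open>C\<^sup>2 R = 1\<close>, where \<open>R = 1 + a\<^sub>1 x + a\<^sub>2 x\<^sup>2 + \<dots>\<close>.

  The derivative of \<open>x G\<^sup>2\<close> is \<open>w = G C\<close>, with coefficients \<open>\<gamma>\<^sub>n = (n + 1) \<beta>\<^sub>n\<close>. Away from 2 the
  denominators of \<open>G C\<close> come only from \<open>1 / (2 i + 1)\<close> with \<open>i \<le> n\<close>, while \<open>R w\<^sup>2 = G\<^sup>2\<close> is a recursion
  for \<open>\<beta>\<^sub>n\<close> that divides only by odd numbers. This gives integrality. For primitivity, the linear
  equation \<open>R (2 x w' + w) + x R' w = 1\<close> yields the coefficients of \<open>a\<^sub>n\<close> and of \<open>a\<^sub>h a\<^sub>j\<close> (\<open>h + j = n\<close>) in \<open>\<gamma>\<^sub>n\<close>.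
  For an odd prime \<open>p\<close> and the largest power \<open>p\<^sup>e \<le> 2 n + 1\<close>, the coefficient of \<open>a\<^sub>n\<close> has the worst possible
  denominator if \<open>p\<^sup>e\<close> divides \<open>2 n + 1\<close>; otherwise that of \<open>a\<^sub>h a\<^sub>j\<close> with \<open>2 h + 1 = p\<^sup>e\<close> does. For \<open>p = 2\<close> the
  coefficient of \<open>a\<^sub>n\<close> in \<open>\<beta>\<^sub>n\<close> is \<open>- 1 / (2 n + 1)\<close>.
\<close>

section \<open>The order filtration on power series in three variables\<close>

definition const3 :: "'r::comm_ring_1 \<Rightarrow> 'r fps3" where
  "const3 a = fps_const (fps_const (fps_const a))"

lemma const3_hom: "is_ring_hom const3"
  by (simp add: is_ring_hom_def const3_def)

lemma coeff3_const3_mult [simp]: "coeff3 (const3 a * s) p q r = a * coeff3 s p q r"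
  by (simp add: coeff3_def const3_def)

lemma coeff3_const3: "coeff3 (const3 a) p q r = (if p = 0 \<and> q = 0 \<and> r = 0 then a else 0)"
  by (auto simp: coeff3_def const3_def)

lemma coeff3_1: "coeff3 1 p q r = (if p = 0 \<and> q = 0 \<and> r = 0 then 1 else 0)"
  by (auto simp: coeff3_def fps_one_nth)

lemma coeff3_sum [simp]: "coeff3 (sum f A) p q r = (\<Sum>a\<in>A. coeff3 (f a) p q r)"
  by (simp add: coeff3_def fps_sum_nth)

text \<open>Filtration by total degree in u, v, w. It is separated (\<open>order_ge_eqI\<close>), so
  infinite substitutions can be compared modulo order n, where finite sums suffice.\<close>

definition order_ge :: "nat \<Rightarrow> 'r::comm_ring_1 fps3 \<Rightarrow> bool" where
  "order_ge n s \<longleftrightarrow> (\<forall>p q r. p + q + r < n \<longrightarrow> coeff3 s p q r = 0)"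

lemma order_ge_0 [simp]: "order_ge 0 s" "order_ge n 0"
  by (simp_all add: order_ge_def)

lemma order_ge_mono: "order_ge m s \<Longrightarrow> n \<le> m \<Longrightarrow> order_ge n s"
  by (auto simp: order_ge_def)

lemma order_ge_add: "order_ge n s \<Longrightarrow> order_ge n t \<Longrightarrow> order_ge n (s + t)"
  by (simp add: order_ge_def)

lemma order_ge_sum: "(\<And>a. a \<in> A \<Longrightarrow> order_ge n (f a)) \<Longrightarrow> order_ge n (sum f A)"
  by (induction A rule: infinite_finite_induct) (auto intro: order_ge_add)

lemma order_ge_mult:
  assumes "order_ge m s" "order_ge n t"
  shows "order_ge (m + n) (s * t)"
  unfolding order_ge_def
proof (intro allI impI)
  fix p q r assume l: "p + q + r < m + n"
  have "coeff3 s i j k * coeff3 t (p - i) (q - j) (r - k) = 0"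
    if "k \<le> r" "j \<le> q" "i \<le> p" for i j k
  proof (cases "i + j + k < m")
    case True
    then show ?thesis using assms(1) by (simp add: order_ge_def)
  next
    case False
    then have "p - i + (q - j) + (r - k) < n" using l that by linarith
    then show ?thesis using assms(2) by (simp add: order_ge_def)
  qed
  then show "coeff3 (s * t) p q r = 0"
    unfolding coeff3_mult by (intro sum.neutral ballI) auto
qed

lemma order_ge_mult_left: "order_ge n t \<Longrightarrow> order_ge n (s * t)"
  using order_ge_mult[of 0 s n t] by simp

lemma order_ge_mult_right: "order_ge n s \<Longrightarrow> order_ge n (s * t)"
  using order_ge_mult[of n s 0 t] by simp

lemma order_ge_power: "order_ge 1 x \<Longrightarrow> order_ge n (x ^ n)"
proof (induction n)
  case (Suc n)
  then show ?case using order_ge_mult[of 1 x n "x ^ n"] by simp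
qed simp

lemma order_ge_powers: "order_ge 1 x \<Longrightarrow> order_ge 1 y \<Longrightarrow> order_ge (i + j) (x ^ i * y ^ j)"
  by (intro order_ge_mult order_ge_power)

lemma order_ge_1_iff: "order_ge 1 s \<longleftrightarrow> coeff3 s 0 0 0 = 0"
  by (auto simp: order_ge_def)

lemma order_ge_vars [simp]: "order_ge 1 uvar" "order_ge 1 vvar" "order_ge 1 wvar"
  "order_ge (Suc 0) uvar" "order_ge (Suc 0) vvar" "order_ge (Suc 0) wvar"
  by (auto simp: order_ge_def coeff3_vars)

lemma order_ge_eqI: "(\<And>n. order_ge n (s - t)) \<Longrightarrow> s = t"
  unfolding fps3_eq_iff
proof (intro allI)
  fix p q r assume "\<And>n. order_ge n (s - t)"
  then have "order_ge (Suc (p + q + r)) (s - t)" .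
  then show "coeff3 s p q r = coeff3 t p q r" by (simp add: order_ge_def)
qed

lemma order_ge_trans: "order_ge n (s - t) \<Longrightarrow> order_ge n (t - u) \<Longrightarrow> order_ge n (s - u)"
  using order_ge_add[of n "s - t" "t - u"] by simp

lemma order_ge_sym: "order_ge n (s - t) \<Longrightarrow> order_ge n (t - s)"
  by (simp add: order_ge_def)

lemma order_ge_diff_mult:
  assumes "order_ge n (s - s')" "order_ge n (t - t')"
  shows "order_ge n (s * t - s' * t')"
proof -
  have "s * t - s' * t' = (s - s') * t + s' * (t - t')" by (simp add: algebra_simps)
  then show ?thesis using assms by (metis order_ge_add order_ge_mult_left order_ge_mult_right)
qed

lemma order_ge_subset_sum:
  assumes "finite B" "A \<subseteq> B" "\<And>b. b \<in> B - A \<Longrightarrow> order_ge n (f b)"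
  shows "order_ge n (sum f B - sum f A)"
  unfolding sum_diff[OF assms(1,2), symmetric] by (rule order_ge_sum) (rule assms(3))


section \<open>Substitution into power series\<close>

text \<open>Two independent cutoffs, because differentiating in the second argument lowers only the
  second one.\<close>

definition trunc_subst2 :: "nat \<Rightarrow> nat \<Rightarrow> (nat \<Rightarrow> nat \<Rightarrow> 'r::comm_ring_1) \<Rightarrow> 'r fps3 \<Rightarrow> 'r fps3 \<Rightarrow> 'r fps3" where
  "trunc_subst2 m m' c x y = (\<Sum>i<m. \<Sum>j<m'. const3 (c i j) * (x ^ i * y ^ j))"

text \<open>The product \<open>x ^ i * y ^ j\<close> has order at least i + j, so below degree n
  neither the cutoff inside \<open>subst2\<close> nor the bounds \<open>m\<close>, \<open>m'\<close>
  lose any term.\<close>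

lemma subst2_trunc:
  assumes x: "order_ge 1 x" and y: "order_ge 1 y" and m: "n \<le> m" "n \<le> m'"
  shows "order_ge n (subst2 c x y - trunc_subst2 m m' c x y)"
  unfolding order_ge_def
proof (intro allI impI)
  fix p q r assume l: "p + q + r < n"
  have z: "coeff3 (x ^ i * y ^ j) p q r = 0" if "i + j > p + q + r" for i j
    using order_ge_powers[OF x y, of i j] that by (simp add: order_ge_def)
  have "(\<Sum>i\<le>p+q+r. \<Sum>j\<le>p+q+r. c i j * coeff3 (x ^ i * y ^ j) p q r)
      = (\<Sum>i<m. \<Sum>j\<le>p+q+r. c i j * coeff3 (x ^ i * y ^ j) p q r)"
    using l m by (intro sum.mono_neutral_left) (auto simp: z)
  also have "\<dots> = (\<Sum>i<m. \<Sum>j<m'. c i j * coeff3 (x ^ i * y ^ j) p q r)"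
    using l m by (intro sum.cong sum.mono_neutral_left) (auto simp: z)
  finally show "coeff3 (subst2 c x y - trunc_subst2 m m' c x y) p q r = 0"
    by (simp add: subst2_def trunc_subst2_def)
qed

lemma subst1_eq_subst2: "subst1 g x = subst2 (\<lambda>i j. if j = 0 then g $ i else 0) x y"
proof -
  have "(if P then a else 0) * b = (if P then a * b else (0::'a))" for P a b by simp
  then show ?thesis by (simp add: fps3_eq_iff subst1_def subst2_def)
qed

text \<open>The chain rule for \<open>subst2\<close> differentiates in the second slot only; this
  form places a one-variable series there.\<close>

lemma subst1_eq_subst2': "subst1 g x = subst2 (\<lambda>i j. if i = 0 then g $ j else 0) y x"
proof -
  have 1: "(if P then a else 0) * b = (if P then a * b else (0::'a))" for P a b by simp
  have "(\<Sum>i\<le>k. \<Sum>j\<le>k. (if i = 0 then g $ j else 0) * coeff3 (y ^ i * x ^ j) p q r)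
     = (\<Sum>i\<le>k. if i = 0 then \<Sum>j\<le>k. g $ j * coeff3 (y ^ i * x ^ j) p q r else 0)" for k p q r
    by (intro sum.cong) (auto simp: 1)
  then show ?thesis by (simp add: fps3_eq_iff subst1_def subst2_def)
qed

section \<open>Evaluation of series at elements of positive order\<close>

definition embed1 :: "'r::comm_ring_1 fps \<Rightarrow> 'r fps3" where
  "embed1 g = fps_const (fps_const g)"

lemma embed1_hom: "is_ring_hom embed1"
  by (simp add: is_ring_hom_def embed1_def)

lemma coeff3_embed1: "coeff3 (embed1 g) p q r = (if q = 0 \<and> r = 0 then g $ p else 0)"
  by (simp add: coeff3_def embed1_def)

lemma embed1_inj:
  assumes "embed1 g = embed1 h"
  shows "g = h"
proof (rule fps_ext)
  fix n
  show "g $ n = h $ n"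
    using arg_cong[OF assms, of "\<lambda>s. coeff3 s n 0 0"] by (simp add: coeff3_embed1)
qed

text \<open>The substitution u -> x, v -> y. Reading only coefficients with third index 0 sets w to
  0, so this can be a ring homomorphism on all of \<open>'r fps3\<close>.\<close>

definition eval_uv :: "'r::comm_ring_1 fps3 \<Rightarrow> 'r fps3 \<Rightarrow> 'r fps3 \<Rightarrow> 'r fps3" where
  "eval_uv x y s = subst2 (\<lambda>i j. coeff3 s i j 0) x y"

lemma subst1_eq_eval_uv: "subst1 g x = eval_uv x y (embed1 g)"
proof -
  have "(\<lambda>i j. coeff3 (embed1 g) i j 0) = (\<lambda>i j. if j = 0 then g $ i else 0)"
    by (auto simp: coeff3_embed1)
  then show ?thesis unfolding eval_uv_def by (simp add: subst1_eq_subst2)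
qed

lemma order_ge_subst2:
  assumes "order_ge 1 x" "order_ge 1 y" "\<And>i j. i + j < n \<Longrightarrow> c i j = 0"
  shows "order_ge n (subst2 c x y)"
proof -
  have "order_ge n (trunc_subst2 n n c x y)"
    unfolding trunc_subst2_def
  proof (intro order_ge_sum)
    fix i j
    show "order_ge n (const3 (c i j) * (x ^ i * y ^ j))"
    proof (cases "i + j < n")
      case True
      then show ?thesis by (simp add: assms(3) ring_hom_simps(1)[OF const3_hom])
    next
      case False
      then show ?thesis
        using order_ge_mono[OF order_ge_powers[OF assms(1,2)], of n i j]
        by (simp add: order_ge_mult_left[of _ "x ^ i * y ^ j"])
    qed
  qed
  then show ?thesis
    using order_ge_add[OF subst2_trunc[OF assms(1,2) order_refl order_refl, of n c]] by fastforce
qed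

lemma order_ge_subst1: "order_ge 1 x \<Longrightarrow> g $ 0 = 0 \<Longrightarrow> order_ge 1 (subst1 g x)"
  using order_ge_subst2[of x 0 1 "\<lambda>i j. if j = 0 then g $ i else 0"] subst1_eq_subst2[of g x 0] by simp

lemma order_ge_embed1: "g $ 0 = 0 \<Longrightarrow> order_ge 1 (embed1 g)"
  unfolding order_ge_1_iff by (simp add: coeff3_embed1)

lemma eval_uv_mult:
  fixes x y :: "'r::comm_ring_1 fps3"
  assumes x: "order_ge 1 x" and y: "order_ge 1 y"
  shows "eval_uv x y (s * t) = eval_uv x y s * eval_uv x y t"
proof (rule order_ge_eqI)
  fix n :: nat
  note C = ring_hom_simps[OF const3_hom] ring_hom_sum[OF const3_hom]
  let ?h = "\<lambda>(i, i') (j, j'). const3 (coeff3 s i j 0 * coeff3 t i' j' 0) * (x ^ (i + i') * y ^ (j + j'))"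
  \<comment> \<open>\<open>?h\<close> pairs a term of \<open>s\<close> with a term of
    \<open>t\<close>. Truncating the product \<open>s * t\<close> keeps both pairs of exponents in
    the triangle \<open>?T\<close>; multiplying the truncations keeps them in the square
    \<open>?Q\<close>.\<close>
  let ?T = "{(i, i'). i + i' < n}" and ?Q = "{..<n} \<times> {..<n}"
  let ?e = "\<lambda>s. trunc_subst2 n n (\<lambda>i j. coeff3 s i j 0) x y"
  have tri: "(\<Sum>j<n. \<Sum>j'\<le>j. ?h (i, i') (j', j - j')) = (\<Sum>z\<in>?T. ?h (i, i') z)" for i i'
    using sum.triangle_reindex[of "\<lambda>j j'. ?h (i, i') (j, j')" n] by (simp add: split_def)
  have "?e (s * t) = (\<Sum>i<n. \<Sum>j<n. \<Sum>j'\<le>j. \<Sum>i'\<le>i. ?h (i', i - i') (j', j - j'))"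
    by (simp add: trunc_subst2_def coeff3_mult C sum_distrib_right)
  also have "\<dots> = (\<Sum>i<n. \<Sum>i'\<le>i. \<Sum>j<n. \<Sum>j'\<le>j. ?h (i', i - i') (j', j - j'))"
    by (subst sum.swap[of _ "{..i}" for i]) (subst sum.swap[of _ "{..i}" "{..<n}" for i], rule refl)
  also have "\<dots> = (\<Sum>i<n. \<Sum>i'\<le>i. \<Sum>z\<in>?T. ?h (i', i - i') z)"
    by (simp only: tri)
  also have "\<dots> = (\<Sum>a\<in>?T. \<Sum>z\<in>?T. ?h a z)"
    using sum.triangle_reindex[of "\<lambda>i i'. \<Sum>z\<in>?T. ?h (i, i') z" n] by (simp add: split_def)
  also have "\<dots> = (\<Sum>(a, z)\<in>?T \<times> ?T. ?h a z)"
    by (simp add: sum.cartesian_product)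
  finally have 1: "?e (s * t) = (\<Sum>(a, z)\<in>?T \<times> ?T. ?h a z)" .
  have "?e s * ?e t = (\<Sum>i<n. \<Sum>i'<n. \<Sum>j<n. \<Sum>j'<n. ?h (i, i') (j, j'))"
    by (simp add: trunc_subst2_def sum_product C power_add mult_ac)
  also have "\<dots> = (\<Sum>i<n. \<Sum>i'<n. \<Sum>z\<in>?Q. ?h (i, i') z)"
    by (simp add: sum.cartesian_product split_def)
  also have "\<dots> = (\<Sum>a\<in>?Q. \<Sum>z\<in>?Q. ?h a z)"
    using sum.cartesian_product[of "\<lambda>i i'. \<Sum>z\<in>?Q. ?h (i, i') z" "{..<n}" "{..<n}"]
    by (simp add: split_def)
  also have "\<dots> = (\<Sum>(a, z)\<in>?Q \<times> ?Q. ?h a z)"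
    by (rule sum.cartesian_product)
  finally have 2: "?e s * ?e t = (\<Sum>(a, z)\<in>?Q \<times> ?Q. ?h a z)" .
  \<comment> \<open>A pair of index pairs in the squares but outside the triangles has total
    exponent at least n, so the surplus terms lie in order n.\<close>
  have "order_ge n (?e s * ?e t - ?e (s * t))"
    unfolding 1 2
  proof (rule order_ge_subset_sum)
    fix b assume "b \<in> ?Q \<times> ?Q - ?T \<times> ?T"
    then obtain i i' j j' where b: "b = ((i, i'), (j, j'))" and "n \<le> i + i' + (j + j')"
      by (cases b) force
    then show "order_ge n (case b of (a, z) \<Rightarrow> ?h a z)"
      using order_ge_mono[OF order_ge_powers[OF x y], of n "i + i'" "j + j'"]
      by (auto intro!: order_ge_mult_left)
  qed auto
  moreover have tr: "order_ge n (eval_uv x y s - ?e s)" for s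
    unfolding eval_uv_def by (rule subst2_trunc[OF x y]) auto
  ultimately show "order_ge n (eval_uv x y (s * t) - eval_uv x y s * eval_uv x y t)"
    using order_ge_diff_mult[OF tr[of s] tr[of t]] by (metis order_ge_sym order_ge_trans)
qed

lemma eval_uv_const3: "eval_uv x y (const3 a) = const3 a"
proof -
  have "(\<Sum>i\<le>k. \<Sum>j\<le>k. coeff3 (const3 a) i j 0 * coeff3 (x ^ i * y ^ j) p q r)
     = (\<Sum>i\<le>k. if i = 0 then (\<Sum>j\<le>k. if j = 0 then a * coeff3 (x ^ i * y ^ j) p q r else 0) else 0)" for k p q r
    by (intro sum.cong if_cong) (auto simp: coeff3_const3 mult_delta_left intro!: sum.neutral)
  then show ?thesis
    by (simp add: fps3_eq_iff eval_uv_def subst2_def coeff3_const3 coeff3_1)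
qed

lemma eval_uv_hom:
  assumes "order_ge 1 x" "order_ge 1 y"
  shows "is_ring_hom (eval_uv x y)"
proof -
  have "eval_uv x y (s + t) = eval_uv x y s + eval_uv x y t" for s t
    by (simp add: fps3_eq_iff eval_uv_def subst2_def distrib_right sum.distrib)
  moreover have "eval_uv x y 1 = 1"
    using eval_uv_const3[of x y 1] by (simp add: ring_hom_simps[OF const3_hom])
  ultimately show ?thesis
    using assms by (simp add: is_ring_hom_def eval_uv_mult)
qed

lemma order_ge_eval_uv:
  "order_ge 1 x \<Longrightarrow> order_ge 1 y \<Longrightarrow> order_ge n s \<Longrightarrow> order_ge n (eval_uv x y s)"
  unfolding eval_uv_def by (rule order_ge_subst2) (auto simp: order_ge_def)

lemma eval_uv_vars:
  fixes x y :: "'r::comm_ring_1 fps3"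
  assumes x: "order_ge 1 x" and y: "order_ge 1 y"
  shows "eval_uv x y uvar = x" "eval_uv x y vvar = y"
proof -
  have *: "subst1 fps_X x = x" if "order_ge 1 x" for x :: "'r fps3"
  proof -
    have "(\<Sum>k\<le>p+q+r. fps_X $ k * coeff3 (x ^ k) p q r)
        = (\<Sum>k\<le>p+q+r. if k = 1 then coeff3 x p q r else 0)" for p q r
      by (intro sum.cong) auto
    then show ?thesis
      using that unfolding order_ge_1_iff by (auto simp: fps3_eq_iff subst1_def Suc_le_eq)
  qed
  have "(\<lambda>i j. coeff3 (uvar :: 'r fps3) i j 0) = (\<lambda>i j. if j = 0 then fps_X $ i else 0)"
    "(\<lambda>i j. coeff3 (vvar :: 'r fps3) i j 0) = (\<lambda>i j. if i = 0 then fps_X $ j else 0)"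
    by (auto simp: fun_eq_iff coeff3_vars)
  then show "eval_uv x y uvar = x" "eval_uv x y vvar = y"
    unfolding eval_uv_def using *[OF x] *[OF y]
    by (simp_all add: subst1_eq_subst2[of _ x y] subst1_eq_subst2'[of _ y x])
qed

text \<open>Compatibility with the order filtration is what lets such a map pass through the
  infinite sum in \<open>subst2\<close>. The instances are evaluation, v = 0 and w = 0.\<close>

locale continuous_hom =
  fixes E :: "'r::comm_ring_1 fps3 \<Rightarrow> 'r fps3"
  assumes hom: "is_ring_hom E" and const3: "E (const3 a) = const3 a"
    and order: "order_ge n s \<Longrightarrow> order_ge n (E s)"
begin

lemma subst2:
  assumes "order_ge 1 x" "order_ge 1 y"
  shows "E (subst2 c x y) = subst2 c (E x) (E y)"
proof (rule order_ge_eqI)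
  fix n :: nat
  have "E (trunc_subst2 n n c x y) = trunc_subst2 n n c (E x) (E y)"
    by (simp add: trunc_subst2_def ring_hom_sum[OF hom] ring_hom_simps[OF hom] ring_hom_power[OF hom] const3)
  then show "order_ge n (E (subst2 c x y) - subst2 c (E x) (E y))"
    using order[OF subst2_trunc[OF assms order_refl order_refl, of n c]]
      subst2_trunc[OF order[OF assms(1)] order[OF assms(2)] order_refl order_refl, of n c]
    unfolding ring_hom_simps(6)[OF hom] by (metis order_ge_sym order_ge_trans)
qed

lemma subst1: "order_ge 1 x \<Longrightarrow> E (subst1 g x) = subst1 g (E x)"
  using subst2[of x 0] by (simp add: subst1_eq_subst2[of _ _ 0] ring_hom_simps[OF hom])

end

lemma continuous_hom_eval_uv: "order_ge 1 x \<Longrightarrow> order_ge 1 y \<Longrightarrow> continuous_hom (eval_uv x y)"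
  by unfold_locales (auto simp: eval_uv_hom eval_uv_const3 order_ge_eval_uv)

text \<open>A derivation may lower the order by one, so its values modulo order n are found from a
  truncation modulo order n + 1. The instances are the derivatives in v and w.\<close>

locale derivation3 =
  fixes D :: "'r::comm_ring_1 fps3 \<Rightarrow> 'r fps3"
  assumes add: "D (s + t) = D s + D t"
    and mult: "D (s * t) = s * D t + D s * t"
    and const3: "D (const3 a) = 0"
    and order: "order_ge (Suc n) s \<Longrightarrow> order_ge n (D s)"
begin

lemma zero: "D 0 = 0"
  using add[of 0 0] by simp

lemma diff: "D (s - t) = D s - D t"
  using add[of "s - t" t] by simp

lemma sum: "D (sum f A) = (\<Sum>a\<in>A. D (f a))"
  by (induction A rule: infinite_finite_induct) (auto simp: add zero)

lemma power: "D (s ^ Suc n) = of_nat (Suc n) * s ^ n * D s"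
  by (induction n) (auto simp: mult algebra_simps)

lemma one: "D 1 = 0"
  using mult[of 1 1] by simp

lemma power_eq_0: "D x = 0 \<Longrightarrow> D (x ^ i) = 0"
  by (cases i) (simp_all add: power one del: power_Suc)

text \<open>Chain rule with the first argument constant for \<open>D\<close>: only the partial
  derivative in the second variable survives, and its coefficients are
  \<open>of_nat (Suc j) * c i (Suc j)\<close>.\<close>

lemma subst2:
  assumes x: "order_ge 1 x" and y: "order_ge 1 y" and Dx: "D x = 0"
  shows "D (subst2 c x y) = subst2 (\<lambda>i j. of_nat (Suc j) * c i (Suc j)) x y * D y"
proof (rule order_ge_eqI)
  fix n :: nat
  let ?d = "\<lambda>i j. of_nat (Suc j) * c i (Suc j)"
  have of_nat: "of_nat k = const3 (of_nat k)" for k :: nat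
    by (simp add: const3_def flip: fps_of_nat)
  have t: "D (const3 a * (x ^ i * y ^ Suc j)) = const3 (of_nat (Suc j) * a) * (x ^ i * y ^ j) * D y" for a i j
    unfolding mult power const3 power_eq_0[OF Dx] of_nat ring_hom_simps[OF const3_hom]
    by (simp only: mult_ac mult_zero_left mult_zero_right add_0_left add_0_right)
  have "D (trunc_subst2 (Suc n) (Suc n) c x y) = trunc_subst2 (Suc n) n ?d x y * D y"
    unfolding trunc_subst2_def sum sum.lessThan_Suc_shift[of _ n] add t
    by (simp add: mult power_eq_0[OF Dx] Dx one const3 sum_distrib_right distrib_right sum.distrib)
  then have "order_ge n (D (subst2 c x y) - trunc_subst2 (Suc n) n ?d x y * D y)"
    using order[OF subst2_trunc[OF x y order_refl order_refl, of "Suc n" c]] by (simp only: diff)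
  moreover have "order_ge n (subst2 ?d x y * D y - trunc_subst2 (Suc n) n ?d x y * D y)"
    unfolding left_diff_distrib[symmetric] by (intro order_ge_mult_right subst2_trunc x y) auto
  ultimately show "order_ge n (D (subst2 c x y) - subst2 ?d x y * D y)"
    by (rule order_ge_trans[OF _ order_ge_sym])
qed

lemma subst1:
  assumes "order_ge 1 x"
  shows "D (subst1 g x) = subst1 (fps_deriv g) x * D x"
proof -
  have "(\<lambda>i j. of_nat (Suc j) * (if i = 0 then g $ Suc j else 0)) = (\<lambda>i j. if i = (0::nat) then fps_deriv g $ j else 0)"
    by (auto simp: fun_eq_iff)
  then show ?thesis
    using subst2[of 0 x "\<lambda>i j. if i = 0 then g $ j else 0"] assms
    by (simp only: subst1_eq_subst2'[of _ x 0] zero order_ge_0)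
qed

end


section \<open>Composition of power series over a commutative ring\<close>

lemma subst1_hom: "order_ge 1 x \<Longrightarrow> is_ring_hom (\<lambda>g. subst1 g x)"
  using ring_hom_comp[OF eval_uv_hom[of x 0] embed1_hom] by (simp add: subst1_eq_eval_uv[of _ x 0])

lemma embed1_power: "embed1 g ^ n = embed1 (g ^ n)"
  by (simp add: ring_hom_power[OF embed1_hom])

lemma embed1_compose:
  assumes "b $ 0 = 0"
  shows "embed1 (a oo b) = subst1 a (embed1 b)"
  by (auto simp: fps3_eq_iff subst1_def embed1_power coeff3_embed1 fps_compose_nth atLeast0AtMost
      intro!: sum.cong)

lemma subst1_compose:
  assumes "order_ge 1 x" "b $ 0 = 0"
  shows "subst1 (a oo b) x = subst1 a (subst1 b x)"
  using continuous_hom.subst1[OF continuous_hom_eval_uv[OF assms(1) order_ge_0(2)] order_ge_embed1[OF assms(2)], of a]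
  by (simp add: subst1_eq_eval_uv[of _ x 0] embed1_compose[OF assms(2)])

lemma subst1_X: "order_ge 1 x \<Longrightarrow> subst1 fps_X x = x"
  using eval_uv_vars(1)[of x 0] by (simp add: subst1_eq_eval_uv[of _ x 0] embed1_def uvar_def)

lemma subst1_uvar: "subst1 g uvar = embed1 g"
  using embed1_compose[of fps_X g] by (simp add: embed1_def uvar_def)

lemma subst1_0: "g $ 0 = 0 \<Longrightarrow> subst1 g 0 = 0"
  by (simp add: fps3_eq_iff subst1_def) (metis (no_types, lifting) coeff3_0 mult_eq_0_iff mult_zero_left mult_zero_right power_0_left sum.neutral)

text \<open>The Lazard ring is available only as a commutative ring, so the laws of composition are
  proved at that generality: the injection \<open>embed1\<close> turns composition into
  substitution, where they hold.\<close>

lemma compose_hom: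
  fixes c :: "'r::comm_ring_1 fps"
  assumes "c $ 0 = 0"
  shows "is_ring_hom (\<lambda>a. a oo c)"
proof -
  have "embed1 ((a * b) oo c) = embed1 ((a oo c) * (b oo c))" for a b
    by (simp only: embed1_compose[OF assms] ring_hom_simps(4)[OF embed1_hom]
        ring_hom_simps(4)[OF subst1_hom[OF order_ge_embed1[OF assms]]])
  then show ?thesis
    by (auto simp: is_ring_hom_def fps_compose_add_distrib intro: embed1_inj)
qed

lemmas compose_simps = ring_hom_simps[OF compose_hom] ring_hom_power[OF compose_hom]

lemma compose_assoc:
  fixes a b c :: "'r::comm_ring_1 fps"
  assumes "b $ 0 = 0" "c $ 0 = 0"
  shows "a oo (b oo c) = (a oo b) oo c"
  by (rule embed1_inj) (simp add: assms embed1_compose subst1_compose[OF order_ge_embed1[OF assms(2)]])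

text \<open>The coefficients of \<open>f\<close> are solved for one after another; no division
  occurs, since the n-th coefficient of \<open>g ^ n\<close> is 1.\<close>

lemma compose_left_inverse_exists:
  fixes g :: "'r::comm_ring_1 fps"
  assumes g: "g $ 0 = 0" "g $ 1 = 1"
  shows "\<exists>f. f $ 0 = 0 \<and> f $ 1 = 1 \<and> f oo g = fps_X"
proof -
  \<comment> \<open>Course-of-values recursion: each coefficient depends on all earlier
    ones.\<close>
  obtain a where a: "\<And>n. a n = fps_X $ n - (\<Sum>i<n. a i * (g ^ i) $ n)"
  proof -
    let ?F = "\<lambda>a n. fps_X $ n - (\<Sum>i<n. a i * (g ^ i) $ n)"
    have "wfrec less_than ?F n = ?F (wfrec less_than ?F) n" for n
      by (subst wfrec[OF wf_less_than]) (auto simp: cut_apply intro!: sum.cong)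
    then show ?thesis by (rule that)
  qed
  have n: "(g ^ n) $ n = 1" for n
    using startsby_zero_power_nth_same[OF g(1)] g(2) by simp
  have "(Abs_fps a oo g) $ n = fps_X $ n" for n
  proof -
    have "(Abs_fps a oo g) $ n = (\<Sum>i<n. a i * (g ^ i) $ n) + a n"
      by (simp add: fps_compose_nth atLeast0AtMost n flip: lessThan_Suc_atMost)
    also have "\<dots> = fps_X $ n" by (subst a[of n]) simp
    finally show ?thesis .
  qed
  moreover have "a 0 = 0" by (simp add: a[of 0])
  moreover have "a 1 = 1" using a[of 1] \<open>a 0 = 0\<close> by simp
  ultimately show ?thesis
    by (intro exI[of _ "Abs_fps a"]) (simp add: fps_eq_iff)
qed

text \<open>A left inverse \<open>f\<close> of \<open>g\<close> has a left inverse \<open>h\<close>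
  of its own, and associativity forces \<open>h = g\<close>.\<close>

lemma compose_inverse_exists:
  fixes g :: "'r::comm_ring_1 fps"
  assumes g: "g $ 0 = 0" "g $ 1 = 1"
  shows "\<exists>f. f $ 0 = 0 \<and> f $ 1 = 1 \<and> f oo g = fps_X \<and> g oo f = fps_X"
proof -
  obtain f where f: "f $ 0 = 0" "f $ 1 = 1" "f oo g = fps_X"
    using compose_left_inverse_exists[OF g] by blast
  obtain h where h: "h $ 0 = 0" "h oo f = fps_X"
    using compose_left_inverse_exists[OF f(1,2)] by blast
  have "h = h oo (f oo g)" by (simp add: f)
  also have "\<dots> = (h oo f) oo g" by (rule compose_assoc) (fact f g)+
  also have "\<dots> = g" by (simp add: f g h)
  finally show ?thesis using f h by blast
qed

lemma compose_inverse_unique: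
  fixes g :: "'r::comm_ring_1 fps"
  assumes "g $ 0 = 0" "f $ 0 = 0" "f oo g = fps_X" "f' $ 0 = 0" "g oo f' = fps_X"
  shows "f' = f"
proof -
  have "f' = (f oo g) oo f'" by (simp add: assms)
  also have "\<dots> = f oo (g oo f')" by (rule compose_assoc[symmetric]) (fact assms)+
  finally show ?thesis by (simp add: assms)
qed

lemma compose_cancel:
  fixes g :: "'r::comm_ring_1 fps"
  assumes "g $ 0 = 0" "g $ 1 = 1" "a oo g = b oo g"
  shows "a = b"
proof -
  obtain f where f: "f $ 0 = 0" "g oo f = fps_X"
    using compose_inverse_exists[OF assms(1,2)] by blast
  have "a oo (g oo f) = b oo (g oo f)" by (simp only: compose_assoc[OF assms(1) f(1)] assms(3))
  then show ?thesis by (simp add: f)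
qed

section \<open>Coefficientwise application of ring homomorphisms\<close>

definition map_fps :: "('r \<Rightarrow> 's) \<Rightarrow> 'r::zero fps \<Rightarrow> 's fps" where
  "map_fps h g = Abs_fps (\<lambda>n. h (g $ n))"

lemma map_fps_nth [simp]: "map_fps h g $ n = h (g $ n)"
  by (simp add: map_fps_def)

lemma map_fps_hom:
  assumes "is_ring_hom h"
  shows "is_ring_hom (map_fps h)"
  by (simp add: is_ring_hom_def fps_eq_iff fps_mult_nth fps_one_nth ring_hom_simps[OF assms] ring_hom_sum[OF assms])

lemma map_fps_X: "is_ring_hom h \<Longrightarrow> map_fps h fps_X = fps_X"
  by (simp add: fps_eq_iff ring_hom_simps fps_X_def)

lemma map_fps_compose:
  assumes "is_ring_hom h"
  shows "map_fps h (a oo b) = map_fps h a oo map_fps h b"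
proof -
  have "h (b ^ i $ n) = (map_fps h b ^ i) $ n" for i n
    by (simp flip: ring_hom_power[OF map_fps_hom[OF assms]])
  then show ?thesis
    by (simp add: fps_eq_iff fps_compose_nth ring_hom_simps[OF assms] ring_hom_sum[OF assms])
qed

lemma map3_subst1:
  assumes "is_ring_hom h"
  shows "map3 h (subst1 g x) = subst1 (map_fps h g) (map3 h x)"
proof -
  have "(\<lambda>i j::nat. h (if j = 0 then g $ i else 0)) = (\<lambda>i j. if j = 0 then map_fps h g $ i else 0)"
    by (auto simp: fun_eq_iff ring_hom_simps[OF assms])
  then show ?thesis
    by (simp only: subst1_eq_subst2[of _ _ 0] map3_subst2[OF assms] map3_simps(1)[OF assms])
qed


section \<open>Logarithms of formal group laws\<close>

text \<open>Since w is the outermost variable, \<open>fps_deriv\<close> is the derivative in w; the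
  derivative in v acts one level deeper.\<close>

definition deriv_v :: "'r::comm_ring_1 fps3 \<Rightarrow> 'r fps3" where
  "deriv_v s = Abs_fps (\<lambda>r. fps_deriv (s $ r))"

lemma coeff3_deriv:
  "coeff3 (deriv_v s) p q r = of_nat (Suc q) * coeff3 s p (Suc q) r"
  "coeff3 (fps_deriv s) p q r = of_nat (Suc r) * coeff3 s p q (Suc r)"
  by (simp_all add: coeff3_def deriv_v_def fps_mult_of_nat_nth del: of_nat_Suc)

lemma derivation3_deriv_v: "derivation3 (deriv_v :: 'r::comm_ring_1 fps3 \<Rightarrow> _)"
proof
  show "deriv_v (s * t) = s * deriv_v t + deriv_v s * t" for s t :: "'r fps3"
    by (simp add: fps_eq_iff[where ?'a = "'r fps fps"] deriv_v_def fps_mult_nth fps_deriv_sum sum.distrib)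
qed (auto simp: fps3_eq_iff coeff3_deriv coeff3_const3 order_ge_def distrib_left)

lemma derivation3_deriv_w: "derivation3 (fps_deriv :: 'r::comm_ring_1 fps3 \<Rightarrow> _)"
proof
  show "fps_deriv (const3 a) = 0" for a :: 'r by (simp add: const3_def)
  show "order_ge n (fps_deriv s)" if "order_ge (Suc n) s" for s :: "'r fps3" and n
    using that by (simp add: coeff3_deriv order_ge_def)
qed auto

lemma deriv_v_vars: "deriv_v uvar = 0" "deriv_v vvar = 1" "deriv_v wvar = 0"
  by (auto simp: fps3_eq_iff coeff3_deriv coeff3_vars coeff3_1)

lemma deriv_w_vars: "fps_deriv uvar = 0" "fps_deriv vvar = 0" "fps_deriv wvar = 1"
  by (simp_all add: uvar_def vvar_def wvar_def)

definition zero_w :: "'r::comm_ring_1 fps3 \<Rightarrow> 'r fps3" where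
  "zero_w s = fps_const (s $ 0)"

definition zero_v :: "'r::comm_ring_1 fps3 \<Rightarrow> 'r fps3" where
  "zero_v = map_fps (\<lambda>s. fps_const (s $ 0))"

lemma coeff3_zero:
  "coeff3 (zero_w s) p q r = (if r = 0 then coeff3 s p q r else 0)"
  "coeff3 (zero_v s) p q r = (if q = 0 then coeff3 s p q r else 0)"
  by (auto simp: coeff3_def zero_w_def zero_v_def)

lemma continuous_hom_zero_w: "continuous_hom (zero_w :: 'r::comm_ring_1 fps3 \<Rightarrow> _)"
proof
  show "is_ring_hom (zero_w :: 'r fps3 \<Rightarrow> _)"
    by (simp add: is_ring_hom_def zero_w_def)
qed (auto simp: fps3_eq_iff coeff3_zero coeff3_const3 order_ge_def)

lemma continuous_hom_zero_v: "continuous_hom (zero_v :: 'r::comm_ring_1 fps3 \<Rightarrow> _)"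
proof
  show "is_ring_hom (zero_v :: 'r fps3 \<Rightarrow> _)"
    unfolding zero_v_def by (rule map_fps_hom) (simp add: is_ring_hom_def)
qed (auto simp: fps3_eq_iff coeff3_zero coeff3_const3 order_ge_def)

lemma zero_vars: "zero_w uvar = uvar" "zero_w vvar = vvar" "zero_w wvar = 0"
  "zero_v uvar = uvar" "zero_v vvar = 0" "zero_v wvar = wvar"
  by (auto simp: fps3_eq_iff coeff3_zero coeff3_vars)

lemma subst2_0_right: "subst2 c x 0 = subst1 (Abs_fps (\<lambda>i. c i 0)) x"
proof -
  have "(\<Sum>i\<le>k. \<Sum>j\<le>k. c i j * coeff3 (x ^ i * 0 ^ j) p q r)
      = (\<Sum>i\<le>k. \<Sum>j\<le>k. if j = 0 then c i 0 * coeff3 (x ^ i) p q r else 0)" for k p q r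
    by (intro sum.cong) (auto simp: power_0_left)
  then show ?thesis by (simp add: fps3_eq_iff subst1_def subst2_def)
qed

lemma subst2_0_left: "subst2 c 0 y = subst1 (Abs_fps (c 0)) y"
proof -
  have "(\<Sum>i\<le>k. \<Sum>j\<le>k. c i j * coeff3 (0 ^ i * y ^ j) p q r)
      = (\<Sum>i\<le>k. if i = 0 then \<Sum>j\<le>k. c 0 j * coeff3 (y ^ j) p q r else 0)" for k p q r
    by (intro sum.cong) (auto simp: power_0_left)
  then show ?thesis by (simp add: fps3_eq_iff subst1_def subst2_def)
qed

text \<open>The invariant differential of the formal group law is \<open>du / invariant_series c\<close>.\<close>

definition invariant_series :: "(nat \<Rightarrow> nat \<Rightarrow> 'r::comm_ring_1) \<Rightarrow> 'r fps" where
  "invariant_series c = Abs_fps (\<lambda>i. c i 1)"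

locale fgl =
  fixes c :: "nat \<Rightarrow> nat \<Rightarrow> 'r::comm_ring_1"
  assumes is_fgl: "is_fgl c"
begin

abbreviation "F \<equiv> subst2 c uvar vvar"
abbreviation "c\<^sub>2 \<equiv> \<lambda>i j. of_nat (Suc j) * c i (Suc j)"
abbreviation "p \<equiv> invariant_series c"

lemma subst2_u_0: "subst2 c uvar 0 = uvar" and subst2_0_v: "subst2 c 0 vvar = vvar"
  and assoc: "subst2 c F wvar = subst2 c uvar (subst2 c vvar wvar)"
  using is_fgl by (auto simp: is_fgl_def)

lemma coeff_0: "c 0 0 = 0" and coeff_0_1: "c 0 1 = 1"
proof -
  have *: "coeff3 (subst1 (Abs_fps (c 0)) vvar) p q r = coeff3 vvar p q r" for p q r
    using subst2_0_v by (simp add: subst2_0_left)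
  show "c 0 0 = 0" using *[of 0 0 0] by (simp add: subst1_def coeff3_vars coeff3_1)
  show "c 0 1 = 1" using *[of 0 1 0] by (simp add: subst1_def coeff3_vars coeff3_1)
qed

lemma order_ge_subst2_fgl: "order_ge 1 x \<Longrightarrow> order_ge 1 y \<Longrightarrow> order_ge 1 (subst2 c x y)"
  by (rule order_ge_subst2) (auto simp: coeff_0)

lemma subst2_v_0: "subst2 c vvar 0 = vvar"
proof -
  interpret E: continuous_hom "eval_uv vvar 0" by (rule continuous_hom_eval_uv) auto
  show ?thesis
    using E.subst2[of uvar 0 c] by (simp add: subst2_u_0 eval_uv_vars ring_hom_simps[OF E.hom])
qed

lemma subst2_c2_0: "subst2 c\<^sub>2 x 0 = subst1 p x"
  by (simp add: subst2_0_right invariant_series_def)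

lemma deriv_v_F: "deriv_v F = subst2 c\<^sub>2 uvar vvar"
proof -
  interpret D: derivation3 deriv_v by (rule derivation3_deriv_v)
  show ?thesis by (simp only: D.subst2[OF order_ge_vars(1,2) deriv_v_vars(1)] deriv_v_vars mult_1_right)
qed

text \<open>The \<open>w\<close>-derivative of the associative law at \<open>w = 0\<close>.\<close>

lemma subst1_invariant_F: "subst1 p F = deriv_v F * subst1 p vvar"
proof -
  interpret D: derivation3 "fps_deriv :: 'r fps3 \<Rightarrow> _" by (rule derivation3_deriv_w)
  interpret Z: continuous_hom "zero_w :: 'r fps3 \<Rightarrow> _" by (rule continuous_hom_zero_w)
  note o = order_ge_vars(1-3) order_ge_subst2_fgl
  have "fps_deriv F = 0"
    by (simp only: D.subst2[OF o(1,2) deriv_w_vars(1)] deriv_w_vars mult_zero_right)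
  then have "fps_deriv (subst2 c F wvar) = subst2 c\<^sub>2 F wvar"
    by (simp only: D.subst2 o deriv_w_vars mult_1_right)
  moreover have "fps_deriv (subst2 c uvar (subst2 c vvar wvar))
      = subst2 c\<^sub>2 uvar (subst2 c vvar wvar) * subst2 c\<^sub>2 vvar wvar"
    by (simp only: D.subst2 o deriv_w_vars mult_1_right)
  ultimately have "zero_w (subst2 c\<^sub>2 F wvar) = zero_w (subst2 c\<^sub>2 uvar (subst2 c vvar wvar) * subst2 c\<^sub>2 vvar wvar)"
    by (simp only: assoc)
  then show ?thesis
    by (simp only: ring_hom_simps(4)[OF Z.hom] Z.subst2 o zero_vars subst2_v_0 subst2_c2_0 deriv_v_F)
qed

end

section \<open>Logarithms over algebras over the rationals\<close>

locale rat_algebra =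
  fixes \<phi> :: "rat \<Rightarrow> 'r::comm_ring_1"
  assumes hom: "is_ring_hom \<phi>"
begin

lemma of_nat: "\<phi> (of_nat n) = of_nat n"
  by (induction n) (auto simp: ring_hom_simps[OF hom])

lemma of_nat_inverse: "n \<noteq> 0 \<Longrightarrow> of_nat n * \<phi> (1 / of_nat n) = 1"
  unfolding of_nat[symmetric] ring_hom_simps(4)[OF hom, symmetric] by (simp add: ring_hom_simps[OF hom])

text \<open>Positive integers are units here, so they cancel without any assumption on zero
  divisors.\<close>

lemma of_nat_cancel:
  fixes a b :: 'r
  assumes "n \<noteq> 0" "of_nat n * a = of_nat n * b"
  shows "a = b"
proof -
  have 1: "\<phi> (1 / of_nat n) * of_nat n = 1"
    using of_nat_inverse[OF assms(1)] by (simp only: mult.commute)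
  have "\<phi> (1 / of_nat n) * (of_nat n * a) = \<phi> (1 / of_nat n) * (of_nat n * b)"
    by (simp only: assms(2))
  then show ?thesis by (simp only: mult.assoc[symmetric] 1 mult_1_left)
qed

lemma fps_deriv_eqD:
  fixes g h :: "'r fps"
  assumes "fps_deriv g = fps_deriv h" "g $ 0 = h $ 0"
  shows "g = h"
proof (rule fps_ext)
  fix n
  show "g $ n = h $ n"
  proof (cases n)
    case (Suc m)
    have "of_nat (Suc m) * g $ Suc m = of_nat (Suc m) * h $ Suc m"
      using arg_cong[OF assms(1), of "\<lambda>s. s $ m"] by simp
    then show ?thesis using of_nat_cancel[of "Suc m"] Suc by blast
  qed (simp add: assms)
qed

text \<open>Forward: differentiate g(F) = g(u) + g(v) in v and set v = 0. Backward: the defect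
  \<open>?W\<close> has zero derivative in v and vanishes at v = 0, hence is 0 because positive
  integers cancel.\<close>

lemma is_logarithm_iff:
  fixes c :: "nat \<Rightarrow> nat \<Rightarrow> 'r"
  assumes "is_fgl c"
  shows "is_logarithm c g \<longleftrightarrow> g $ 0 = 0 \<and> fps_deriv g * invariant_series c = 1"
proof -
  interpret fgl c by unfold_locales fact
  interpret D: derivation3 "deriv_v :: 'r fps3 \<Rightarrow> _" by (rule derivation3_deriv_v)
  interpret Z: continuous_hom "zero_v :: 'r fps3 \<Rightarrow> _" by (rule continuous_hom_zero_v)
  note o = order_ge_vars(1-3) order_ge_subst2_fgl order_ge_0
  note hom1 = ring_hom_simps[OF subst1_hom]
  note Zhom = ring_hom_simps[OF Z.hom]
  show ?thesis
  proof (intro iffI conjI)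
    assume l: "is_logarithm c g"
    then show g0: "g $ 0 = 0" by (simp add: is_logarithm_def)
    have "subst1 g F = subst1 g uvar + subst1 g vvar" and g1: "g $ 1 = 1"
      using l by (simp_all add: is_logarithm_def)
    then have "deriv_v (subst1 g F) = deriv_v (subst1 g uvar + subst1 g vvar)" by simp
    then have "subst1 (fps_deriv g) F * subst2 c\<^sub>2 uvar vvar = subst1 (fps_deriv g) vvar"
      by (simp only: D.subst1 D.add o deriv_v_vars deriv_v_F mult_zero_right mult_1_right add_0_left)
    then have "zero_v (subst1 (fps_deriv g) F * subst2 c\<^sub>2 uvar vvar) = zero_v (subst1 (fps_deriv g) vvar)"
      by simp
    then have "subst1 (fps_deriv g) uvar * subst1 p uvar = subst1 (fps_deriv g) 0"
      by (simp only: Zhom Z.subst1 Z.subst2 o zero_vars subst2_u_0 subst2_c2_0)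
    \<comment> \<open>Substituting 0 leaves the constant coefficient of g', which is
      \<open>g $ 1\<close>.\<close>
    moreover have "subst1 (fps_deriv g) 0 = 1"
    proof -
      have "subst1 (fps_deriv g) 0 = subst1 (fps_deriv g - 1) 0 + subst1 1 0"
        by (simp add: hom1)
      also have "subst1 (fps_deriv g - 1) 0 = 0"
        by (rule subst1_0) (use g1 in simp)
      finally show ?thesis by (simp add: hom1)
    qed
    ultimately have "subst1 (fps_deriv g * p) uvar = subst1 1 uvar"
      by (simp add: hom1)
    then show "fps_deriv g * p = 1"
      by (simp add: subst1_uvar embed1_inj)
  next
    assume r: "g $ 0 = 0 \<and> fps_deriv g * p = 1"
    let ?q = "fps_deriv g"
    have g1: "g $ 1 = 1"
      using arg_cong[of _ _ "\<lambda>s. s $ 0", OF conjunct2[OF r]] coeff_0_1 by (simp add: invariant_series_def)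
    have qp: "subst1 ?q x * subst1 p x = 1" if "order_ge 1 x" for x
      using r hom1(4)[OF that, of ?q p] hom1(2)[OF that] by simp
    have oF: "order_ge 1 F" by (intro o)
    let ?W = "subst1 g F - subst1 g uvar - subst1 g vvar"
    \<comment> \<open>Invariance of the differential du / p(u), with \<open>?q\<close> as the
      inverse of \<open>p\<close>.\<close>
    have "deriv_v F = subst1 p F * subst1 ?q vvar"
      unfolding subst1_invariant_F mult.assoc using qp[OF order_ge_vars(2)] by (simp add: mult.commute)
    then have "deriv_v (subst1 g F) = (subst1 ?q F * subst1 p F) * subst1 ?q vvar"
      unfolding D.subst1[OF oF] by (simp add: mult_ac)
    then have "deriv_v ?W = 0"
      by (simp only: D.diff D.subst1 o oF qp deriv_v_vars) simp
    then have "coeff3 ?W p (Suc q) r = 0" for p q r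
      using of_nat_cancel[of "Suc q" "coeff3 ?W p (Suc q) r" 0] coeff3_deriv(1)[of ?W p q r] by simp
    moreover have "zero_v ?W = 0"
      using subst1_0[OF conjunct1[OF r]]
      by (simp only: Zhom Z.subst1 Z.subst2 o oF zero_vars subst2_u_0) simp
    then have "coeff3 ?W p 0 r = 0" for p r
      using coeff3_zero(2)[of ?W p 0 r] by simp
    ultimately have "?W = 0"
      unfolding fps3_eq_iff[of ?W 0] coeff3_0 by (metis not0_implies_Suc)
    then show "is_logarithm c g"
      using r g1 by (simp add: is_logarithm_def algebra_simps)
  qed
qed

lemma logarithm_unique:
  fixes c :: "nat \<Rightarrow> nat \<Rightarrow> 'r"
  assumes "is_fgl c"
  shows "\<exists>!g. is_logarithm c g"
proof -
  interpret fgl c by unfold_locales fact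
  \<comment> \<open>The argument 1 is the inverse of the constant coefficient of \<open>p\<close>,
    which is \<open>c 0 1 = 1\<close>. The logarithm is the formal integral of
    \<open>?q\<close>.\<close>
  let ?q = "fps_right_inverse p 1"
  have pq: "p * ?q = 1"
    by (rule fps_right_inverse) (simp add: invariant_series_def coeff_0_1[simplified])
  define g where "g = Abs_fps (\<lambda>n. \<phi> (1 / of_nat n) * (if n = 0 then 0 else ?q $ (n - 1)))"
  have "of_nat (Suc n) * (\<phi> (1 / of_nat (Suc n)) * a) = a" for n a
    using of_nat_inverse[of "Suc n"] by (simp only: mult.assoc[symmetric] mult_1_left nat.distinct simp_thms)
  then have "fps_deriv g = ?q"
    by (simp add: fps_eq_iff g_def del: of_nat_Suc)
  then have g: "is_logarithm c g"
    using pq by (simp add: is_logarithm_iff[OF is_fgl] mult.commute) (simp add: g_def)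
  moreover have "h = g" if "is_logarithm c h" for h
  proof (rule fps_deriv_eqD)
    have h: "fps_deriv h * p = 1" and g: "fps_deriv g * p = 1"
      using that g by (simp_all only: is_logarithm_iff[OF is_fgl])
    have "fps_deriv h = fps_deriv h * (fps_deriv g * p)" by (simp only: g mult_1_right)
    also have "\<dots> = fps_deriv g * (fps_deriv h * p)" by (simp only: mult.left_commute)
    finally show "fps_deriv h = fps_deriv g" by (simp only: h mult_1_right)
  qed (use that g in \<open>simp add: is_logarithm_def\<close>)
  ultimately show ?thesis by blast
qed

end

section \<open>Correspondence between formal group laws and logarithms\<close>

lemma map3_add: "is_ring_hom h \<Longrightarrow> map3 h (s + t) = map3 h s + map3 h t"
  by (simp add: fps3_eq_iff ring_hom_simps)

lemma coeff3_subst2_vars: "coeff3 (subst2 c uvar vvar) i j 0 = c i j"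
proof -
  have m: "coeff3 (uvar ^ a * vvar ^ b) i j 0 = (if a = i \<and> b = j then 1 else (0::'a))" for a b
    by (auto simp: coeff3_def uvar_def vvar_def fps_const_power fps_X_power_nth)
  have "(\<Sum>a\<le>i+j+0. \<Sum>b\<le>i+j+0. c a b * coeff3 (uvar ^ a * vvar ^ b) i j 0)
     = (\<Sum>a\<le>i+j. if a = i then (\<Sum>b\<le>i+j. if b = j then c i j else 0) else 0)"
    by (intro sum.cong) (auto simp: m mult_delta_right intro!: sum.neutral)
  then show ?thesis by (simp add: subst2_def)
qed

text \<open>Applying the inverse of \<open>g\<close> to g(F) = g(u) + g(v) recovers F.\<close>

lemma logarithm_determines_fgl:
  assumes "is_fgl c" "is_logarithm c g" "f $ 0 = 0" "f oo g = fps_X"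
  shows "c i j = coeff3 (subst1 f (subst1 g uvar + subst1 g vvar)) i j 0"
proof -
  interpret fgl c by unfold_locales fact
  have o: "order_ge 1 F" by (rule order_ge_subst2_fgl) auto
  have g: "g $ 0 = 0" "subst1 g F = subst1 g uvar + subst1 g vvar"
    using assms(2) by (simp_all add: is_logarithm_def)
  have "F = subst1 f (subst1 g F)"
    using subst1_compose[OF o g(1), of f] assms(4) subst1_X[OF o] by simp
  then show ?thesis using g(2) coeff3_subst2_vars[of c i j] by simp
qed

text \<open>Take F = f(g(u) + g(v)). Evaluation extends this formula to all arguments of positive
  order, and the axioms become those of addition, transported along \<open>g\<close>.\<close>

lemma fgl_of_logarithm:
  fixes g :: "'r::comm_ring_1 fps"
  assumes g: "g $ 0 = 0" "g $ 1 = 1"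
  shows "\<exists>c. is_fgl c \<and> is_logarithm c g"
proof -
  obtain f where f: "f $ 0 = 0" "f oo g = fps_X" "g oo f = fps_X"
    using compose_inverse_exists[OF g] by blast
  define c where "c = (\<lambda>i j. coeff3 (subst1 f (subst1 g uvar + subst1 g vvar)) i j 0)"
  have s: "subst2 c x y = subst1 f (subst1 g x + subst1 g y)" if x: "order_ge 1 x" and y: "order_ge 1 y" for x y
  proof -
    interpret E: continuous_hom "eval_uv x y" by (rule continuous_hom_eval_uv[OF x y])
    have "subst2 c x y = eval_uv x y (subst1 f (subst1 g uvar + subst1 g vvar))"
      by (simp add: eval_uv_def c_def)
    then show ?thesis
      by (simp only: E.subst1 order_ge_add order_ge_subst1 order_ge_vars g ring_hom_simps(3)[OF E.hom]
          eval_uv_vars[OF x y])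
  qed
  have oo: "order_ge 1 (subst2 c x y)" if x: "order_ge 1 x" and y: "order_ge 1 y" for x y
    using that by (simp only: s order_ge_add order_ge_subst1 g f)
  have fg: "subst1 f (subst1 g x) = x" if "order_ge 1 x" for x
    using subst1_compose[OF that g(1), of f] subst1_X[OF that] f by simp
  have gf: "subst1 g (subst1 f x) = x" if "order_ge 1 x" for x
    using subst1_compose[OF that f(1), of g] subst1_X[OF that] f by simp
  have gs: "subst1 g (subst2 c x y) = subst1 g x + subst1 g y" if "order_ge 1 x" "order_ge 1 y" for x y
    using that by (simp only: s gf order_ge_add order_ge_subst1 g)
  have "is_fgl c"
    unfolding is_fgl_def
    by (simp only: s gs gf f g order_ge_add order_ge_subst1 order_ge_vars order_ge_0 subst1_0[OF g(1)] fg ac_simps add_0_left add_0_right simp_thms)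
  moreover have "is_logarithm c g"
    using g by (simp only: is_logarithm_def gs order_ge_vars simp_thms)
  ultimately show ?thesis by blast
qed


section \<open>Ring homomorphisms out of the rational Lazard ring\<close>

interpretation lazard: rat_algebra lazard_const
proof
  have *: "lazard_const = (\<lambda>c::rat. abs_lazard (mconst c))"
    by (simp add: fun_eq_iff lazard_const.abs_eq)
  show "is_ring_hom (lazard_const :: rat \<Rightarrow> rat lazard)"
    unfolding * by (rule ring_hom_comp[OF abs_lazard_hom mconst_hom])
qed

lemma is_logarithm_g_U: "is_logarithm universal_fgl g_U"
  unfolding g_U_def using lazard.logarithm_unique[OF is_fgl_universal] by (rule theI')

lemma g_U_nth: "g_U $ 0 = 0" "g_U $ 1 = 1" "g_U $ Suc 0 = 1"
  using is_logarithm_g_U by (simp_all add: is_logarithm_def)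

text \<open>The Lazard ring classifies formal group laws, and over the rationals these correspond to
  normalized logarithms. Hence a homomorphism may be prescribed freely, and uniquely, by the image
  of \<open>g_U\<close>.\<close>

lemma lazard_hom_unique:
  fixes \<phi> :: "rat \<Rightarrow> 'r::comm_ring_1"
  assumes \<phi>: "is_ring_hom \<phi>" and g: "g $ 0 = 0" "g $ 1 = 1"
  shows "\<exists>!h. is_ring_hom h \<and> (\<forall>a. h (lazard_const a) = \<phi> a) \<and> map_fps h g_U = g"
proof -
  interpret rat_algebra \<phi> by unfold_locales fact
  obtain c where c: "is_fgl c" "is_logarithm c g"
    using fgl_of_logarithm[OF g] by blast
  obtain f where f: "f $ 0 = 0" "f oo g = fps_X"
    using compose_inverse_exists[OF g] by blast
  have log: "is_logarithm (\<lambda>i j. h (universal_fgl i j)) (map_fps h g_U)" if h: "is_ring_hom h" for h :: "rat lazard \<Rightarrow> 'r"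
  proof -
    have "map3 h (subst1 g_U (subst2 universal_fgl uvar vvar)) = map3 h (subst1 g_U uvar + subst1 g_U vvar)"
      using is_logarithm_g_U by (simp add: is_logarithm_def)
    then show ?thesis
      by (simp add: is_logarithm_def g_U_nth ring_hom_simps[OF h] map3_subst1[OF h] map3_subst2[OF h]
          map3_simps[OF h] map3_add[OF h])
  qed
  have fgl: "is_fgl (\<lambda>i j. h (universal_fgl i j))" if "is_ring_hom h" for h :: "rat lazard \<Rightarrow> 'r"
    using is_fgl_universal[where ?'k = rat] that
    by (auto simp: is_fgl_iff_defects fgl_defects_hom ring_hom_simps)
  have "map_fps h g_U = g \<longleftrightarrow> (\<forall>i j. h (universal_fgl i j) = c i j)" if h: "is_ring_hom h" for h
  proof
    assume "map_fps h g_U = g"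
    then show "\<forall>i j. h (universal_fgl i j) = c i j"
      using logarithm_determines_fgl[OF fgl[OF h] _ f] logarithm_determines_fgl[OF c f] log[OF h] by auto
  next
    assume "\<forall>i j. h (universal_fgl i j) = c i j"
    then show "map_fps h g_U = g"
      using log[OF h] c logarithm_unique[OF c(1)] by auto
  qed
  then show ?thesis
    using lazard_universal[OF \<phi> c(1)] by (metis (no_types, lifting))
qed


section \<open>The series \<open>B\<close>\<close>

lemma f_U: "f_U $ 0 = 0" "f_U $ 1 = 1" "f_U oo g_U = fps_X" "g_U oo f_U = fps_X"
proof -
  obtain f where f: "f $ 0 = 0" "f $ 1 = 1" "f oo g_U = fps_X" "g_U oo f = fps_X"
    using compose_inverse_exists[OF g_U_nth(1,2)] by blast
  have "f_U = f"
    unfolding f_U_def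
    by (rule the_equality) (use f in blast, blast intro: compose_inverse_unique[OF g_U_nth(1) f(1,3)])
  then show "f_U $ 0 = 0" "f_U $ 1 = 1" "f_U oo g_U = fps_X" "g_U oo f_U = fps_X"
    using f by simp_all
qed

lemma compose_uminus_X_nth: "(h oo - fps_X) $ n = (-1) ^ n * h $ n" for h :: "'r::comm_ring_1 fps"
  by (simp add: fps_compose_uminus')

lemma uminus_X_compose: "a $ 0 = 0 \<Longrightarrow> - fps_X oo a = (- a :: 'r::comm_ring_1 fps)"
  by (simp add: fps_compose_uminus)

lemma compose_uminus: "a $ 0 = 0 \<Longrightarrow> h oo - a = (h oo - fps_X) oo a" for h :: "'r::comm_ring_1 fps"
  using compose_assoc[of "- fps_X" a h] by (simp add: uminus_X_compose)

lemma compose_X2_nth: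
  fixes h :: "'r::comm_ring_1 fps"
  shows "(h oo fps_X\<^sup>2) $ n = (if even n then h $ (n div 2) else 0)"
proof -
  have "(h oo fps_X\<^sup>2) $ n = (\<Sum>i=0..n. if i = n div 2 \<and> even n then h $ i else 0)"
    unfolding fps_compose_nth by (intro sum.cong) (auto simp: power_mult[symmetric] fps_X_power_nth)
  then show ?thesis by simp
qed

lemma compose_X2_cancel: "h oo fps_X\<^sup>2 = k oo fps_X\<^sup>2 \<Longrightarrow> h = k" for h k :: "'r::comm_ring_1 fps"
  by (rule fps_ext) (metis compose_X2_nth even_mult_iff even_numeral nonzero_mult_div_cancel_left zero_neq_numeral)

lemma compose_uminus_X_cancel:
  fixes h k :: "'r::comm_ring_1 fps"
  assumes "h oo - fps_X = k oo - fps_X"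
  shows "h = k"
proof (rule fps_ext)
  fix n
  have "(-1) ^ n * ((-1) ^ n * h $ n) = (-1) ^ n * ((-1) ^ n * k $ n)"
    using arg_cong[OF assms, of "\<lambda>s. s $ n"] by (simp add: compose_uminus_X_nth)
  then show "h $ n = k $ n"
    by (simp add: mult.assoc[symmetric] flip: power_add)
qed

lemma X2_power_compose: "a $ 0 = 0 \<Longrightarrow> fps_X\<^sup>2 oo a = a\<^sup>2" for a :: "'r::comm_ring_1 fps"
  by (simp add: compose_simps)

context rat_algebra
begin

text \<open>An odd coefficient equals its own negative, and 2 cancels.\<close>

lemma even_series:
  fixes e :: "'r fps"
  assumes "e oo - fps_X = e"
  shows "\<exists>h. e = h oo fps_X\<^sup>2"
proof
  have "e $ n = 0" if "odd n" for n
  proof -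
    have *: "- (e $ n) = e $ n"
      using arg_cong[OF assms, of "\<lambda>s. s $ n"] that by (simp add: compose_uminus_X_nth)
    have "e $ n + e $ n = - (e $ n) + e $ n" unfolding * ..
    also have "\<dots> = 0" by (rule add.left_inverse)
    finally have "e $ n + e $ n = 0" .
    then have "of_nat 2 * e $ n = of_nat 2 * 0"
      by (simp only: of_nat_numeral mult_2 mult_zero_right)
    then show ?thesis using of_nat_cancel[of 2 "e $ n" 0] by simp
  qed
  then show "e = Abs_fps (\<lambda>k. e $ (2 * k)) oo fps_X\<^sup>2"
    by (auto simp: fps_eq_iff compose_X2_nth)
qed

text \<open>
  With \<open>f(z) f(-z) = H(z\<^sup>2)\<close> the condition on \<open>B\<close> becomes \<open>B(H(x)) = -x\<close>.
\<close>

lemma B_exists_unique: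
  fixes f g :: "'r fps"
  assumes f: "f $ 0 = 0" "f $ 1 = 1" and g: "g $ 0 = 0" "g $ 1 = 1" and fg: "f oo g = fps_X"
  shows "\<exists>!B. B $ 0 = 0 \<and> B $ 1 = 1 \<and> B oo (fps_X * (f oo - g)) = - (g\<^sup>2)"
proof -
  let ?e = "f * (f oo - fps_X)"
  have m0: "(- fps_X :: 'r fps) $ 0 = 0" by simp
  have mm: "(h oo - fps_X) oo - fps_X = h" for h :: "'r fps"
    by (simp add: fps_eq_iff compose_uminus_X_nth mult.assoc[symmetric] flip: power_add)
  have "?e oo - fps_X = ?e"
    by (simp only: compose_simps(4)[OF m0] mm mult.commute)
  then obtain H where H: "?e = H oo fps_X\<^sup>2"
    using even_series by blast
  have H0: "H $ 0 = 0"
    using arg_cong[OF H, of "\<lambda>s. s $ 0"] f by (simp add: compose_X2_nth)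
  have "?e $ 2 = -1"
    using f by (simp add: fps_mult_nth compose_uminus_X_nth numeral_2_eq_2)
  moreover have "(H oo fps_X\<^sup>2) $ 2 = H $ 1"
    by (simp add: compose_X2_nth)
  ultimately have H1: "H $ 1 = -1"
    by (simp only: H)
  have g2: "(g\<^sup>2) $ 0 = 0" using g by (simp add: power2_eq_square)
  have X2: "(fps_X\<^sup>2 :: 'r fps) $ 0 = 0" by simp
  \<comment> \<open>With z = g(u), the product of u and its formal inverse is f(z) f(-z).\<close>
  have "fps_X * (f oo - g) = ?e oo g"
    by (simp add: compose_simps g fg compose_uminus[OF g(1), of f])
  also have "\<dots> = H oo g\<^sup>2"
    unfolding H by (simp add: compose_assoc[OF X2 g(1), symmetric] X2_power_compose g)
  finally have 1: "B oo (fps_X * (f oo - g)) = - (g\<^sup>2) \<longleftrightarrow> B oo H = - fps_X" for B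
  proof -
    assume *: "fps_X * (f oo - g) = H oo g\<^sup>2"
    have "B oo (fps_X * (f oo - g)) = ((B oo H) oo fps_X\<^sup>2) oo g"
      by (simp only: * compose_assoc[OF H0 g2] compose_assoc[OF X2 g(1), symmetric] X2_power_compose g)
    moreover have "- (g\<^sup>2) = (- fps_X oo fps_X\<^sup>2) oo g"
      by (simp add: uminus_X_compose fps_compose_uminus X2_power_compose g)
    ultimately show ?thesis
      using compose_cancel[OF g] compose_X2_cancel by metis
  qed
  \<comment> \<open>\<open>- H\<close> has linear coefficient 1 and so has an inverse
    \<open>K\<close>; the solution of B(H(x)) = -x is then B(x) = -K(-x).\<close>
  obtain K where K: "K $ 0 = 0" "K $ 1 = 1" "K oo - H = fps_X"
    using compose_left_inverse_exists[of "- H"] H0 H1 by auto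
  have 2: "B oo H = - fps_X \<longleftrightarrow> B = - (K oo - fps_X)" for B
  proof -
    have "B oo H = (B oo - fps_X) oo - H"
      unfolding compose_uminus[OF H0] mm ..
    moreover have "- fps_X = (- K) oo - H" by (simp add: fps_compose_uminus K)
    ultimately have "B oo H = - fps_X \<longleftrightarrow> B oo - fps_X = - K"
      using compose_cancel[of "- H" "B oo - fps_X" "- K"] H0 H1 by auto
    also have "\<dots> \<longleftrightarrow> B = - (K oo - fps_X)"
      using mm by (metis fps_compose_uminus)
    finally show ?thesis .
  qed
  show ?thesis
    unfolding 1 2 using K by (auto simp: compose_uminus_X_nth)
qed

end

lemma B_U: "B_U $ 0 = 0" "B_U $ 1 = 1" "B_U oo (fps_X * ubar) = - (g_U\<^sup>2)"
  using theI'[OF lazard.B_exists_unique[OF f_U(1,2) g_U_nth(1,2) f_U(3)]]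
  unfolding B_U_def ubar_def by blast+


section \<open>Genera and Lagrange inversion\<close>

interpretation mpoly: rat_algebra "mconst :: rat \<Rightarrow> ('v, rat) mpoly"
  by unfold_locales (rule mconst_hom)

text \<open>Up to the invertible factor n + 1, the class \<open>CP n\<close> is a coefficient of
  \<open>g_U\<close>. Prescribing the values on all \<open>CP n\<close> therefore amounts to
  prescribing the image of \<open>g_U\<close>, so the definite description is well defined.\<close>

lemma total_char_number:
  "is_ring_hom total_char_number" "total_char_number (lazard_const a) = mconst a"
  "total_char_number (CP n) = (generic_series ^ (n + 1)) $ n"
proof -
  define g where "g = Abs_fps (\<lambda>n. if n = 0 then 0 else
    mconst (1 / of_nat n) * (generic_series ^ n) $ (n - 1))"
  have g: "g $ 0 = 0" "g $ 1 = 1"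
    by (simp_all add: g_def generic_series_def)
  have "(\<forall>n. h (CP n) = (generic_series ^ (n + 1)) $ n) \<longleftrightarrow> map_fps h g_U = g"
    if h: "is_ring_hom h" for h :: "rat lazard \<Rightarrow> (nat, rat) mpoly"
  proof -
    have of_nat: "h (of_nat n) = of_nat n" for n
      by (induction n) (auto simp: ring_hom_simps[OF h])
    have "h (CP n) = (generic_series ^ (n + 1)) $ n \<longleftrightarrow> h (g_U $ Suc n) = g $ Suc n" for n
    proof -
      have "of_nat (Suc n) * g $ Suc n = (generic_series ^ (n + 1)) $ n"
        by (simp add: g_def mult.assoc[symmetric] mpoly.of_nat_inverse del: of_nat_Suc)
      moreover have "h (CP n) = of_nat (Suc n) * h (g_U $ Suc n)"
        by (simp add: CP_def ring_hom_simps[OF h] of_nat)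
      ultimately show ?thesis
        using mpoly.of_nat_cancel[of "Suc n" "h (g_U $ Suc n)" "g $ Suc n"] by (metis nat.distinct(1))
    qed
    moreover have "h (g_U $ 0) = g $ 0" by (simp add: g g_U_nth ring_hom_simps[OF h])
    ultimately show ?thesis
      unfolding fps_eq_iff map_fps_nth by (metis not0_implies_Suc)
  qed
  then have "\<exists>!h. is_ring_hom h \<and> (\<forall>c. h (lazard_const c) = mconst c) \<and>
      (\<forall>n. h (CP n) = (generic_series ^ (n + 1)) $ n)"
    using lazard_hom_unique[OF mconst_hom g] by (metis (no_types, lifting))
  from theI'[OF this] show "is_ring_hom total_char_number" "total_char_number (lazard_const a) = mconst a"
    "total_char_number (CP n) = (generic_series ^ (n + 1)) $ n"
    unfolding total_char_number_def by blast+
qed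

lemma x_over:
  fixes f :: "'r::comm_ring_1 fps"
  assumes "f $ 0 = 0" "f $ 1 = 1"
  shows "x_over f * f = fps_X" "x_over f $ 0 = 1"
proof -
  define s where "s = fps_shift 1 f"
  define q where "q = fps_right_inverse s 1"
  have s: "f = fps_X * s" and "s $ 0 = 1"
    using assms by (auto simp: s_def fps_eq_iff)
  then have sq: "s * q = 1"
    unfolding q_def by (intro fps_right_inverse) simp
  have "x_over f = q"
    unfolding x_over_def
  proof (rule the_equality)
    show "q * f = fps_X" using sq by (simp add: s mult_ac)
    fix q' assume "q' * f = fps_X"
    then have "q' * (fps_X * s) * q = fps_X * q" by (simp add: s)
    then have "fps_X * q' = fps_X * q"
      using sq by (simp add: mult_ac)
    then have "(fps_X * q') $ Suc n = (fps_X * q) $ Suc n" for n by simp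
    then show "q' = q" by (simp add: fps_eq_iff)
  qed
  then show "x_over f * f = fps_X" "x_over f $ 0 = 1"
    using sq by (simp_all add: s mult_ac) (simp add: q_def)
qed

text \<open>Summing characteristic numbers against the monomials is evaluating one polynomial at the
  coefficients of x / f(x), which makes multiplicativity immediate.\<close>

lemma hirzebruch_genus_eq:
  "hirzebruch_genus f M = mpoly_eval mconst (\<lambda>j. x_over f $ j) (total_char_number M)"
  by (simp add: hirzebruch_genus_def mpoly_eval_def char_number_def keys.rep_eq)

lemma hirzebruch_genus_hom: "is_ring_hom (hirzebruch_genus f)"
  unfolding hirzebruch_genus_eq[abs_def]
  by (rule ring_hom_comp[OF mpoly_eval_hom[OF mconst_hom] total_char_number(1)])

lemma hirzebruch_genus_CP:
  assumes "f $ 0 = 0" "f $ 1 = 1"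
  shows "hirzebruch_genus f (CP n) = (x_over f ^ (n + 1)) $ n"
proof -
  let ?e = "mpoly_eval mconst (\<lambda>j. x_over f $ j)"
  have e: "is_ring_hom ?e" by (rule mpoly_eval_hom[OF mconst_hom])
  have "map_fps ?e generic_series = x_over f"
    by (simp add: fps_eq_iff generic_series_def ring_hom_simps[OF e] x_over[OF assms] mpoly_eval_var[OF mconst_hom])
  then have "map_fps ?e (generic_series ^ (n + 1)) = x_over f ^ (n + 1)"
    by (simp only: ring_hom_power[OF map_fps_hom[OF e]])
  from arg_cong[OF this, of "\<lambda>s. s $ n"] show ?thesis
    by (simp only: hirzebruch_genus_eq total_char_number map_fps_nth)
qed

text \<open>Since g'(f) f' = 1, the n-th coefficient of \<open>q ^ (n + 1)\<close> is that of g'(f)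
  \<open>?b\<close>. Expanding g'(f) in powers of \<open>f\<close>, only the power with k = n
  contributes.\<close>

lemma lagrange_inversion:
  fixes f g q :: "'r::{idom, ring_char_0} fps"
  assumes f: "f $ 0 = 0" and g: "g oo f = fps_X" and q: "q * f = fps_X"
  shows "of_nat (n + 1) * g $ (n + 1) = (q ^ (n + 1)) $ n"
proof -
  let ?b = "fps_deriv f * q ^ (n + 1)"
  have qf1: "(q * fps_deriv f) $ 0 = 1"
  proof -
    have "fps_deriv (q * f) $ 0 = 1" unfolding q by simp
    then show ?thesis using f by simp
  qed
  \<comment> \<open>The coefficient is the formal residue of f' / f^(m+1). For m > 0 this is an
    exact differential; the proof uses the derivative of \<open>q ^ m\<close> and cancels m.\<close>
  have low: "(q ^ (m + 1) * fps_deriv f) $ m = (if m = 0 then 1 else 0)" for m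
  proof (cases m)
    case (Suc k)
    have "fps_deriv (q * f) = 1" unfolding q by simp
    then have "q * fps_deriv f = 1 - fps_deriv q * f" by (simp add: algebra_simps)
    moreover have "q ^ (m + 1) * fps_deriv f = q ^ m * (q * fps_deriv f)"
      by (simp add: mult_ac)
    ultimately have "q ^ (m + 1) * fps_deriv f = q ^ m - q ^ m * fps_deriv q * f"
      by (simp add: right_diff_distrib mult_ac)
    also have "q ^ m * fps_deriv q * f = fps_X * (q ^ k * fps_deriv q)"
      by (simp add: Suc q[symmetric] mult_ac)
    finally have "(q ^ (m + 1) * fps_deriv f) $ m = q ^ m $ m - (q ^ k * fps_deriv q) $ k"
      by (simp add: Suc del: power_Suc)
    moreover have "fps_deriv (q ^ m) $ k = of_nat m * (q ^ k * fps_deriv q) $ k"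
      unfolding Suc fps_deriv_power by (simp only: diff_Suc_1 mult.assoc fps_mult_left_const_nth mult.commute[of "q ^ k"])
    then have "of_nat m * (q ^ k * fps_deriv q) $ k = of_nat m * (q ^ m $ m)"
      by (simp add: Suc del: of_nat_Suc power_Suc)
    then have "(q ^ k * fps_deriv q) $ k = q ^ m $ m" using Suc by (simp del: of_nat_Suc power_Suc)
    ultimately show ?thesis using Suc by simp
  qed (use qf1 in simp)
  have fk: "(f ^ k * ?b) $ n = (if k = n then 1 else 0)" if "k \<le> n" for k
  proof -
    have "n + 1 = k + (n - k + 1)" using that by simp
    then have "q ^ (n + 1) = q ^ k * q ^ (n - k + 1)" by (metis power_add)
    then have "f ^ k * ?b = (q * f) ^ k * (q ^ (n - k + 1) * fps_deriv f)"
      by (simp only: power_mult_distrib mult_ac)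
    then have "(f ^ k * ?b) $ n = (q ^ (n - k + 1) * fps_deriv f) $ (n - k)"
      using that by (simp only: q fps_X_power_mult_nth) simp
    then show ?thesis
      using low[of "n - k"] that by simp
  qed
  have "((fps_deriv g oo f) * fps_deriv f) = 1"
    using arg_cong[OF g, of fps_deriv] fps_compose_deriv[OF f, of g] by simp
  then have "(q ^ (n + 1)) $ n = ((fps_deriv g oo f) * ?b) $ n"
    by (simp add: mult.assoc[symmetric])
  also have "\<dots> = (\<Sum>i=0..n. \<Sum>k=0..n. fps_deriv g $ k * (f ^ k $ i * ?b $ (n - i)))"
    unfolding fps_mult_nth[of "fps_deriv g oo f"] fps_compose_nth sum_distrib_right mult.assoc
    by (intro sum.cong sum.mono_neutral_left) (auto simp: startsby_zero_power_prefix[OF f])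
  also have "\<dots> = (\<Sum>k=0..n. fps_deriv g $ k * (f ^ k * ?b) $ n)"
    by (subst sum.swap) (simp only: fps_mult_nth[of "f ^ k" "?b" for k] sum_distrib_left)
  also have "\<dots> = (\<Sum>k=0..n. if k = n then fps_deriv g $ k else 0)"
  proof (rule sum.cong[OF refl])
    fix k assume "k \<in> {0..n}"
    then have "k \<le> n" by simp
    show "fps_deriv g $ k * (f ^ k * ?b) $ n = (if k = n then fps_deriv g $ k else 0)"
      by (simp only: fk[OF \<open>k \<le> n\<close>] if_distrib[of "\<lambda>a. fps_deriv g $ k * a"] mult_1_right mult_zero_right)
  qed
  finally show ?thesis by simp
qed

text \<open>The genus of \<open>CP n\<close> is the n-th coefficient of (x / f)^(n+1), which
  Lagrange inversion identifies with n + 1 times a coefficient of the inverse of \<open>f\<close>.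
  The order on variables makes the polynomial ring an integral domain.\<close>

lemma hirzebruch_genus_g_U:
  fixes f g :: "('v::linorder, rat) mpoly fps"
  assumes f: "f $ 0 = 0" "f $ 1 = 1" and g: "g $ 0 = 0" "g oo f = fps_X"
  shows "map_fps (hirzebruch_genus f) g_U = g"
proof (rule fps_ext)
  fix n
  let ?h = "hirzebruch_genus f"
  note h = hirzebruch_genus_hom[of f]
  have of_nat: "?h (of_nat n) = of_nat n" for n
    by (induction n) (auto simp: ring_hom_simps[OF h])
  show "map_fps ?h g_U $ n = g $ n"
  proof (cases n)
    case 0
    then show ?thesis by (simp add: g g_U_nth ring_hom_simps[OF h])
  next
    case (Suc m)
    have "of_nat (Suc m) * ?h (g_U $ Suc m) = of_nat (Suc m) * g $ Suc m"
      using hirzebruch_genus_CP[OF f, of m] lagrange_inversion[OF f(1) g(2) x_over(1)[OF f], of m]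
      by (simp add: CP_def ring_hom_simps[OF h] of_nat)
    then show ?thesis using mpoly.of_nat_cancel[of "Suc m"] Suc by (metis map_fps_nth nat.distinct(1))
  qed
qed

text \<open>For odd \<open>f\<close> the image of \<open>ubar\<close> is -u, so the defining
  equation of B becomes B(-u^2) = -g(u)^2.\<close>

lemma hirzebruch_genus_B_U:
  fixes f g :: "('v::linorder, rat) mpoly fps"
  assumes f: "f $ 0 = 0" "f $ 1 = 1" and g: "g $ 0 = 0" "g oo f = fps_X" "f oo g = fps_X"
    and odd: "f oo - fps_X = - f"
  shows "map_fps (hirzebruch_genus f) B_U oo - (fps_X\<^sup>2) = - (g\<^sup>2)"
proof -
  let ?h = "hirzebruch_genus f"
  note h = hirzebruch_genus_hom[of f]
  note H = ring_hom_simps[OF map_fps_hom[OF h]] ring_hom_power[OF map_fps_hom[OF h]] map_fps_compose[OF h]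
    map_fps_X[OF h]
  have gU: "map_fps ?h g_U = g" by (rule hirzebruch_genus_g_U) fact+
  have "map_fps ?h (g_U oo f_U) = fps_X" by (simp add: f_U H)
  then have "g oo map_fps ?h f_U = fps_X" by (simp add: H gU)
  moreover have "map_fps ?h f_U $ 0 = 0" by (simp add: f_U ring_hom_simps[OF h])
  ultimately have fU: "map_fps ?h f_U = f"
    using compose_inverse_unique[OF g(1) f(1) g(3)] by blast
  have "map_fps ?h ubar = - fps_X"
    by (simp add: ubar_def H fU gU compose_uminus[OF g(1), of f] odd fps_compose_uminus g)
  then have "map_fps ?h (fps_X * ubar) = - (fps_X\<^sup>2)"
    by (simp add: H power2_eq_square)
  then show ?thesis
    using arg_cong[OF B_U(3), of "map_fps ?h"] by (simp only: H gU)
qed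


section \<open>The exponential of \<open>Bc\<^sub>N\<close>\<close>

text \<open>\<open>R\<close>, \<open>inv_sqrt\<close> and \<open>arc\<close> are the series R, C and
  G of the introduction, in the variable x = t^2.\<close>

locale elliptic_type =
  fixes R :: "('v::linorder, rat) mpoly fps"
  assumes R0: "R $ 0 = 1"
begin

definition "inv_sqrt = map_fps mconst (fps_binomial (- (1 / 2))) oo (R - 1)"

text \<open>\<open>t arc(t\<^sup>2)\<close> is the integral of \<open>inv_sqrt(t\<^sup>2)\<close>.\<close>

definition "arc = Abs_fps (\<lambda>k. mconst (1 / of_nat (2 * k + 1)) * inv_sqrt $ k)"

lemma inv_sqrt_0: "inv_sqrt $ 0 = 1"
  by (simp add: inv_sqrt_def)

lemma inv_sqrt: "inv_sqrt\<^sup>2 * R = 1"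
proof -
  have r: "(R - 1) $ 0 = 0" by (simp add: R0)
  have "fps_binomial (- (1 / 2)) ^ 2 * (1 + fps_X) = (1 :: rat fps)"
    unfolding fps_binomial_power fps_binomial_1[symmetric] by (simp flip: fps_binomial_add_mult)
  from arg_cong[OF this, of "map_fps mconst"]
  have "map_fps mconst (fps_binomial (- (1 / 2))) ^ 2 * (1 + fps_X) = (1 :: ('v, rat) mpoly fps)"
    by (simp only: ring_hom_simps[OF map_fps_hom[OF mconst_hom]] ring_hom_power[OF map_fps_hom[OF mconst_hom]]
        map_fps_X[OF mconst_hom])
  from arg_cong[OF this, of "\<lambda>s. s oo (R - 1)"] show ?thesis
    by (simp add: compose_simps[OF r] inv_sqrt_def R0)
qed

lemma arc_0: "arc $ 0 = 1"
  by (simp add: arc_def inv_sqrt_0)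

lemma arc_ode: "arc + 2 * fps_X * fps_deriv arc = inv_sqrt"
proof (rule fps_ext)
  fix n
  have "(arc + 2 * fps_X * fps_deriv arc) $ n = of_nat (2 * n + 1) * arc $ n"
    by (cases n) (simp_all add: mult.assoc numeral_fps_const algebra_simps)
  also have "\<dots> = inv_sqrt $ n"
    by (simp add: arc_def mult.assoc[symmetric] mpoly.of_nat_inverse del: of_nat_Suc of_nat_add of_nat_mult)
  finally show "(arc + 2 * fps_X * fps_deriv arc) $ n = inv_sqrt $ n" .
qed

text \<open>The logarithm of the genus. The argument is negated because the signs in the equation
  for f alternate, that is, f'^2 = R(-f^2).\<close>

definition "arc_log = fps_X * (arc oo - (fps_X\<^sup>2))"

lemma arc_log_nth: "arc_log $ 0 = 0" "arc_log $ 1 = 1"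
  by (simp_all add: arc_log_def arc_0)

lemma neg_X2_0: "(- (fps_X\<^sup>2) :: ('v, rat) mpoly fps) $ 0 = 0"
  by simp

lemma deriv_arc_log: "fps_deriv arc_log = inv_sqrt oo - (fps_X\<^sup>2)"
proof -
  have "fps_deriv arc_log = (arc oo - (fps_X\<^sup>2)) + 2 * - (fps_X\<^sup>2) * (fps_deriv arc oo - (fps_X\<^sup>2))"
    by (simp add: arc_log_def fps_compose_deriv fps_deriv_power' power2_eq_square algebra_simps)
  also have "\<dots> = (arc + 2 * fps_X * fps_deriv arc) oo - (fps_X\<^sup>2)"
    by (simp add: compose_simps[OF neg_X2_0] neg_X2_0)
  finally show ?thesis by (simp only: arc_ode)
qed

lemma deriv_arc_log_square: "(fps_deriv arc_log)\<^sup>2 * (R oo - (fps_X\<^sup>2)) = 1"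
  using arg_cong[OF inv_sqrt, of "\<lambda>s. s oo - (fps_X\<^sup>2)"]
  by (simp add: deriv_arc_log compose_simps[OF neg_X2_0])

text \<open>In terms of the inverse g of f the equation reads g'(z)^2 R(-z^2) = 1, and a square root
  with constant coefficient 1 is unique, so g' is the derivative of \<open>arc_log\<close>.\<close>

lemma exponential_ode_iff:
  assumes f: "f $ 0 = 0" "f $ 1 = 1"
  shows "(fps_deriv f)\<^sup>2 = R oo - (f\<^sup>2) \<longleftrightarrow> arc_log oo f = fps_X"
proof
  have f2: "R oo - (f\<^sup>2) = (R oo - (fps_X\<^sup>2)) oo f"
    using compose_assoc[OF neg_X2_0 f(1), of R] by (simp add: compose_simps[OF f(1)] f)
  have chain: "(fps_deriv g oo f) * fps_deriv f = 1" if "g oo f = fps_X" for g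
    using arg_cong[OF that, of fps_deriv] fps_compose_deriv[OF f(1), of g] by simp
  have sq: "(fps_deriv f)\<^sup>2 = R oo - (f\<^sup>2) \<longleftrightarrow> ((fps_deriv g)\<^sup>2 * (R oo - (fps_X\<^sup>2))) oo f = 1"
    if g: "g oo f = fps_X" for g
  proof -
    have ab: "(fps_deriv g oo f)\<^sup>2 * (fps_deriv f)\<^sup>2 = 1" (is "?a * ?b = 1")
      using chain[OF g] by (simp flip: power_mult_distrib)
    have "?b = c \<longleftrightarrow> ?a * c = 1" for c
    proof
      assume ac: "?a * c = 1"
      have "?b = ?b * (?a * c)" by (simp only: ac mult_1_right)
      also have "\<dots> = (?a * ?b) * c" by (simp only: mult_ac)
      finally show "?b = c" by (simp only: ab mult_1_left)
    qed (use ab in simp)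
    then show ?thesis
      by (simp add: f2 compose_simps[OF f(1)])
  qed
  show "(fps_deriv f)\<^sup>2 = R oo - (f\<^sup>2)" if "arc_log oo f = fps_X"
    unfolding sq[OF that] deriv_arc_log_square by simp
  show "arc_log oo f = fps_X" if ode: "(fps_deriv f)\<^sup>2 = R oo - (f\<^sup>2)"
  proof -
    obtain g where g: "g $ 0 = 0" "g $ 1 = 1" "g oo f = fps_X"
      using compose_left_inverse_exists[OF f] by blast
    have "((fps_deriv g)\<^sup>2 * (R oo - (fps_X\<^sup>2))) oo f = 1 oo f"
      using sq[OF g(3)] ode by simp
    then have "(fps_deriv g)\<^sup>2 * (R oo - (fps_X\<^sup>2)) = (fps_deriv arc_log)\<^sup>2 * (R oo - (fps_X\<^sup>2))"
      using compose_cancel[OF f] deriv_arc_log_square by metis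
    moreover have "R oo - (fps_X\<^sup>2) \<noteq> 0"
      using deriv_arc_log_square by auto
    ultimately have "(fps_deriv g)\<^sup>2 = (fps_deriv arc_log)\<^sup>2" by simp
    then have "fps_deriv g = fps_deriv arc_log"
      by (rule fps_power_eqD) (use g arc_log_nth in simp_all)
    then have "g = arc_log"
      by (rule mpoly.fps_deriv_eqD) (simp add: g arc_log_nth)
    then show ?thesis using g by simp
  qed
qed

lemma arc_log_odd: "arc_log oo - fps_X = - arc_log"
proof -
  have m0: "(- fps_X :: ('v, rat) mpoly fps) $ 0 = 0" by simp
  have "arc oo - (fps_X\<^sup>2) oo - fps_X = arc oo (- (fps_X\<^sup>2) oo - fps_X)"
    by (rule compose_assoc[symmetric]) simp_all
  also have "\<dots> = arc oo - (fps_X\<^sup>2)"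
    by (simp add: compose_simps[OF m0])
  finally show ?thesis
    by (simp add: arc_log_def compose_simps[OF m0])
qed

text \<open>As \<open>arc_log\<close> is odd, -f(-z) is also a right inverse of it and must equal
  f.\<close>

lemma exponential_odd:
  assumes f: "f $ 0 = 0" "arc_log oo f = fps_X"
  shows "f oo - fps_X = - f"
proof -
  have m0: "(- fps_X :: ('v, rat) mpoly fps) $ 0 = 0" by simp
  let ?k = "f oo - fps_X"
  obtain h where h: "h $ 0 = 0" "h oo arc_log = fps_X"
    using compose_left_inverse_exists[OF arc_log_nth] by blast
  have "arc_log oo - ?k = (arc_log oo - fps_X) oo ?k"
    by (rule compose_uminus) (simp add: f)
  also have "\<dots> = - ((arc_log oo f) oo - fps_X)"
    using compose_assoc[OF f(1) m0, of arc_log] by (simp add: arc_log_odd fps_compose_uminus)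
  also have "\<dots> = fps_X" by (simp add: f)
  finally have "arc_log oo - ?k = fps_X" .
  then have "- ?k = h"
    by (intro compose_inverse_unique[OF arc_log_nth(1) h]) (simp add: f)
  moreover have "f = h"
    using compose_inverse_unique[OF arc_log_nth(1) h f] .
  ultimately have "- ?k = f" by simp
  then show ?thesis by (metis minus_minus)
qed

lemma exponential_exists_unique:
  "\<exists>!f. (\<forall>k. even k \<longrightarrow> f $ k = 0) \<and> f $ 1 = 1 \<and> (fps_deriv f)\<^sup>2 = R oo - (f\<^sup>2)"
proof -
  obtain f where f: "f $ 0 = 0" "f $ 1 = 1" "f oo arc_log = fps_X" "arc_log oo f = fps_X"
    using compose_inverse_exists[OF arc_log_nth] by blast
  have "f $ k = 0" if "even k" for k
    using arg_cong[OF exponential_odd[OF f(1,4)], of "\<lambda>s. s $ k"] that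
    by (simp add: compose_uminus_X_nth)
  moreover have "h = f" if "\<forall>k. even k \<longrightarrow> h $ k = 0" "h $ 1 = 1" "(fps_deriv h)\<^sup>2 = R oo - (h\<^sup>2)" for h
  proof -
    have "h $ 0 = 0" using that(1) by simp
    then show ?thesis
      using compose_inverse_unique[OF arc_log_nth(1) f(1,3)] exponential_ode_iff that(2,3) by blast
  qed
  ultimately show ?thesis
    using f exponential_ode_iff[OF f(1,2)] by (intro ex1I[of _ f]) auto
qed

text \<open>Here -g(z)^2 = -z^2 G(-z^2)^2 is the series x G(x)^2 at x = -z^2, and substitution of
  -z^2 is injective.\<close>

lemma hirzebruch_genus_b_U:
  assumes f: "\<forall>k. even k \<longrightarrow> f $ k = 0" "f $ 1 = 1" and ode: "(fps_deriv f)\<^sup>2 = R oo - (f\<^sup>2)"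
  shows "hirzebruch_genus f (b_U n) = (arc\<^sup>2) $ n"
proof -
  have f0: "f $ 0 = 0" using f(1) by simp
  have inv: "arc_log oo f = fps_X" using exponential_ode_iff[OF f0 f(2)] ode by simp
  obtain h where h: "h $ 0 = 0" "h oo arc_log = fps_X"
    using compose_left_inverse_exists[OF arc_log_nth] by blast
  have "f = h" using compose_inverse_unique[OF arc_log_nth(1) h f0 inv] .
  then have "map_fps (hirzebruch_genus f) B_U oo - (fps_X\<^sup>2) = - (arc_log\<^sup>2)"
    using hirzebruch_genus_B_U[OF f0 f(2) arc_log_nth(1) inv _ exponential_odd[OF f0 inv]] h by simp
  also have "\<dots> = (fps_X * arc\<^sup>2) oo - (fps_X\<^sup>2)"
    by (simp add: compose_simps[OF neg_X2_0] neg_X2_0 arc_log_def power_mult_distrib)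
  finally have "(map_fps (hirzebruch_genus f) B_U oo - fps_X) oo fps_X\<^sup>2 = ((fps_X * arc\<^sup>2) oo - fps_X) oo fps_X\<^sup>2"
    by (simp add: compose_uminus[of "fps_X\<^sup>2"])
  then have "map_fps (hirzebruch_genus f) B_U = fps_X * arc\<^sup>2"
    using compose_X2_cancel compose_uminus_X_cancel by blast
  from arg_cong[OF this, of "\<lambda>s. s $ (n + 1)"] show ?thesis
    by (simp add: b_U_def)
qed

end

text \<open>Without signs: composing with -(f^2) produces the alternating signs in the equation for
  \<open>f_Bc\<close>.\<close>

definition R_Bc :: "nat \<Rightarrow> (nat, rat) mpoly fps" where
  "R_Bc N = Abs_fps (\<lambda>k. if k = 0 then 1 else if k \<le> N then mvar k else 0)"

interpretation Bc: elliptic_type "R_Bc N" for N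
  by unfold_locales (simp add: R_Bc_def)

lemma R_Bc_compose:
  assumes "f $ 0 = 0"
  shows "R_Bc N oo - (f\<^sup>2) = 1 + (\<Sum>k=1..N. fps_const ((-1) ^ k * mvar k) * f ^ (2 * k))"
proof -
  have f2: "(- (f\<^sup>2)) $ 0 = 0" using assms by (simp add: power2_eq_square)
  have "R_Bc N = 1 + (\<Sum>k=1..N. fps_const (mvar k) * fps_X ^ k)"
    by (auto simp: fps_eq_iff fps_sum_nth R_Bc_def fps_X_power_nth mult_delta_right)
  moreover have "(fps_const (mvar k) * fps_X ^ k) oo - (f\<^sup>2) = fps_const ((-1) ^ k * mvar k) * f ^ (2 * k)" for k
  proof -
    have "(- (f\<^sup>2)) ^ k = fps_const ((-1) ^ k) * f ^ (2 * k)"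
      by (simp add: power_minus[of "f\<^sup>2"] power_mult fps_const_power[symmetric] fps_const_neg[symmetric] del: fps_const_neg fps_const_power)
    then show ?thesis
      by (simp only: compose_simps[OF f2] fps_const_compose fps_X_fps_compose_startby0[OF f2]
          fps_const_mult[symmetric] mult_ac)
  qed
  ultimately show ?thesis
    by (simp only: compose_simps[OF f2] ring_hom_sum[OF compose_hom[OF f2]])
qed

lemma Bc_b_U: "Bc N (b_U n) = ((Bc.arc N)\<^sup>2) $ n"
proof -
  let ?P = "\<lambda>f. (\<forall>k. even k \<longrightarrow> f $ k = 0) \<and> f $ 1 = 1 \<and>
     fps_deriv f ^ 2 = 1 + (\<Sum>k=1..N. fps_const ((-1) ^ k * mvar k) * f ^ (2 * k))"
  let ?Q = "\<lambda>f. (\<forall>k. even k \<longrightarrow> f $ k = 0) \<and> f $ 1 = 1 \<and> (fps_deriv f)\<^sup>2 = R_Bc N oo - (f\<^sup>2)"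
  have "?P = ?Q"
  proof
    fix f :: "(nat, rat) mpoly fps"
    show "?P f = ?Q f"
      \<comment> \<open>If \<open>f $ 0\<close> is nonzero, both predicates already fail at k = 0;
        otherwise the composition formula applies.\<close>
      by (cases "f $ 0 = 0") (simp_all only: R_Bc_compose, metis even_zero)
  qed
  then have "?Q (f_Bc N)"
    unfolding f_Bc_def using theI'[OF Bc.exponential_exists_unique] by simp
  then show ?thesis
    unfolding Bc_def by (intro Bc.hirzebruch_genus_b_U) auto
qed


section \<open>Polynomials with coefficients in a subring of the rationals\<close>

definition rat_subring :: "rat set \<Rightarrow> bool" where
  "rat_subring K \<longleftrightarrow> \<int> \<subseteq> K \<and> (\<forall>x\<in>K. \<forall>y\<in>K. x + y \<in> K \<and> x * y \<in> K)"

text \<open>The ring Z[1/2]; \<open>Z_odd\<close> is the localization of Z at the prime 2. Their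
  intersection is Z, so integrality can be tested in each separately.\<close>

definition Z_half :: "rat set" where "Z_half = {x. \<exists>k. 2 ^ k * x \<in> \<int>}"

definition Z_odd :: "rat set" where "Z_odd = {x. \<exists>d. odd d \<and> of_nat d * x \<in> \<int>}"

lemma rat_subring_Z_half: "rat_subring Z_half"
proof -
  have "x + y \<in> Z_half \<and> x * y \<in> Z_half" if xy: "x \<in> Z_half" "y \<in> Z_half" for x y
  proof -
    obtain k l where kl: "2 ^ k * x \<in> \<int>" "2 ^ l * y \<in> \<int>"
      using xy unfolding Z_half_def by blast
    have "2 ^ (k + l) * (x + y) = 2 ^ l * (2 ^ k * x) + 2 ^ k * (2 ^ l * y)"
      "2 ^ (k + l) * (x * y) = (2 ^ k * x) * (2 ^ l * y)"
      by (simp_all add: power_add algebra_simps)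
    moreover have "2 ^ l * (2 ^ k * x) + 2 ^ k * (2 ^ l * y) \<in> \<int>" "(2 ^ k * x) * (2 ^ l * y) \<in> \<int>"
      by (rule Ints_add[OF Ints_mult[OF _ kl(1)] Ints_mult[OF _ kl(2)]], simp_all) (rule Ints_mult[OF kl])
    ultimately show ?thesis unfolding Z_half_def mem_Collect_eq by metis
  qed
  moreover have "x \<in> Z_half" if "x \<in> \<int>" for x
    using that by (auto simp: Z_half_def intro!: exI[of _ 0])
  ultimately show ?thesis by (auto simp: rat_subring_def)
qed

lemma rat_subring_Z_odd: "rat_subring Z_odd"
proof -
  have "x + y \<in> Z_odd \<and> x * y \<in> Z_odd" if xy: "x \<in> Z_odd" "y \<in> Z_odd" for x y
  proof -
    obtain k l where kl: "odd k" "of_nat k * x \<in> \<int>" "odd l" "of_nat l * y \<in> \<int>"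
      using xy unfolding Z_odd_def by blast
    have "of_nat (k * l) * (x + y) = of_nat l * (of_nat k * x) + of_nat k * (of_nat l * y)"
      "of_nat (k * l) * (x * y) = (of_nat k * x) * (of_nat l * y)"
      by (simp_all add: algebra_simps)
    moreover have "of_nat l * (of_nat k * x) + of_nat k * (of_nat l * y) \<in> \<int>"
      "(of_nat k * x) * (of_nat l * y) \<in> \<int>"
      by (rule Ints_add[OF Ints_mult[OF _ kl(2)] Ints_mult[OF _ kl(4)]], simp_all) (rule Ints_mult[OF kl(2,4)])
    moreover have "odd (k * l)" using kl by simp
    ultimately show ?thesis unfolding Z_odd_def mem_Collect_eq by metis
  qed
  moreover have "x \<in> Z_odd" if "x \<in> \<int>" for x
    using that by (auto simp: Z_odd_def intro!: exI[of _ 1])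
  ultimately show ?thesis by (auto simp: rat_subring_def)
qed

lemma Z_half_Z_odd:
  assumes "x \<in> Z_half" "x \<in> Z_odd"
  shows "x \<in> \<int>"
proof -
  obtain k d where k: "2 ^ k * x \<in> \<int>" and d: "odd d" "of_nat d * x \<in> \<int>"
    using assms by (auto simp: Z_half_def Z_odd_def)
  have "coprime (2 ^ k) (int d)" using d by simp
  then obtain u v where "u * 2 ^ k + v * int d = 1"
    using bezout_int[of "2 ^ k" "int d"] by (auto simp: coprime_iff_gcd_eq_1)
  then have *: "of_int (u * 2 ^ k + v * int d) = (1 :: rat)" by simp
  have "x = of_int (u * 2 ^ k + v * int d) * x" by (simp only: * mult_1_left)
  also have "\<dots> = of_int u * (2 ^ k * x) + of_int v * (of_nat d * x)"
    by (simp add: algebra_simps)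
  also have "\<dots> \<in> \<int>" by (intro Ints_add Ints_mult[OF Ints_of_int k] Ints_mult[OF Ints_of_int d(2)])
  finally show ?thesis .
qed

definition mpoly_over :: "rat set \<Rightarrow> 'v set \<Rightarrow> ('v, rat) mpoly set" where
  "mpoly_over K V = {p. (\<forall>m. Poly_Mapping.lookup p m \<in> K) \<and>
     (\<forall>m\<in>Poly_Mapping.keys p. Poly_Mapping.keys m \<subseteq> V)}"

lemma mpoly_sum_monomials: "p = (\<Sum>m\<in>Poly_Mapping.keys p. Poly_Mapping.single m (Poly_Mapping.lookup p m))"
  by (rule poly_mapping_eqI) (simp add: lookup_sum lookup_single when_def in_keys_iff)

locale subring_polys =
  fixes K :: "rat set" and V :: "'v set"
  assumes subring: "rat_subring K"
begin

abbreviation "P \<equiv> mpoly_over K V"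

lemma Ints: "x \<in> \<int> \<Longrightarrow> x \<in> K"
  using subring by (auto simp: rat_subring_def)

lemma single: "c \<in> K \<Longrightarrow> Poly_Mapping.keys m \<subseteq> V \<Longrightarrow> Poly_Mapping.single m c \<in> P"
  using Ints[of 0] by (auto simp: mpoly_over_def lookup_single when_def)

lemma const: "c \<in> K \<Longrightarrow> mconst c \<in> P"
  by (rule single) auto

lemma of_nat: "of_nat n \<in> P"
  using const[OF Ints[OF Ints_of_nat]] by (simp only: mpoly.of_nat)

lemma var: "v \<in> V \<Longrightarrow> mvar v \<in> P"
  unfolding mvar_def by (rule single) (auto simp: Ints)

lemma add: "p \<in> P \<Longrightarrow> q \<in> P \<Longrightarrow> p + q \<in> P"
  using subring Poly_Mapping.keys_add[of p q] by (fastforce simp: mpoly_over_def rat_subring_def lookup_add)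

lemma sum: "(\<And>a. a \<in> A \<Longrightarrow> f a \<in> P) \<Longrightarrow> sum f A \<in> P"
  using of_nat[of 0] by (induction A rule: infinite_finite_induct) (auto intro: add)

lemma mult:
  assumes "p \<in> P" "q \<in> P"
  shows "p * q \<in> P"
proof -
  have "p * q = (\<Sum>m\<in>Poly_Mapping.keys p. \<Sum>l\<in>Poly_Mapping.keys q.
      Poly_Mapping.single (m + l) (Poly_Mapping.lookup p m * Poly_Mapping.lookup q l))"
    by (subst mpoly_sum_monomials[of p], subst mpoly_sum_monomials[of q])
      (simp add: sum_product mult_single)
  also have "\<dots> \<in> P"
  proof (intro sum single)
    fix m l assume "m \<in> Poly_Mapping.keys p" "l \<in> Poly_Mapping.keys q"
    then have "Poly_Mapping.keys m \<subseteq> V" "Poly_Mapping.keys l \<subseteq> V"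
      using assms by (auto simp: mpoly_over_def)
    then show "Poly_Mapping.keys (m + l) \<subseteq> V"
      using Poly_Mapping.keys_add[of m l] by blast
    show "Poly_Mapping.lookup p m * Poly_Mapping.lookup q l \<in> K"
      using assms subring by (simp add: mpoly_over_def rat_subring_def)
  qed
  finally show ?thesis .
qed

lemma uminus: "p \<in> P \<Longrightarrow> - p \<in> P"
  using mult[OF const[of "- 1"], of p] Ints[of "- 1"]
  by (simp add: ring_hom_simps[OF mconst_hom])

lemma scale: "c \<in> K \<Longrightarrow> c * d = 1 \<Longrightarrow> mconst d * p \<in> P \<Longrightarrow> p \<in> P"
  using mult[OF const[of c], of "mconst d * p"]
  by (simp add: mult.assoc[symmetric] ring_hom_simps[OF mconst_hom] flip: ring_hom_simps(4)[OF mconst_hom])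

end


section \<open>Recursions for the coefficients\<close>

context elliptic_type
begin

definition "beta n = (arc\<^sup>2) $ n"
definition "gamma n = (arc * inv_sqrt) $ n"

text \<open>The derivative of x G^2 is G (G + 2 x G') = G C.\<close>

lemma gamma_eq: "gamma n = of_nat (n + 1) * beta n"
proof -
  have "fps_deriv (fps_X * arc\<^sup>2) = arc * (arc + 2 * fps_X * fps_deriv arc)"
    by (simp add: fps_deriv_power' power2_eq_square algebra_simps)
  then have "fps_deriv (fps_X * arc\<^sup>2) $ n = (arc * inv_sqrt) $ n" by (simp only: arc_ode)
  moreover have "fps_deriv (fps_X * arc\<^sup>2) $ n = of_nat (n + 1) * beta n"
    by (simp only: fps_deriv_nth beta_def) simp
  ultimately show ?thesis by (simp only: gamma_def)
qed

lemma gamma_0: "gamma 0 = 1"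
  by (simp add: gamma_def arc_0 inv_sqrt_0)

text \<open>Differentiating C^2 R = 1 and cancelling C gives 2 C' R + C R' = 0; this removes C' when
  w = G C is differentiated.\<close>

lemma gamma_linear_ode:
  "R * (2 * fps_X * fps_deriv (arc * inv_sqrt) + arc * inv_sqrt) + fps_X * fps_deriv R * (arc * inv_sqrt) = 1"
proof -
  let ?C = inv_sqrt and ?C' = "fps_deriv inv_sqrt" and ?R' = "fps_deriv R"
  have "fps_deriv (?C\<^sup>2 * R) = 0" unfolding inv_sqrt by simp
  then have "?C * (2 * ?C' * R + ?C * ?R') = 0"
    by (simp add: fps_deriv_power' power2_eq_square algebra_simps)
  moreover have "?C \<noteq> 0" using inv_sqrt_0 by auto
  ultimately have 1: "2 * ?C' * R + ?C * ?R' = 0" by simp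
  have "R * (2 * fps_X * fps_deriv (arc * ?C) + arc * ?C) + fps_X * ?R' * (arc * ?C)
     = R * ?C * (arc + 2 * fps_X * fps_deriv arc) + fps_X * arc * (2 * ?C' * R + ?C * ?R')"
    by (simp add: algebra_simps)
  also have "\<dots> = ?C\<^sup>2 * R"
    unfolding 1 arc_ode by (simp add: power2_eq_square algebra_simps)
  finally show ?thesis by (simp only: inv_sqrt)
qed

text \<open>Coefficient of x^n in the linear equation. The weight is (2 (n - k) + 1) + k, the second
  summand coming from x R'.\<close>

lemma gamma_recursion:
  assumes "n > 0"
  shows "of_nat (2 * n + 1) * gamma n = - (\<Sum>k=1..n. of_nat (2 * n - k + 1) * (R $ k * gamma (n - k)))"
proof -
  let ?w = "arc * inv_sqrt"
  have X: "(fps_X * fps_deriv s) $ k = of_nat k * s $ k" for s :: "('v, rat) mpoly fps" and k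
    by (cases k) simp_all
  have w: "(2 * fps_X * fps_deriv ?w + ?w) $ k = of_nat (2 * k + 1) * gamma k" for k
  proof -
    have "(2 * fps_X * fps_deriv ?w + ?w) $ k = 2 * (of_nat k * gamma k) + gamma k"
      unfolding mult.assoc[of 2] by (simp only: mult_2 fps_add_nth X gamma_def)
    then show ?thesis by (simp add: algebra_simps)
  qed
  have "0 = (\<Sum>k=0..n. R $ k * (of_nat (2 * (n - k) + 1) * gamma (n - k))) + (\<Sum>k=0..n. of_nat k * R $ k * gamma (n - k))"
    using arg_cong[OF gamma_linear_ode, of "\<lambda>s. s $ n"] assms
    unfolding fps_add_nth[of "R * _"] fps_mult_nth[of R] fps_mult_nth[of "fps_X * fps_deriv R"] w X
    by (simp only: gamma_def[symmetric] fps_one_nth) simp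
  also have "\<dots> = (\<Sum>k=0..n. of_nat (2 * n - k + 1) * (R $ k * gamma (n - k)))"
    unfolding sum.distrib[symmetric]
  proof (rule sum.cong[OF refl])
    fix k assume "k \<in> {0..n}"
    then have "2 * n - k + 1 = 2 * (n - k) + 1 + k" by simp
    then show "R $ k * (of_nat (2 * (n - k) + 1) * gamma (n - k)) + of_nat k * R $ k * gamma (n - k)
        = of_nat (2 * n - k + 1) * (R $ k * gamma (n - k))"
      by (simp only: of_nat_add algebra_simps)
  qed
  also have "\<dots> = of_nat (2 * n + 1) * gamma n + (\<Sum>k=1..n. of_nat (2 * n - k + 1) * (R $ k * gamma (n - k)))"
    by (subst sum.atLeast_Suc_atMost) (simp_all add: R0)
  finally show ?thesis by (simp add: eq_neg_iff_add_eq_0)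
qed

text \<open>Coefficient of x^n in G^2 = R w^2. The terms i = 0 and i = n contribute 2
  \<open>gamma n\<close> = 2 (n + 1) \<open>beta n\<close>; moving them across leaves the odd factor
  2 n + 1, so no power of 2 enters the denominators.\<close>

lemma beta_recursion:
  assumes "n > 0"
  shows "of_nat (2 * n + 1) * beta n =
    - ((\<Sum>i=1..n-1. gamma i * gamma (n - i)) + (\<Sum>k=1..n. R $ k * (\<Sum>i=0..n-k. gamma i * gamma (n - k - i))))"
proof -
  have "beta n = (arc\<^sup>2 * (inv_sqrt\<^sup>2 * R)) $ n"
    by (simp only: inv_sqrt beta_def mult_1_right)
  also have "\<dots> = (R * (arc * inv_sqrt * (arc * inv_sqrt))) $ n"
    by (simp only: power2_eq_square mult_ac)
  also have "\<dots> = (\<Sum>k=0..n. R $ k * (\<Sum>i=0..n-k. gamma i * gamma (n - k - i)))"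
    unfolding fps_mult_nth[of R] fps_mult_nth[of "arc * inv_sqrt" "arc * inv_sqrt"] gamma_def[symmetric] ..
  also have "\<dots> = (\<Sum>i=0..n. gamma i * gamma (n - i)) + (\<Sum>k=1..n. R $ k * (\<Sum>i=0..n-k. gamma i * gamma (n - k - i)))"
    by (subst sum.atLeast_Suc_atMost) (simp_all add: R0)
  also have "(\<Sum>i=0..n. gamma i * gamma (n - i)) = 2 * gamma n + (\<Sum>i=1..n-1. gamma i * gamma (n - i))"
  proof -
    have "{0..n} = insert 0 (insert n {1..n-1})" using assms by auto
    then show ?thesis using assms by (simp add: gamma_0)
  qed
  finally have "beta n = 2 * ((of_nat n + 1) * beta n) + (\<Sum>i=1..n-1. gamma i * gamma (n - i))
      + (\<Sum>k=1..n. R $ k * (\<Sum>i=0..n-k. gamma i * gamma (n - k - i)))"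
    by (simp only: gamma_eq[of n] of_nat_add of_nat_1)
  moreover have "(2 * k + 1) * b = - (s + t)" if "b = 2 * ((k + 1) * b) + s + t" for b k s t :: "('v, rat) mpoly"
    using that by algebra
  ultimately show ?thesis
    by (simp only: of_nat_add of_nat_mult of_nat_1 of_nat_numeral)
qed

end

section \<open>Denominators of C, gamma and beta\<close>

locale elliptic_type_over = elliptic_type R + subring_polys K V
  for R :: "('v::linorder, rat) mpoly fps" and K :: "rat set" and V :: "'v set" +
  fixes n :: nat
  assumes coeffs: "k \<le> n \<Longrightarrow> R $ k \<in> mpoly_over K V"
begin

text \<open>Solving C^2 R = 1 for successive coefficients divides only by 2.\<close>

lemma inv_sqrt_in:
  assumes "1 / 2 \<in> K"
  shows "k \<le> n \<Longrightarrow> inv_sqrt $ k \<in> P"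
proof (induction k rule: less_induct)
  case (less k)
  let ?C = inv_sqrt
  show ?case
  proof (cases "k = 0")
    case True
    then show ?thesis using of_nat[of 1] by (simp add: inv_sqrt_0)
  next
    case False
    have sq: "(?C\<^sup>2) $ m = (\<Sum>i=0..m. ?C $ i * ?C $ (m - i))" for m
      by (simp only: power2_eq_square fps_mult_nth)
    have "0 = (R * ?C\<^sup>2) $ k"
      using arg_cong[OF inv_sqrt, of "\<lambda>s. s $ k"] False by (simp add: mult.commute)
    also have "\<dots> = (?C\<^sup>2) $ k + (\<Sum>j=1..k. R $ j * (?C\<^sup>2) $ (k - j))"
      unfolding fps_mult_nth[of R] by (subst sum.atLeast_Suc_atMost) (simp_all add: R0)
    also have "(?C\<^sup>2) $ k = 2 * ?C $ k + (\<Sum>i=1..k-1. ?C $ i * ?C $ (k - i))"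
    proof -
      have "{0..k} = insert 0 (insert k {1..k-1})" using False by auto
      then show ?thesis using False by (simp add: sq inv_sqrt_0)
    qed
    finally have "2 * ?C $ k = - ((\<Sum>i=1..k-1. ?C $ i * ?C $ (k - i)) + (\<Sum>j=1..k. R $ j * (?C\<^sup>2) $ (k - j)))"
      by (simp add: algebra_simps eq_neg_iff_add_eq_0)
    also have "\<dots> \<in> P"
      unfolding sq by (intro uminus add sum mult less coeffs) (use less.prems False in auto)
    finally have "mconst 2 * ?C $ k \<in> P"
      using mpoly.of_nat[of 2] by (metis of_nat_numeral)
    then show ?thesis using scale[OF assms, of 2] by simp
  qed
qed

text \<open>In the convolution G C the only denominators, apart from powers of 2, are the factors 2
  i + 1 from G, all cleared by \<open>l\<close>.\<close>

lemma gamma_in: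
  assumes "1 / 2 \<in> K" "\<And>i. i \<le> n \<Longrightarrow> 2 * i + 1 dvd l"
  shows "of_nat l * gamma n \<in> P"
proof -
  have "of_nat l * arc $ i \<in> P" if i: "i \<le> n" for i
  proof -
    obtain z where z: "l = (2 * i + 1) * z" using assms(2)[OF i] by blast
    have "of_nat l * arc $ i = of_nat z * (of_nat (2 * i + 1) * mconst (1 / of_nat (2 * i + 1))) * inv_sqrt $ i"
      unfolding z of_nat_mult[of "2 * i + 1" z] by (simp only: arc_def fps_nth_Abs_fps mult_ac)
    also have "\<dots> = of_nat z * inv_sqrt $ i"
      by (subst mpoly.of_nat_inverse) simp_all
    finally have "of_nat l * arc $ i = of_nat z * inv_sqrt $ i" .
    then show ?thesis using inv_sqrt_in[OF assms(1) i] by (simp add: mult of_nat)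
  qed
  note l = this
  have "of_nat l * gamma n = (\<Sum>i=0..n. of_nat l * arc $ i * inv_sqrt $ (n - i))"
    by (simp add: gamma_def fps_mult_nth sum_distrib_left mult.assoc)
  also have "\<dots> \<in> P"
    by (rule sum, rule mult[OF l inv_sqrt_in[OF assms(1)]]) auto
  finally show ?thesis .
qed

text \<open>Induction along \<open>beta_recursion\<close>: the right-hand side involves only earlier
  \<open>gamma i\<close>, which are multiples of \<open>beta i\<close>.\<close>

lemma beta_in:
  assumes "\<And>k. 1 / of_nat (2 * k + 1) \<in> K"
  shows "k \<le> n \<Longrightarrow> beta k \<in> P"
proof (induction k rule: less_induct)
  case (less k)
  show ?case
  proof (cases "k = 0")
    case True
    then show ?thesis using of_nat[of 1] by (simp add: beta_def arc_0 power2_eq_square)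
  next
    case False
    have g: "gamma i \<in> P" if "i < k" for i
      using less that unfolding gamma_eq by (intro mult of_nat) auto
    have "of_nat (2 * k + 1) * beta k \<in> P"
      unfolding beta_recursion[OF False[unfolded neq0_conv]]
      by (intro uminus add sum mult g coeffs) (use less.prems False in auto)
    then have "mconst (of_nat (2 * k + 1)) * beta k \<in> P"
      by (simp only: mpoly.of_nat)
    then show ?thesis
      by (rule scale[OF assms[of k], rotated]) (simp del: of_nat_Suc of_nat_add)
  qed
qed

end


section \<open>Coefficients of \<open>(n + 1) \<beta>\<^sub>n\<close>\<close>

lemma lookup_mconst_mult: "Poly_Mapping.lookup (mconst (c :: 'k::comm_ring_1) * p) m = c * Poly_Mapping.lookup p m"
  by (induction p rule: mpoly_induct) (simp_all add: distrib_left mult_single lookup_add lookup_single when_def)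

lemma lookup_of_nat_mult:
  "Poly_Mapping.lookup (of_nat k * p :: ('v, rat) mpoly) m = of_nat k * Poly_Mapping.lookup p m"
  by (simp only: mpoly.of_nat[symmetric] lookup_mconst_mult)

lemma lookup_mvar_mult:
  "Poly_Mapping.lookup (mvar v * p) (Poly_Mapping.single v 1 + m) = Poly_Mapping.lookup p m"
  by (induction p rule: mpoly_induct)
    (simp_all add: distrib_left mvar_def mult_single lookup_add lookup_single when_def)

lemma lookup_mvar_mult_eq_0:
  assumes "Poly_Mapping.lookup m v = 0"
  shows "Poly_Mapping.lookup (mvar v * p) m = 0"
proof -
  have "Poly_Mapping.single v 1 + m' \<noteq> m" for m'
    using assms by (auto simp: lookup_add)
  then show ?thesis
    by (induction p rule: mpoly_induct)
      (simp_all add: distrib_left mvar_def mult_single lookup_add lookup_single when_def)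
qed

context
  fixes N :: nat
begin

abbreviation "\<gamma> \<equiv> Bc.gamma N"

lemma lookup_gamma_recursion:
  assumes "0 < m" "m \<le> N"
  shows "of_nat (2 * m + 1) * Poly_Mapping.lookup (\<gamma> m) \<mu> =
    - (\<Sum>k=1..m. of_nat (2 * m - k + 1) * Poly_Mapping.lookup (mvar k * \<gamma> (m - k)) \<mu>)"
proof -
  have "of_nat (2 * m + 1) * \<gamma> m = - (\<Sum>k=1..m. of_nat (2 * m - k + 1) * (R_Bc N $ k * \<gamma> (m - k)))"
    by (rule Bc.gamma_recursion) fact
  also have "\<dots> = - (\<Sum>k=1..m. of_nat (2 * m - k + 1) * (mvar k * \<gamma> (m - k)))"
    using assms by (intro arg_cong[of _ _ uminus] sum.cong) (auto simp: R_Bc_def)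
  finally have "of_nat (2 * m + 1) * \<gamma> m = - (\<Sum>k=1..m. of_nat (2 * m - k + 1) * (mvar k * \<gamma> (m - k)))" .
  from arg_cong[OF this, of "\<lambda>p. Poly_Mapping.lookup p \<mu>"] show ?thesis
    by (simp only: lookup_of_nat_mult lookup_uminus lookup_sum)
qed

text \<open>In the recursion only k = m can produce the monomial a_m; its weight is 2 m - m + 1 and
  \<open>gamma 0\<close> is 1.\<close>

lemma lookup_gamma_linear:
  assumes "0 < m" "m \<le> N"
  shows "Poly_Mapping.lookup (\<gamma> m) (Poly_Mapping.single m 1) = - (of_nat (m + 1) / of_nat (2 * m + 1))"
proof -
  let ?\<mu> = "Poly_Mapping.single m (1 :: nat)"
  have "Poly_Mapping.lookup (mvar m * \<gamma> 0) (?\<mu> + 0) = 1"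
    unfolding lookup_mvar_mult Bc.gamma_0 by (simp add: lookup_one)
  then have "Poly_Mapping.lookup (mvar k * \<gamma> (m - k)) ?\<mu> = (if k = m then 1 else 0)" for k
    by (auto intro!: lookup_mvar_mult_eq_0 simp: lookup_single)
  then have "of_nat (2 * m + 1) * Poly_Mapping.lookup (\<gamma> m) ?\<mu> = - (\<Sum>k=1..m. if k = m then of_nat (2 * m - k + 1) else 0)"
    unfolding lookup_gamma_recursion[OF assms] by (intro arg_cong[of _ _ uminus] sum.cong) auto
  also have "\<dots> = - of_nat (m + 1)"
    using assms by (simp add: numeral_2_eq_2)
  finally show ?thesis
    by (simp add: field_simps del: of_nat_Suc of_nat_add of_nat_mult)
qed

text \<open>Only k = i and k = j contribute, through the linear coefficients above. For i = j these
  are a single term, hence 8 instead of 4. Partial fractions separate the three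
  denominators.\<close>

lemma lookup_gamma_quadratic:
  assumes "0 < i" "0 < j" "i + j \<le> N"
  defines "\<mu> \<equiv> Poly_Mapping.single i 1 + Poly_Mapping.single j (1 :: nat)"
  shows "(if i = j then 8 else 4) * Poly_Mapping.lookup (\<gamma> (i + j)) \<mu> =
    3 + 1 / of_nat (2 * i + 1) + 1 / of_nat (2 * j + 1) + 3 / of_nat (2 * (i + j) + 1)"
proof -
  let ?f = "\<lambda>k. Poly_Mapping.lookup (mvar k * \<gamma> (i + j - k)) \<mu>"
  have 1: "?f i = - (of_nat (j + 1) / of_nat (2 * j + 1))"
    unfolding \<mu>_def lookup_mvar_mult using lookup_gamma_linear[of j] assms by simp
  have 2: "?f j = - (of_nat (i + 1) / of_nat (2 * i + 1))"
    unfolding \<mu>_def add.commute[of "Poly_Mapping.single i 1"] lookup_mvar_mult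
    using lookup_gamma_linear[of i] assms by simp
  have 3: "?f k = 0" if "k \<noteq> i" "k \<noteq> j" for k
    using that by (intro lookup_mvar_mult_eq_0) (simp add: \<mu>_def lookup_add lookup_single)
  have "of_nat (2 * (i + j) + 1) * Poly_Mapping.lookup (\<gamma> (i + j)) \<mu>
      = - (\<Sum>k=1..i+j. of_nat (2 * (i + j) - k + 1) * ?f k)"
    by (rule lookup_gamma_recursion) (use assms in auto)
  also have "(\<Sum>k=1..i+j. of_nat (2 * (i + j) - k + 1) * ?f k) = (\<Sum>k\<in>{i, j}. of_nat (2 * (i + j) - k + 1) * ?f k)"
    using assms(1,2) by (intro sum.mono_neutral_right) (auto simp: 3)
  finally have *: "of_nat (2 * (i + j) + 1) * Poly_Mapping.lookup (\<gamma> (i + j)) \<mu>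
      = - (\<Sum>k\<in>{i, j}. of_nat (2 * (i + j) - k + 1) * ?f k)" .
  have n: "2 * (i + j) - i + 1 = i + 2 * j + 1" "2 * (i + j) - j + 1 = 2 * i + j + 1" by simp_all
  have pos: "1 + 2 * rat_of_nat k \<noteq> 0" "1 + (2 * rat_of_nat i + 2 * of_nat j) \<noteq> 0" for k
    by (simp_all add: add_nonneg_eq_0_iff)
  have solve: "x = b / a" if "a * x = b" "a \<noteq> 0" for a b x :: rat
    using that by (simp add: field_simps)
  show ?thesis
  proof (cases "i = j")
    case True
    have "of_nat (4 * j + 1) * Poly_Mapping.lookup (\<gamma> (i + j)) \<mu> = of_nat (3 * j + 1) * (of_nat (j + 1) / of_nat (2 * j + 1))"
      using * 1 n(1) unfolding True by simp
    moreover have "1 + 4 * rat_of_nat j \<noteq> 0" by (simp add: add_nonneg_eq_0_iff)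
    ultimately have K: "Poly_Mapping.lookup (\<gamma> (i + j)) \<mu> = of_nat (3 * j + 1) * (of_nat (j + 1) / of_nat (2 * j + 1)) / of_nat (4 * j + 1)"
      by (intro solve) simp_all
    show ?thesis
      unfolding K using True pos(1)[of j] \<open>1 + 4 * rat_of_nat j \<noteq> 0\<close> by (simp add: field_simps)
  next
    case False
    have "of_nat (2 * (i + j) + 1) * Poly_Mapping.lookup (\<gamma> (i + j)) \<mu>
       = of_nat (i + 2 * j + 1) * (of_nat (j + 1) / of_nat (2 * j + 1)) + of_nat (2 * i + j + 1) * (of_nat (i + 1) / of_nat (2 * i + 1))"
      using * False by (simp only: 1 2 n sum.insert finite.intros empty_iff insert_iff sum.empty simp_thms)
    then have K: "Poly_Mapping.lookup (\<gamma> (i + j)) \<mu>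
       = (of_nat (i + 2 * j + 1) * (of_nat (j + 1) / of_nat (2 * j + 1)) + of_nat (2 * i + j + 1) * (of_nat (i + 1) / of_nat (2 * i + 1)))
          / of_nat (2 * (i + j) + 1)"
      by (rule solve) (simp del: of_nat_Suc of_nat_add)
    show ?thesis
      unfolding K using False pos by (simp add: divide_simps) (simp add: algebra_simps)
  qed
qed

end


section \<open>Arithmetic of the least common multiple\<close>

text \<open>The least common multiple divides p^e times the product of the p-free parts of the
  elements, and p does not divide that product.\<close>

lemma prime_power_not_dvd_Lcm:
  fixes S :: "nat set"
  assumes p: "prime p" and S: "finite S" "0 \<notin> S" "\<And>k. k \<in> S \<Longrightarrow> \<not> p ^ Suc e dvd k"
  shows "\<not> p ^ Suc e dvd Lcm S"
proof
  assume d: "p ^ Suc e dvd Lcm S"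
  let ?r = "\<lambda>k. k div p ^ multiplicity p k"
  have unit: "\<not> is_unit p" using p by (simp add: prime_nat_iff)
  have "Lcm S dvd p ^ e * (\<Prod>k\<in>S. ?r k)"
  proof (rule Lcm_least)
    fix k assume k: "k \<in> S"
    then have "k \<noteq> 0" using S by metis
    then have "multiplicity p k \<le> e"
      using S(3)[OF k] multiplicity_dvd'[of "Suc e" p k] by (metis not_less_eq_eq)
    then have "p ^ multiplicity p k dvd p ^ e" by (rule le_imp_power_dvd)
    moreover have "?r k dvd (\<Prod>k\<in>S. ?r k)" using k S(1) by (intro dvd_prodI)
    moreover have "k = p ^ multiplicity p k * ?r k" by (simp add: multiplicity_dvd)
    ultimately show "k dvd p ^ e * (\<Prod>k\<in>S. ?r k)" by (metis mult_dvd_mono)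
  qed
  then have "p ^ e * p dvd p ^ e * (\<Prod>k\<in>S. ?r k)"
    using d by (metis dvd_trans power_Suc2)
  then have "p dvd (\<Prod>k\<in>S. ?r k)"
    using p by (simp add: prime_gt_0_nat)
  then obtain k where k: "k \<in> S" "p dvd ?r k"
    using p S(1) by (auto simp: prime_dvd_prod_iff)
  have "k \<noteq> 0" using k S by metis
  then show False using multiplicity_decompose[of k p] k(2) unit by blast
qed

section \<open>Odd least common multiples and the odd part of d_n\<close>

abbreviation odd_lcm :: "nat \<Rightarrow> nat" where
  "odd_lcm n \<equiv> Lcm {k. odd k \<and> k \<le> 2 * n + 1}"

lemma finite_odd_le: "finite {k :: nat. odd k \<and> k \<le> b}"
  by (rule finite_subset[of _ "{..b}"]) auto

lemma dvd_odd_lcm: "i \<le> n \<Longrightarrow> 2 * i + 1 dvd odd_lcm n"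
  by (rule dvd_Lcm) auto

lemma prime_power_not_dvd_odd_lcm:
  assumes "prime p" "2 * n + 1 < p ^ Suc e"
  shows "\<not> p ^ Suc e dvd odd_lcm n"
  using assms by (intro prime_power_not_dvd_Lcm finite_odd_le)
    (auto dest!: dvd_imp_le simp del: power_Suc intro: odd_pos)

lemma odd_odd_lcm: "odd (odd_lcm n)"
  using prime_power_not_dvd_Lcm[of 2 "{k. odd k \<and> k \<le> 2 * n + 1}" 0] finite_odd_le[of "2 * n + 1"] by simp

lemma odd_part_eq:
  assumes "odd b"
  shows "odd_part (2 ^ a * b) = b"
proof -
  have "multiplicity 2 (2 ^ a * b) = a"
    using assms by (intro multiplicity_eqI) auto
  then show ?thesis by (simp add: odd_part_def)
qed

lemma odd_part_decompose:
  assumes "m > 0"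
  shows "m = 2 ^ multiplicity 2 m * odd_part m" "odd (odd_part m)"
proof -
  show "m = 2 ^ multiplicity 2 m * odd_part m"
    by (simp add: odd_part_def multiplicity_dvd)
  show "odd (odd_part m)"
    using multiplicity_decompose[of m 2] assms by (simp add: odd_part_def)
qed

text \<open>The odd part of every k in the range is an odd number at most 2 n + 1. The exponent is
  positive because 2 lies in the range, so the halving in \<open>d_den\<close> is exact.\<close>

lemma Lcm_atMost_eq:
  "\<exists>s. Lcm {1..2 * n + 2} = 2 ^ Suc s * odd_lcm n"
proof -
  let ?M = "Lcm {1..2 * n + 2}"
  define M' where "M' = odd_part ?M"
  define s where "s = multiplicity 2 ?M"
  have "?M \<noteq> 0" by (simp add: Lcm_0_iff)
  then have "?M > 0" by (metis gr0I)
  then have M: "?M = 2 ^ s * M'" "odd M'"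
    unfolding M'_def s_def by (rule odd_part_decompose)+
  have "odd_lcm n dvd 2 ^ s * M'"
    unfolding M(1)[symmetric] by (rule Lcm_least) (auto intro!: dvd_Lcm simp: Suc_le_eq odd_pos)
  moreover have "coprime (odd_lcm n) (2 ^ s)" using odd_odd_lcm[of n] by simp
  ultimately have 1: "odd_lcm n dvd M'" by (simp add: coprime_dvd_mult_right_iff)
  have "?M dvd 2 ^ (2 * n + 2) * odd_lcm n"
  proof (rule Lcm_least)
    fix k assume k: "k \<in> {1..2 * n + 2}"
    have d: "k = 2 ^ multiplicity 2 k * odd_part k" "odd (odd_part k)"
      using odd_part_decompose[of k] k by auto
    have "odd_part k dvd k" by (subst d(1)) simp
    then have "odd_part k \<le> 2 * n + 2" using k by (auto dest!: dvd_imp_le)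
    moreover have "odd_part k \<noteq> 2 * n + 2" using d(2) by auto
    ultimately have "odd_part k dvd odd_lcm n" using d(2) by (intro dvd_Lcm) simp
    moreover have "2 ^ multiplicity 2 k \<le> k"
      using k by (intro dvd_imp_le multiplicity_dvd) auto
    then have "multiplicity 2 k \<le> 2 * n + 2"
      using k less_exp[of "multiplicity 2 k"] unfolding atLeastAtMost_iff by linarith
    then have "(2::nat) ^ multiplicity 2 k dvd 2 ^ (2 * n + 2)" by (rule le_imp_power_dvd)
    ultimately show "k dvd 2 ^ (2 * n + 2) * odd_lcm n"
      by (subst d(1)) (rule mult_dvd_mono)
  qed
  then have "M' dvd 2 ^ (2 * n + 2) * odd_lcm n"
    unfolding M(1) by (rule dvd_mult_right)
  moreover have "coprime M' (2 ^ (2 * n + 2))"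
    using M(2) by (simp only: coprime_power_right_iff coprime_right_2_iff_odd simp_thms)
  ultimately have "M' dvd odd_lcm n" by (simp only: coprime_dvd_mult_right_iff)
  with 1 have "M' = odd_lcm n" by (simp add: dvd_antisym)
  moreover have "s \<noteq> 0"
  proof
    assume "s = 0"
    have "2 dvd ?M" by (rule dvd_Lcm) auto
    then show False using M(2) unfolding M(1) \<open>s = 0\<close> by simp
  qed
  ultimately show ?thesis using M(1) by (metis not0_implies_Suc)
qed

lemma odd_part_d_den: "odd_part (d_den n) = \<delta>_den n"
proof -
  obtain s where s: "Lcm {1..2 * n + 2} = 2 ^ Suc s * odd_lcm n"
    using Lcm_atMost_eq by blast
  have n: "n + 1 = 2 ^ multiplicity 2 (n + 1) * odd_part (n + 1)" "odd (odd_part (n + 1))"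
    using odd_part_decompose[of "n + 1"] by auto
  have "(n + 1) * Lcm {1..2 * n + 2} = 2 * ((n + 1) * (2 ^ s * odd_lcm n))"
    unfolding s by simp
  then have "d_den n = (n + 1) * (2 ^ s * odd_lcm n)"
    unfolding d_den_def by (metis nonzero_mult_div_cancel_left zero_neq_numeral)
  also have "\<dots> = 2 ^ multiplicity 2 (n + 1) * odd_part (n + 1) * (2 ^ s * odd_lcm n)"
    by (subst n(1)) (rule refl)
  also have "\<dots> = 2 ^ (multiplicity 2 (n + 1) + s) * \<delta>_den n"
    by (simp only: \<delta>_den_def power_add mult_ac)
  finally show ?thesis
    using n(2) odd_odd_lcm[of n] by (simp only: \<delta>_den_def odd_part_eq even_mult_iff simp_thms)
qed

text \<open>With p^e the largest power of p up to 2 n + 1, the power p^(e+1) does not divide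
  \<open>odd_lcm n\<close>. A coefficient whose denominator contains p^e is therefore not a multiple
  of p after clearing.\<close>

lemma odd_prime_not_dvd_gamma:
  assumes p: "prime p" "odd p" and n: "0 < n" "n \<le> N"
  shows "\<exists>\<mu>. \<forall>z. of_nat (odd_lcm n) * Poly_Mapping.lookup (Bc.gamma N n) \<mu> \<noteq> of_int (int p * z)"
proof -
  let ?L = "odd_lcm n" and ?K = "Poly_Mapping.lookup (Bc.gamma N n)"
  have p2: "p \<ge> 2" using p(1) by (rule prime_ge_2_nat)
  obtain e where e: "p ^ e \<le> 2 * n + 1" "2 * n + 1 < p ^ Suc e"
    using ex_power_ivl1[OF p2, of "2 * n + 1"] by auto
  have L: "\<not> p ^ Suc e dvd ?L" by (rule prime_power_not_dvd_odd_lcm[OF p(1) e(2)])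
  show ?thesis
  proof (cases "p ^ e dvd 2 * n + 1")
    case True
    \<comment> \<open>For e = 0 the prime exceeds 2 n + 1; otherwise p divides 2 n + 1, which is
      coprime to n + 1.\<close>
    have "\<not> p dvd n + 1"
    proof
      assume d: "p dvd n + 1"
      show False
      proof (cases e)
        case 0
        then show ?thesis using e d by (auto dest!: dvd_imp_le)
      next
        case (Suc e')
        then have "p dvd 2 * n + 1" using True by (metis dvd_trans dvd_triv_left power_Suc)
        moreover have "p dvd 2 * (n + 1)" using d by (rule dvd_mult)
        ultimately have "p dvd 2 * (n + 1) - (2 * n + 1)" by (rule dvd_diff_nat[rotated])
        then show False using p2 by simp
      qed
    qed
    then have cop: "coprime (p ^ Suc e) (n + 1)"
      using p(1) by (simp only: coprime_power_left_iff prime_imp_coprime simp_thms)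
    have "of_nat ?L * ?K (Poly_Mapping.single n 1) \<noteq> of_int (int p * z)" for z
    proof
      assume "of_nat ?L * ?K (Poly_Mapping.single n 1) = of_int (int p * z)"
      then have "of_nat ?L * (of_nat (n + 1) :: rat) = of_int (- (int p * z)) * of_nat (2 * n + 1)"
        unfolding lookup_gamma_linear[OF n] by (simp add: field_simps)
      then have "of_int (int ?L * int (n + 1)) = (of_int (- (int p * z) * int (2 * n + 1)) :: rat)"
        by simp
      then have "int ?L * int (n + 1) = - (int p * z) * int (2 * n + 1)"
        by (simp only: of_int_eq_iff)
      then have "int (?L * (n + 1)) = int p * int (2 * n + 1) * (- z)"
        by (simp add: algebra_simps)
      moreover have "int (p ^ Suc e) dvd int p * int (2 * n + 1)"
        using True unfolding power_Suc of_nat_mult[symmetric] int_dvd_int_iff by (rule mult_dvd_mono[OF dvd_refl])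
      ultimately have "int (p ^ Suc e) dvd int (?L * (n + 1))"
        by (metis dvd_mult2)
      then have "p ^ Suc e dvd ?L * (n + 1)" by (simp only: int_dvd_int_iff)
      then show False using L cop by (simp only: coprime_dvd_mult_left_iff)
    qed
    then show ?thesis by blast
  next
    case False
    have "odd (p ^ e)" using p(2) by simp
    \<comment> \<open>This \<open>h\<close> makes p^e a denominator in the coefficient of a_h a_j
      with j = n - h. It is below n since p^e does not divide 2 n + 1.\<close>
    then obtain h where h: "p ^ e = 2 * h + 1" by (rule oddE)
    have "e \<noteq> 0" using False by (intro notI) simp
    then have "p ^ 1 \<le> p ^ e" using p2 by (intro power_increasing) auto
    then have h0: "0 < h" using p2 p(2) h by (cases h) auto
    have hn: "h < n" using e(1) False h by (cases "h = n") auto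
    define j where "j = n - h"
    have j: "0 < j" "h + j = n" using hn by (auto simp: j_def)
    obtain Lh where Lh: "?L = (2 * h + 1) * Lh"
      using dvd_odd_lcm[of h n] hn by (metis dvdE order_refl less_imp_le)
    obtain Lj where Lj: "?L = (2 * j + 1) * Lj"
      using dvd_odd_lcm[of j n] j by (metis dvdE order_refl le_add2)
    obtain Ln where Ln: "?L = (2 * n + 1) * Ln"
      using dvd_odd_lcm[of n n] by (metis dvdE order_refl le_add2)
    have pe: "p ^ e dvd ?L" unfolding h by (rule dvd_odd_lcm) (use hn in simp)
    have p_L: "p dvd ?L" using pe \<open>e \<noteq> 0\<close> by (metis dvd_power dvd_trans not_gr0)
    have cop: "coprime (p ^ e) x" if "\<not> p dvd x" for x
      using that p(1) by (simp add: prime_imp_coprime)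
    have p_Ln: "p dvd Ln"
    proof (rule ccontr)
      assume *: "\<not> p dvd Ln"
      have "p ^ e dvd 2 * n + 1"
        using pe unfolding Ln by (simp only: coprime_dvd_mult_left_iff[OF cop[OF *]])
      then show False using False by blast
    qed
    have p_Lh: "\<not> p dvd Lh"
    proof
      assume "p dvd Lh"
      then have "p ^ e * p dvd p ^ e * Lh" by (rule mult_dvd_mono[OF dvd_refl])
      moreover have "?L = p ^ e * Lh" unfolding h by (rule Lh)
      ultimately show False using L unfolding power_Suc2 by metis
    qed
    \<comment> \<open>The contributions of 1 / (2 h + 1) and 1 / (2 j + 1) could cancel modulo p
      only if 2 j + 1 = q p^e with p dividing q + 1. As q < p this forces q = p - 1, which is even,
      whereas q divides an odd number.\<close>
    have nd: "\<not> p dvd Lh + Lj"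
    proof
      assume d: "p dvd Lh + Lj"
      then have Lj': "\<not> p dvd Lj" using p_Lh d dvd_add_left_iff by blast
      then have "p ^ e dvd 2 * j + 1"
        using pe unfolding Lj by (simp only: coprime_dvd_mult_left_iff[OF cop[OF Lj']])
      then obtain q where q: "2 * j + 1 = p ^ e * q" by (rule dvdE)
      have "p ^ e * (q * Lj) = p ^ e * Lh" by (metis Lh Lj h q mult.assoc)
      then have "q * Lj = Lh" using p2 by simp
      then have "p dvd (q + 1) * Lj" using d by (simp add: add.commute)
      then have "p dvd q + 1" using Lj' p(1) by (simp only: prime_dvd_mult_iff simp_thms)
      moreover have "p ^ e * q < p ^ e * p" using e(2) q j by (simp only: power_Suc2)
      then have "q < p" using p2 by simp
      ultimately have "q + 1 = p" by (auto dest!: dvd_imp_le)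
      moreover have "odd q" using arg_cong[OF q, of even] by simp
      ultimately show False using p(2) by auto
    qed
    define \<mu> where "\<mu> = Poly_Mapping.single h 1 + Poly_Mapping.single j (1 :: nat)"
    have "of_nat ?L * ?K \<mu> \<noteq> of_int (int p * z)" for z
    proof
      assume z: "of_nat ?L * ?K \<mu> = of_int (int p * z)"
      \<comment> \<open>Scaling by \<open>s\<close> keeps a multiple of p and turns the cleared
        coefficient into 3 \<open>?L\<close> + \<open>Lh\<close> + \<open>Lj\<close> + 3
        \<open>Ln\<close>, where p divides \<open>?L\<close> and \<open>Ln\<close>.\<close>
      define s :: int where "s = (if h = j then 8 else 4)"
      have sK: "of_int s * ?K \<mu> = 3 + 1 / of_nat (2 * h + 1) + 1 / of_nat (2 * j + 1) + 3 / of_nat (2 * n + 1)"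
        using lookup_gamma_quadratic[of h j N] h0 j n(2) by (simp add: s_def \<mu>_def split: if_splits)
      have "of_int s * (of_nat ?L * ?K \<mu>) = of_nat ?L * (of_int s * ?K \<mu>)"
        by (rule mult.left_commute)
      also have "\<dots> = of_nat ?L * (3 + 1 / of_nat (2 * h + 1) + 1 / of_nat (2 * j + 1) + 3 / of_nat (2 * n + 1))"
        by (simp only: sK)
      also have "\<dots> = 3 * of_nat ?L + of_nat ?L / of_nat (2 * h + 1) + of_nat ?L / of_nat (2 * j + 1) + 3 * (of_nat ?L / of_nat (2 * n + 1))"
        by (simp add: algebra_simps)
      also have "of_nat ?L / of_nat (2 * h + 1) = rat_of_nat Lh"
        unfolding Lh of_nat_mult by (rule nonzero_mult_div_cancel_left) (simp del: of_nat_Suc of_nat_add)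
      also have "of_nat ?L / of_nat (2 * j + 1) = rat_of_nat Lj"
        unfolding Lj of_nat_mult by (rule nonzero_mult_div_cancel_left) (simp del: of_nat_Suc of_nat_add)
      also have "of_nat ?L / of_nat (2 * n + 1) = rat_of_nat Ln"
        unfolding Ln of_nat_mult by (rule nonzero_mult_div_cancel_left) (simp del: of_nat_Suc of_nat_add)
      finally have "of_int (s * (int p * z)) = (of_int (int (3 * ?L + Lh + Lj + 3 * Ln)) :: rat)"
        unfolding z by simp
      then have "s * (int p * z) = int (3 * ?L + Lh + Lj + 3 * Ln)" by (simp only: of_int_eq_iff)
      then have "int p dvd int (3 * ?L + Lh + Lj + 3 * Ln)" by (metis dvd_mult dvd_triv_left)
      then have "p dvd (Lh + Lj) + (3 * ?L + 3 * Ln)" unfolding int_dvd_int_iff by (simp add: add_ac)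
      moreover have "p dvd 3 * ?L + 3 * Ln" using p_L p_Ln by simp
      ultimately show False using nd dvd_add_left_iff by blast
    qed
    then show ?thesis by blast
  qed
qed


section \<open>Denominators\<close>

text \<open>If k clears the denominators, d divides k times every coefficient of d p, hence k times
  their gcd, which is k.\<close>

lemma exact_denominator_eqI:
  assumes "d > 0" and prim: "primitive_over_Z (of_nat d * p)"
  shows "exact_denominator p = d"
proof -
  obtain c :: "_ \<Rightarrow> int" where c: "\<And>m. of_nat d * Poly_Mapping.lookup p m = of_int (c m)" and g: "Gcd (range c) = 1"
    using prim by (auto simp: primitive_over_Z_def lookup_of_nat_mult)
  have "d \<le> k" if k: "k > 0" "\<forall>m. of_nat k * Poly_Mapping.lookup p m \<in> \<int>" for k
  proof -
    have "int d dvd int k * c m" for m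
    proof -
      obtain z where z: "of_nat k * Poly_Mapping.lookup p m = of_int z"
        using k(2) by (auto elim: Ints_cases)
      have "of_int (int k * c m) = of_nat k * (of_nat d * Poly_Mapping.lookup p m)" by (simp add: c)
      also have "\<dots> = of_nat d * (of_nat k * Poly_Mapping.lookup p m)" by (simp only: mult_ac)
      also have "\<dots> = of_int (int d * z)" by (simp add: z)
      finally have "int k * c m = int d * z" by (simp only: of_int_eq_iff)
      then show ?thesis by simp
    qed
    then have "int d dvd Gcd ((*) (int k) ` range c)"
      by (auto intro: Gcd_greatest)
    then have "int d dvd int k" by (simp add: Gcd_mult g)
    then show ?thesis using k(1) by (simp add: dvd_imp_le)
  qed
  then show ?thesis
    unfolding exact_denominator_def using assms(1) c by (intro Least_equality) auto
qed

text \<open>Clearing \<open>gamma\<close> by the odd lcm and \<open>beta\<close> by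
  \<open>\<delta>_den\<close> differ only by the power of 2 in n + 1, a unit away from 2.\<close>

lemma gamma_eq_delta_beta:
  "of_nat (odd_lcm n) * Bc.gamma N n =
    mconst (2 ^ multiplicity 2 (n + 1)) * (of_nat (\<delta>_den n) * Bc.beta N n)"
proof -
  have "odd_lcm n * (n + 1) = odd_lcm n * (2 ^ multiplicity 2 (n + 1) * odd_part (n + 1))"
    using odd_part_decompose(1)[of "n + 1"] by simp
  also have "\<dots> = 2 ^ multiplicity 2 (n + 1) * \<delta>_den n"
    by (simp only: \<delta>_den_def mult_ac)
  finally have "of_nat (odd_lcm n) * of_nat (n + 1) =
      (of_nat (2 ^ multiplicity 2 (n + 1)) * of_nat (\<delta>_den n) :: (nat, rat) mpoly)"
    by (simp only: of_nat_mult[symmetric])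
  moreover have "of_nat (2 ^ multiplicity 2 (n + 1)) = (mconst (2 ^ multiplicity 2 (n + 1)) :: (nat, rat) mpoly)"
    by (simp only: mpoly.of_nat[symmetric] of_nat_power of_nat_numeral)
  ultimately show ?thesis
    by (simp only: Bc.gamma_eq mult.assoc[symmetric])
qed

text \<open>The recursion for \<open>beta\<close> gives coefficients in \<open>Z_odd\<close>, the
  convolution for \<open>gamma\<close> gives them in \<open>Z_half\<close>, and the two rings meet
  in Z.\<close>

lemma beta_integral:
  assumes "n \<le> N"
  shows "poly_over_Z_in {1..n} (of_nat (\<delta>_den n) * Bc.beta N n)"
proof -
  let ?V = "{1..n}" and ?p = "of_nat (\<delta>_den n) * Bc.beta N n"
  have coeffs: "R_Bc N $ k \<in> mpoly_over K ?V" if "rat_subring K" "k \<le> n" for k K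
  proof -
    interpret subring_polys K ?V by unfold_locales fact
    show ?thesis
      using that assms of_nat[of 1] var[of k] by (auto simp: R_Bc_def)
  qed
  interpret O: elliptic_type_over "R_Bc N" Z_odd ?V n
    by unfold_locales (fact rat_subring_Z_odd, rule coeffs[OF rat_subring_Z_odd])
  interpret H: elliptic_type_over "R_Bc N" Z_half ?V n
    by unfold_locales (fact rat_subring_Z_half, rule coeffs[OF rat_subring_Z_half])
  have "1 / of_nat (2 * k + 1) \<in> Z_odd" for k
    unfolding Z_odd_def by (auto intro!: exI[of _ "2 * k + 1"] simp del: of_nat_Suc of_nat_add)
  then have O: "?p \<in> mpoly_over Z_odd ?V"
    by (intro O.mult O.of_nat O.beta_in) auto
  have "(1 / 2) \<in> Z_half"
    unfolding Z_half_def by (auto intro!: exI[of _ 1])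
  then have "of_nat (odd_lcm n) * Bc.gamma N n \<in> mpoly_over Z_half ?V"
    by (rule H.gamma_in) (rule dvd_odd_lcm)
  also have "of_nat (odd_lcm n) * Bc.gamma N n = mconst (2 ^ multiplicity 2 (n + 1)) * ?p"
    by (simp only: gamma_eq_delta_beta)
  finally have "?p \<in> mpoly_over Z_half ?V"
    by (rule H.scale[of "1 / 2 ^ multiplicity 2 (n + 1)", rotated 2])
      (auto simp: Z_half_def intro!: exI[of _ "multiplicity 2 (n + 1)"])
  with O show ?thesis
    by (auto simp: poly_over_Z_in_def mpoly_over_def intro: Z_half_Z_odd)
qed

text \<open>A prime dividing all coefficients of the cleared \<open>beta\<close> would divide those
  of the cleared \<open>gamma\<close> too, which excludes odd primes.\<close>

lemma beta_primitive:
  assumes n: "0 < n" "n \<le> N"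
  shows "primitive_over_Z (of_nat (\<delta>_den n) * Bc.beta N n)"
proof -
  let ?p = "of_nat (\<delta>_den n) * Bc.beta N n"
  have "\<forall>m. \<exists>z :: int. Poly_Mapping.lookup ?p m = of_int z"
    using beta_integral[OF n(2)] unfolding poly_over_Z_in_def by (metis Ints_cases)
  then obtain c :: "_ \<Rightarrow> int" where c: "\<And>m. Poly_Mapping.lookup ?p m = of_int (c m)"
    by metis
  have L: "of_nat (odd_lcm n) * Poly_Mapping.lookup (Bc.gamma N n) \<mu> = of_int (2 ^ multiplicity 2 (n + 1) * c \<mu>)" for \<mu>
    using arg_cong[OF gamma_eq_delta_beta[of n N], of "\<lambda>p. Poly_Mapping.lookup p \<mu>"]
    by (simp only: lookup_of_nat_mult[of "odd_lcm n"] lookup_mconst_mult c) simp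
  have "Gcd (range c) = 1"
  proof (rule ccontr)
    assume "Gcd (range c) \<noteq> 1"
    then have "nat (Gcd (range c)) \<noteq> 1" by (metis Gcd_int_greater_eq_0 int_nat_eq of_nat_1)
    then obtain p where p: "prime p" "p dvd nat (Gcd (range c))"
      using prime_factor_nat by blast
    then have "int p dvd Gcd (range c)"
      by (metis Gcd_int_greater_eq_0 int_dvd_int_iff int_nat_eq)
    then have pc: "int p dvd c \<mu>" for \<mu>
      by (rule dvd_GcdD) simp
    show False
    proof (cases "odd p")
      case True
      obtain \<mu> where "\<And>z. of_nat (odd_lcm n) * Poly_Mapping.lookup (Bc.gamma N n) \<mu> \<noteq> of_int (int p * z)"
        using odd_prime_not_dvd_gamma[OF p(1) True n] by blast
      moreover obtain z where "c \<mu> = int p * z" using pc[of \<mu>] by (auto elim: dvdE)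
      ultimately show False unfolding L by (metis mult.left_commute)
    next
      case False
      then have p2: "p = 2" using p(1) prime_odd_nat[of p] prime_ge_2_nat[of p] by fastforce
      \<comment> \<open>The coefficient of a_n in the cleared \<open>beta\<close> is
        -\<open>\<delta>_den n\<close> / (2 n + 1), an odd integer.\<close>
      let ?\<mu> = "Poly_Mapping.single n (1 :: nat)"
      have "of_nat (n + 1) * of_int (c ?\<mu>) = of_nat (\<delta>_den n) * Poly_Mapping.lookup (Bc.gamma N n) ?\<mu>"
        unfolding Bc.gamma_eq lookup_of_nat_mult c[symmetric] by (simp only: mult_ac)
      also have "\<dots> = of_nat (n + 1) * - (of_nat (\<delta>_den n) / of_nat (2 * n + 1))"
        unfolding lookup_gamma_linear[OF n] by simp
      finally have "of_int (c ?\<mu>) = - (of_nat (\<delta>_den n) / of_nat (2 * n + 1) :: rat)"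
        by (rule mult_left_cancel[THEN iffD1, rotated]) (simp del: of_nat_Suc of_nat_add)
      then have "of_nat (2 * n + 1) * of_int (c ?\<mu>) = (- of_nat (\<delta>_den n) :: rat)"
        by (simp add: field_simps del: of_nat_Suc of_nat_add of_nat_mult)
      then have "of_int (int (2 * n + 1) * c ?\<mu>) = (of_int (- int (\<delta>_den n)) :: rat)"
        by simp
      then have "int (2 * n + 1) * c ?\<mu> = - int (\<delta>_den n)"
        by (simp only: of_int_eq_iff)
      moreover have "odd (\<delta>_den n)"
        using odd_odd_lcm[of n] odd_part_decompose(2)[of "n + 1"] by (simp add: \<delta>_den_def)
      ultimately have "odd (c ?\<mu>)" by (metis even_minus even_mult_iff even_of_nat)
      then show False using pc[of ?\<mu>] p2 by simp
    qed
  qed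
  then show ?thesis unfolding primitive_over_Z_def using c by blast
qed

theorem theorem2p5p6:
  fixes n :: nat
  assumes "n \<ge> 1"
  shows "(\<forall>N\<ge>n. poly_over_Z_in {1..n} (of_nat (\<delta>_den n) * Bc N (b_U n)) \<and>
                 primitive_over_Z (of_nat (\<delta>_den n) * Bc N (b_U n)) \<and>
                 exact_denominator (Bc N (b_U n)) = \<delta>_den n) \<and>
         exact_denominator (Bc n (b_U n)) = odd_part (d_den n)"
proof -
  have "0 < \<delta>_den n"
    using odd_odd_lcm[of n] odd_part_decompose(2)[of "n + 1"] by (auto simp: \<delta>_den_def intro: odd_pos)
  then have "poly_over_Z_in {1..n} (of_nat (\<delta>_den n) * Bc N (b_U n)) \<and>
      primitive_over_Z (of_nat (\<delta>_den n) * Bc N (b_U n)) \<and>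
      exact_denominator (Bc N (b_U n)) = \<delta>_den n" if "n \<le> N" for N
    using beta_integral[OF that] beta_primitive[of n N] that assms
    by (simp add: Bc_b_U exact_denominator_eqI flip: Bc.beta_def)
  then show ?thesis by (simp add: odd_part_d_den)
qed

end
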